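(* Let $(\mathfrak{g}_\sigma,\mathfrak{q},\mathfrak{h}_\sigma)$ be a parabolic $CR$-triple with root system $\mathcal{R}=\mathcal{R}(\mathfrak{g},\mathfrak{h})$, parabolic set $\mathcal{Q}=\{\alpha\in\mathcal{R}\mid\mathfrak{g}^\alpha\subseteq\mathfrak{q}\}$ and induced involution $\mathrm{s}$ of $\mathcal{R}$. For $w$ in the Weyl group $\mathbf{W}(\mathcal{R})$ let $\mathfrak{q}_w=\mathfrak{h}\oplus\sum_{\alpha\in w(\mathcal{Q})}\mathfrak{g}^\alpha$. If $\dim_\mathbb{R}(\mathfrak{g}_\sigma,\mathfrak{q})\le\dim_\mathbb{R}(\mathfrak{g}_\sigma,\mathfrak{q}_w)$ for all $w\in\mathbf{W}(\mathcal{R})$, then the triple is of minimal type, i.e. every root $\alpha\in\mathcal{Q}^n$ with $\mathrm{s}(\alpha)\notin\mathcal{Q}$ satisfies $\mathrm{s}(\alpha)=-\alpha$.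
   Context: $\mathfrak{g}$ is a complex semisimple Lie algebra, $\sigma$ an anti-$\mathbb{C}$-linear involution, $\mathfrak{g}_\sigma$ its fixed-point real form, $\mathfrak{q}$ a parabolic subalgebra of $\mathfrak{g}$. A parabolic $CR$-triple $(\mathfrak{g}_\sigma,\mathfrak{q},\mathfrak{h}_\sigma)$ consists of such data and a Cartan subalgebra $\mathfrak{h}_\sigma$ of $\mathfrak{g}_\sigma$ contained in $\mathfrak{q}\cap\mathfrak{g}_\sigma$; $\mathfrak{h}$ is its complexification, $\mathfrak{g}^\alpha$ the root spaces. Since $\sigma(\mathfrak{h})=\mathfrak{h}$, $\sigma$ induces an involution $\mathrm{s}$ of $\mathcal{R}$ determined by $\sigma(\mathfrak{g}^\alpha)=\mathfrak{g}^{\mathrm{s}(\alpha)}$. $\mathcal{Q}^n=\{\alpha\in\mathcal{Q}\mid-\alpha\notin\mathcal{Q}\}$. For a complex subalgebra $\mathfrak{q}'$ of $\mathfrak{g}$, $\dim_\mathbb{R}(\mathfrak{g}_\sigma,\mathfrak{q}')=\dim_\mathbb{C}\mathfrak{g}-\dim_\mathbb{C}(\mathfrak{q}'\cap\sigma(\mathfrak{q}'))$ (the real dimension of the corresponding homogeneous $CR$-manifold). *)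

theory Defs
  imports "HOL-Analysis.Analysis"
begin

text \<open>A complex Lie algebra is modelled by a type 'g of class ab_group_add with a
complex scalar multiplication sm (satisfying the vector space axioms) and a bracket br.
Complex spans/dimensions use the library locale vector_space, instantiated with sm;
real spans use the restriction of sm to real scalars.\<close>

definition cspan :: "(complex \<Rightarrow> 'g::ab_group_add \<Rightarrow> 'g) \<Rightarrow> 'g set \<Rightarrow> 'g set" where
  "cspan sm A = module.span sm A"

definition cdim :: "(complex \<Rightarrow> 'g::ab_group_add \<Rightarrow> 'g) \<Rightarrow> 'g set \<Rightarrow> nat" where
  "cdim sm A = vector_space.dim sm A"

definition rspan :: "(complex \<Rightarrow> 'g::ab_group_add \<Rightarrow> 'g) \<Rightarrow> 'g set \<Rightarrow> 'g set" where
  "rspan sm A = module.span (\<lambda>r::real. sm (complex_of_real r)) A"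

definition brs :: "('g \<Rightarrow> 'g \<Rightarrow> 'g) \<Rightarrow> 'g set \<Rightarrow> 'g set \<Rightarrow> 'g set" where
  "brs br A B = {br x y | x y. x \<in> A \<and> y \<in> B}"

definition lie_algebra :: "(complex \<Rightarrow> 'g::ab_group_add \<Rightarrow> 'g) \<Rightarrow> ('g \<Rightarrow> 'g \<Rightarrow> 'g) \<Rightarrow> bool" where
  "lie_algebra sm br \<longleftrightarrow> vector_space sm
     \<and> (\<forall>x y z. br (x + y) z = br x z + br y z)
     \<and> (\<forall>x y z. br x (y + z) = br x y + br x z)
     \<and> (\<forall>c x y. br (sm c x) y = sm c (br x y))
     \<and> (\<forall>c x y. br x (sm c y) = sm c (br x y))
     \<and> (\<forall>x. br x x = 0)
     \<and> (\<forall>x y z. br x (br y z) + br y (br z x) + br z (br x y) = 0)"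

definition fin_dim :: "(complex \<Rightarrow> 'g::ab_group_add \<Rightarrow> 'g) \<Rightarrow> bool" where
  "fin_dim sm \<longleftrightarrow> (\<exists>B. finite B \<and> cspan sm B = UNIV)"

definition csubspace :: "(complex \<Rightarrow> 'g::ab_group_add \<Rightarrow> 'g) \<Rightarrow> 'g set \<Rightarrow> bool" where
  "csubspace sm S = module.subspace sm S"

definition rsubspace :: "(complex \<Rightarrow> 'g::ab_group_add \<Rightarrow> 'g) \<Rightarrow> 'g set \<Rightarrow> bool" where
  "rsubspace sm S = module.subspace (\<lambda>r::real. sm (complex_of_real r)) S"

definition subalgebra :: "(complex \<Rightarrow> 'g::ab_group_add \<Rightarrow> 'g) \<Rightarrow> ('g \<Rightarrow> 'g \<Rightarrow> 'g) \<Rightarrow> 'g set \<Rightarrow> bool" where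
  "subalgebra sm br S \<longleftrightarrow> csubspace sm S \<and> brs br S S \<subseteq> S"

definition lie_ideal :: "(complex \<Rightarrow> 'g::ab_group_add \<Rightarrow> 'g) \<Rightarrow> ('g \<Rightarrow> 'g \<Rightarrow> 'g) \<Rightarrow> 'g set \<Rightarrow> bool" where
  "lie_ideal sm br S \<longleftrightarrow> csubspace sm S \<and> brs br UNIV S \<subseteq> S"

fun derived :: "(complex \<Rightarrow> 'g::ab_group_add \<Rightarrow> 'g) \<Rightarrow> ('g \<Rightarrow> 'g \<Rightarrow> 'g) \<Rightarrow> 'g set \<Rightarrow> nat \<Rightarrow> 'g set" where
  "derived sm br S 0 = S"
| "derived sm br S (Suc k) = cspan sm (brs br (derived sm br S k) (derived sm br S k))"

definition solvable :: "(complex \<Rightarrow> 'g::ab_group_add \<Rightarrow> 'g) \<Rightarrow> ('g \<Rightarrow> 'g \<Rightarrow> 'g) \<Rightarrow> 'g set \<Rightarrow> bool" where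
  "solvable sm br S \<longleftrightarrow> (\<exists>k. derived sm br S k = {0})"

definition semisimple :: "(complex \<Rightarrow> 'g::ab_group_add \<Rightarrow> 'g) \<Rightarrow> ('g \<Rightarrow> 'g \<Rightarrow> 'g) \<Rightarrow> bool" where
  "semisimple sm br \<longleftrightarrow> lie_algebra sm br \<and> fin_dim sm
     \<and> (\<forall>I. lie_ideal sm br I \<and> solvable sm br I \<longrightarrow> I = {0})"

definition borel :: "(complex \<Rightarrow> 'g::ab_group_add \<Rightarrow> 'g) \<Rightarrow> ('g \<Rightarrow> 'g \<Rightarrow> 'g) \<Rightarrow> 'g set \<Rightarrow> bool" where
  "borel sm br B \<longleftrightarrow> subalgebra sm br B \<and> solvable sm br B
     \<and> (\<forall>S. subalgebra sm br S \<and> solvable sm br S \<and> B \<subseteq> S \<longrightarrow> S = B)"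

definition parabolic :: "(complex \<Rightarrow> 'g::ab_group_add \<Rightarrow> 'g) \<Rightarrow> ('g \<Rightarrow> 'g \<Rightarrow> 'g) \<Rightarrow> 'g set \<Rightarrow> bool" where
  "parabolic sm br q \<longleftrightarrow> subalgebra sm br q \<and> (\<exists>B. borel sm br B \<and> B \<subseteq> q)"

definition anti_involution :: "(complex \<Rightarrow> 'g::ab_group_add \<Rightarrow> 'g) \<Rightarrow> ('g \<Rightarrow> 'g \<Rightarrow> 'g) \<Rightarrow> ('g \<Rightarrow> 'g) \<Rightarrow> bool" where
  "anti_involution sm br \<sigma> \<longleftrightarrow>
     (\<forall>x y. \<sigma> (x + y) = \<sigma> x + \<sigma> y)
     \<and> (\<forall>c x. \<sigma> (sm c x) = sm (cnj c) (\<sigma> x))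
     \<and> (\<forall>x. \<sigma> (\<sigma> x) = x)
     \<and> (\<forall>x y. \<sigma> (br x y) = br (\<sigma> x) (\<sigma> y))"

definition real_form :: "('g \<Rightarrow> 'g) \<Rightarrow> 'g set" where
  "real_form \<sigma> = {x. \<sigma> x = x}"

definition rsubalgebra :: "(complex \<Rightarrow> 'g::ab_group_add \<Rightarrow> 'g) \<Rightarrow> ('g \<Rightarrow> 'g \<Rightarrow> 'g) \<Rightarrow> 'g set \<Rightarrow> bool" where
  "rsubalgebra sm br S \<longleftrightarrow> rsubspace sm S \<and> brs br S S \<subseteq> S"

fun lcs :: "(complex \<Rightarrow> 'g::ab_group_add \<Rightarrow> 'g) \<Rightarrow> ('g \<Rightarrow> 'g \<Rightarrow> 'g) \<Rightarrow> 'g set \<Rightarrow> nat \<Rightarrow> 'g set" where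
  "lcs sm br S 0 = S"
| "lcs sm br S (Suc k) = rspan sm (brs br S (lcs sm br S k))"

definition rnilpotent :: "(complex \<Rightarrow> 'g::ab_group_add \<Rightarrow> 'g) \<Rightarrow> ('g \<Rightarrow> 'g \<Rightarrow> 'g) \<Rightarrow> 'g set \<Rightarrow> bool" where
  "rnilpotent sm br S \<longleftrightarrow> (\<exists>k. lcs sm br S k = {0})"

definition real_cartan :: "(complex \<Rightarrow> 'g::ab_group_add \<Rightarrow> 'g) \<Rightarrow> ('g \<Rightarrow> 'g \<Rightarrow> 'g) \<Rightarrow> 'g set \<Rightarrow> 'g set \<Rightarrow> bool" where
  "real_cartan sm br L H \<longleftrightarrow> H \<subseteq> L \<and> rsubalgebra sm br H \<and> rnilpotent sm br H
     \<and> {x \<in> L. brs br {x} H \<subseteq> H} = H"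

text \<open>Roots: functionals on h, represented as functions 'g \<Rightarrow> complex vanishing outside h.\<close>
definition rootspace :: "(complex \<Rightarrow> 'g::ab_group_add \<Rightarrow> 'g) \<Rightarrow> ('g \<Rightarrow> 'g \<Rightarrow> 'g) \<Rightarrow> 'g set \<Rightarrow> ('g \<Rightarrow> complex) \<Rightarrow> 'g set" where
  "rootspace sm br h \<alpha> = {x. \<forall>y\<in>h. br y x = sm (\<alpha> y) x}"

definition roots :: "(complex \<Rightarrow> 'g::ab_group_add \<Rightarrow> 'g) \<Rightarrow> ('g \<Rightarrow> 'g \<Rightarrow> 'g) \<Rightarrow> 'g set \<Rightarrow> ('g \<Rightarrow> complex) set" where
  "roots sm br h = {\<alpha>. (\<forall>x. x \<notin> h \<longrightarrow> \<alpha> x = 0) \<and> (\<exists>y\<in>h. \<alpha> y \<noteq> 0)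
      \<and> rootspace sm br h \<alpha> \<noteq> {0}}"

definition root_inv :: "(complex \<Rightarrow> 'g::ab_group_add \<Rightarrow> 'g) \<Rightarrow> ('g \<Rightarrow> 'g \<Rightarrow> 'g) \<Rightarrow> 'g set \<Rightarrow> ('g \<Rightarrow> 'g)
    \<Rightarrow> ('g \<Rightarrow> complex) \<Rightarrow> ('g \<Rightarrow> complex)" where
  "root_inv sm br h \<sigma> \<alpha> = (THE \<beta>. \<beta> \<in> roots sm br h \<and> \<sigma> ` rootspace sm br h \<alpha> = rootspace sm br h \<beta>)"

definition coroot :: "(complex \<Rightarrow> 'g::ab_group_add \<Rightarrow> 'g) \<Rightarrow> ('g \<Rightarrow> 'g \<Rightarrow> 'g) \<Rightarrow> 'g set \<Rightarrow> ('g \<Rightarrow> complex) \<Rightarrow> 'g" where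
  "coroot sm br h \<alpha> = (THE t. t \<in> cspan sm (brs br (rootspace sm br h \<alpha>) (rootspace sm br h (- \<alpha>)))
       \<and> \<alpha> t = 2)"

definition reflection :: "(complex \<Rightarrow> 'g::ab_group_add \<Rightarrow> 'g) \<Rightarrow> ('g \<Rightarrow> 'g \<Rightarrow> 'g) \<Rightarrow> 'g set \<Rightarrow> ('g \<Rightarrow> complex)
    \<Rightarrow> ('g \<Rightarrow> complex) \<Rightarrow> ('g \<Rightarrow> complex)" where
  "reflection sm br h \<alpha> \<beta> = (\<lambda>x. \<beta> x - \<beta> (coroot sm br h \<alpha>) * \<alpha> x)"

inductive_set weyl :: "(complex \<Rightarrow> 'g::ab_group_add \<Rightarrow> 'g) \<Rightarrow> ('g \<Rightarrow> 'g \<Rightarrow> 'g) \<Rightarrow> 'g set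
    \<Rightarrow> (('g \<Rightarrow> complex) \<Rightarrow> ('g \<Rightarrow> complex)) set" for sm br h where
  weyl_id: "id \<in> weyl sm br h"
| weyl_step: "\<alpha> \<in> roots sm br h \<Longrightarrow> w \<in> weyl sm br h \<Longrightarrow> reflection sm br h \<alpha> \<circ> w \<in> weyl sm br h"

definition parabolic_set :: "(complex \<Rightarrow> 'g::ab_group_add \<Rightarrow> 'g) \<Rightarrow> ('g \<Rightarrow> 'g \<Rightarrow> 'g) \<Rightarrow> 'g set \<Rightarrow> 'g set
    \<Rightarrow> ('g \<Rightarrow> complex) set" where
  "parabolic_set sm br h q = {\<alpha> \<in> roots sm br h. rootspace sm br h \<alpha> \<subseteq> q}"

definition nilpart :: "('g \<Rightarrow> complex) set \<Rightarrow> ('g \<Rightarrow> complex) set" where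
  "nilpart Q = {\<alpha> \<in> Q. - \<alpha> \<notin> Q}"

definition q_w :: "(complex \<Rightarrow> 'g::ab_group_add \<Rightarrow> 'g) \<Rightarrow> ('g \<Rightarrow> 'g \<Rightarrow> 'g) \<Rightarrow> 'g set \<Rightarrow> ('g \<Rightarrow> complex) set
    \<Rightarrow> (('g \<Rightarrow> complex) \<Rightarrow> ('g \<Rightarrow> complex)) \<Rightarrow> 'g set" where
  "q_w sm br h Q w = cspan sm (h \<union> \<Union> {rootspace sm br h \<beta> | \<beta>. \<beta> \<in> w ` Q})"

definition cr_dim :: "(complex \<Rightarrow> 'g::ab_group_add \<Rightarrow> 'g) \<Rightarrow> ('g \<Rightarrow> 'g) \<Rightarrow> 'g set \<Rightarrow> int" where
  "cr_dim sm \<sigma> q' = int (cdim sm UNIV) - int (cdim sm (q' \<inter> \<sigma> ` q'))"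

end

theory Submission
  imports Defs "HOL-Computational_Algebra.Fundamental_Theorem_Algebra"
begin

text \<open>Call a root \<open>\<alpha>\<close> bad if \<open>\<alpha> \<in> Q\<^sup>n\<close>, \<open>s \<alpha> \<notin> Q\<close> and \<open>s \<alpha> \<noteq> -\<alpha>\<close>. Since all root spaces are lines,
  minimality of the dimension means that \<open>w = id\<close> maximizes \<open>|w Q \<inter> s (w Q)|\<close>, and it suffices to show that a
  reflection \<open>r\<close> in a suitable bad root \<open>\<alpha>\<close> increases this number. This is a two-point rearrangement
  (polarization) argument applied twice: \<open>Q\<close> and \<open>s Q\<close> lie on opposite sides of the wall of \<open>\<alpha>\<close>, hence
  \<open>|Q \<inter> s Q| < |Q \<inter> r s Q| = |Q \<inter> s r Q|\<close>; and \<open>Q\<close> and \<open>s r Q\<close> lie on (weakly) opposite sides as soon as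
  \<open>-r (s \<alpha>) \<in> Q\<close>, whence \<open>|Q \<inter> s r Q| \<le> |Q \<inter> r s r Q| = |r Q \<inter> s r Q|\<close>. As \<open>s\<close> is isometric, the Cartan
  integer of \<open>s \<alpha>\<close> and \<open>\<alpha>\<close> is at least \<open>-1\<close>, and this makes the extra condition true for \<open>\<alpha>\<close> or for the
  bad root \<open>-s \<alpha>\<close>.

  The structure theory behind this (Cartan's criterion, root decomposition, \<open>Q \<union> -Q = R\<close>) is obtained inside
  the adjoint representation: every module needed is a subquotient \<open>V / U\<close> of the Lie algebra itself.\<close>

section \<open>Traces and generalized eigenspaces\<close>

text \<open>The definitions give little: a Cartan subalgebra is nilpotent and self-normalizing, a
  parabolic contains a maximal solvable subalgebra, a root is a mere function. One construction
  bridges the gap: an operator acting as \<open>\<phi> c\<close> on the generalized eigenspace for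
  \<open>c\<close> of a given operator. With \<open>\<phi> = cnj\<close> it is the test operator of
  Cartan's criterion. With the identity it is the semisimple part of \<open>br x\<close>, which is a
  derivation, hence inner, and this makes the Cartan subalgebra act diagonally. It takes the place
  of the Jordan decomposition. Parabolicity enters the counting through two facts: a root string
  started in \<open>Q\<close> by adding a root of \<open>Q\<close> stays in \<open>Q\<close>, so
  certain reflections preserve membership, and of two opposite roots at least one lies in
  \<open>Q\<close>. The obstacle is the second comparison. The side on which \<open>s r Q\<close>
  lies is governed by the reflected root \<open>r (s \<alpha>)\<close>, about which badness of
  \<open>\<alpha>\<close> says nothing; this is why the bad root has to be chosen.\<close>

locale fd_cspace = finite_dimensional_vector_space sm Basis
  for sm :: "complex \<Rightarrow> 'g::ab_group_add \<Rightarrow> 'g" (infixr \<open>\<cdot>\<close> 75) and Basis :: "'g set"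
begin

section \<open>Linear maps, spans and traces on invariant subspaces\<close>

definition lin :: "('g \<Rightarrow> 'g) \<Rightarrow> bool" where
  "lin T \<longleftrightarrow> (\<forall>x y. T (x + y) = T x + T y) \<and> (\<forall>c x. T (c \<cdot> x) = c \<cdot> T x)"

lemma linI:
  "(\<And>x y. T (x + y) = T x + T y) \<Longrightarrow> (\<And>c x. T (c \<cdot> x) = c \<cdot> T x) \<Longrightarrow> lin T"
  by (simp add: lin_def)

lemma lin_add: "lin T \<Longrightarrow> T (x + y) = T x + T y"
  and lin_scale: "lin T \<Longrightarrow> T (c \<cdot> x) = c \<cdot> T x"
  by (simp_all add: lin_def)

lemma lin_0: "lin T \<Longrightarrow> T 0 = 0"
  by (metis lin_scale scale_zero_left)

lemma lin_minus: "lin T \<Longrightarrow> T (- x) = - T x"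
  by (metis lin_scale scale_minus_left scale_one)

lemma lin_diff: "lin T \<Longrightarrow> T (x - y) = T x - T y"
  by (metis lin_add lin_minus diff_conv_add_uminus)

lemma lin_sum: "lin T \<Longrightarrow> T (sum f A) = (\<Sum>i\<in>A. T (f i))"
  by (induction A rule: infinite_finite_induct) (auto simp: lin_0 lin_add)

lemma lin_lincomb: "lin T \<Longrightarrow> T (\<Sum>i\<in>A. r i \<cdot> f i) = (\<Sum>i\<in>A. r i \<cdot> T (f i))"
  by (simp add: lin_sum lin_scale)

lemma lin_comp: "lin S \<Longrightarrow> lin T \<Longrightarrow> lin (S \<circ> T)"
  by (simp add: lin_def)

lemma lin_shift: "lin T \<Longrightarrow> lin (\<lambda>v. T v - c \<cdot> v)"
  by (rule linI) (auto simp: lin_add lin_scale algebra_simps)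

lemma subspace_preimage: "lin T \<Longrightarrow> subspace U \<Longrightarrow> subspace {v. T v \<in> U}"
  by (auto simp: subspace_def lin_0 lin_add lin_scale)

lemma lin_span_subset:
  assumes "lin T" "subspace U" "\<And>v. v \<in> A \<Longrightarrow> T v \<in> U" "v \<in> span A"
  shows "T v \<in> U"
proof -
  have "span A \<subseteq> {v. T v \<in> U}"
    by (rule span_minimal) (use assms subspace_preimage in auto)
  with assms(4) show ?thesis by auto
qed

lemma in_span_insertE:
  assumes "subspace U" "v \<in> span (insert x U)"
  obtains k u where "u \<in> U" "v = u + k \<cdot> x"
  using assms by (metis span_breakdown_eq span_eq_iff diff_add_cancel)

lemma finite_subspace_basis:
  assumes "subspace M"
  obtains B where "finite B" "independent B" "span B = M" "card B = dim M"
  using basis_subspace_exists[OF assms] by metis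

text \<open>Operators remain total functions and the subspace is an argument, so invariant subspaces
  need no types of their own. For a linear map preserving \<open>M\<close> the chosen basis is
  immaterial by \<open>tr_basis\<close>.\<close>

definition tr :: "'g set \<Rightarrow> ('g \<Rightarrow> 'g) \<Rightarrow> complex" where
  "tr M T = (let B = (SOME B. finite B \<and> independent B \<and> span B = M)
             in \<Sum>b\<in>B. representation B (T b) b)"

lemma rep_expand:
  assumes "finite B" "independent B" "v \<in> span B"
  shows "(\<Sum>b\<in>B. representation B v b \<cdot> b) = v"
  using sum_representation_eq[OF assms(2,3,1)] by simp

lemma representation_lincomb:
  assumes "independent B" "\<And>i. i \<in> A \<Longrightarrow> f i \<in> span B"
  shows "representation B (\<Sum>i\<in>A. r i \<cdot> f i) b = (\<Sum>i\<in>A. r i * representation B (f i) b)"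
proof -
  have "representation B (\<Sum>i\<in>A. r i \<cdot> f i) = (\<lambda>b. \<Sum>i\<in>A. representation B (r i \<cdot> f i) b)"
    by (rule representation_sum[OF assms(1)]) (simp add: assms(2) span_scale)
  then show ?thesis
    by (simp add: representation_scale[OF assms(1)] assms(2))
qed

text \<open>Writing \<open>T b\<close> in the basis \<open>C\<close> and each \<open>c\<close> in
  the basis \<open>B\<close> turns both traces into the same double sum of products of
  coordinates.\<close>

lemma tr_basis:
  assumes B: "finite B" "independent B" "span B = M" and T: "lin T" "\<And>v. v \<in> M \<Longrightarrow> T v \<in> M"
  shows "tr M T = (\<Sum>b\<in>B. representation B (T b) b)"
proof -
  define C where "C = (SOME B. finite B \<and> independent B \<and> span B = M)"
  have C: "finite C" "independent C" "span C = M"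
    using someI[of "\<lambda>B. finite B \<and> independent B \<and> span B = M" B] B by (auto simp: C_def)
  have inC: "c \<in> C \<Longrightarrow> c \<in> M" for c using C span_base by blast
  have inB: "c \<in> B \<Longrightarrow> c \<in> M" for c using B span_base by blast
  have 1: "representation B (T b) b
      = (\<Sum>c\<in>C. representation C (T b) c * representation B c b)" if "b \<in> B" for b
  proof -
    have "T b = (\<Sum>c\<in>C. representation C (T b) c \<cdot> c)"
      using rep_expand[OF C(1,2), of "T b"] C T(2) inB[OF that] by simp
    then have "representation B (T b) b = representation B (\<Sum>c\<in>C. representation C (T b) c \<cdot> c) b"
      by simp
    also have "\<dots> = (\<Sum>c\<in>C. representation C (T b) c * representation B c b)"
      by (rule representation_lincomb[OF B(2)]) (simp add: B(3) inC)
    finally show ?thesis .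
  qed
  have 2: "representation C (T c) c
      = (\<Sum>b\<in>B. representation C (T b) c * representation B c b)" if "c \<in> C" for c
  proof -
    have "c = (\<Sum>b\<in>B. representation B c b \<cdot> b)"
      using rep_expand[OF B(1,2), of c] B inC[OF that] by simp
    from arg_cong[OF this, of T] have "T c = (\<Sum>b\<in>B. representation B c b \<cdot> T b)"
      by (simp only: lin_lincomb[OF T(1)])
    then have "representation C (T c) c = representation C (\<Sum>b\<in>B. representation B c b \<cdot> T b) c"
      by simp
    also have "\<dots> = (\<Sum>b\<in>B. representation B c b * representation C (T b) c)"
      by (rule representation_lincomb[OF C(2)]) (simp add: C(3) inB T(2))
    finally show ?thesis by (simp add: mult.commute)
  qed
  have "tr M T = (\<Sum>c\<in>C. representation C (T c) c)"
    by (simp add: tr_def C_def Let_def)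
  also have "\<dots> = (\<Sum>c\<in>C. \<Sum>b\<in>B. representation C (T b) c * representation B c b)"
    using 2 by simp
  also have "\<dots> = (\<Sum>b\<in>B. \<Sum>c\<in>C. representation C (T b) c * representation B c b)"
    by (rule sum.swap)
  also have "\<dots> = (\<Sum>b\<in>B. representation B (T b) b)"
    using 1 by simp
  finally show ?thesis .
qed

lemma tr_commute:
  assumes M: "subspace M" and S: "lin S" "\<And>v. v \<in> M \<Longrightarrow> S v \<in> M"
    and T: "lin T" "\<And>v. v \<in> M \<Longrightarrow> T v \<in> M"
  shows "tr M (S \<circ> T) = tr M (T \<circ> S)"
proof -
  obtain B where B: "finite B" "independent B" "span B = M"
    using finite_subspace_basis[OF M] by blast
  have inB: "c \<in> B \<Longrightarrow> c \<in> M" for c using B span_base by blast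
  have *: "representation B (S (T b)) b
      = (\<Sum>c\<in>B. representation B (T b) c * representation B (S c) b)"
    if ST: "lin S" "\<And>v. v \<in> M \<Longrightarrow> S v \<in> M" "\<And>v. v \<in> M \<Longrightarrow> T v \<in> M" and "b \<in> B" for b S T
  proof -
    have "T b = (\<Sum>c\<in>B. representation B (T b) c \<cdot> c)"
      using rep_expand[OF B(1,2), of "T b"] B ST inB that by simp
    from arg_cong[OF this, of S] have "S (T b) = (\<Sum>c\<in>B. representation B (T b) c \<cdot> S c)"
      by (simp only: lin_lincomb[OF ST(1)])
    then have "representation B (S (T b)) b = representation B (\<Sum>c\<in>B. representation B (T b) c \<cdot> S c) b"
      by simp
    also have "\<dots> = (\<Sum>c\<in>B. representation B (T b) c * representation B (S c) b)"
      by (rule representation_lincomb[OF B(2)]) (simp add: B(3) inB ST(2))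
    finally show ?thesis .
  qed
  have "tr M (S \<circ> T) = (\<Sum>b\<in>B. \<Sum>c\<in>B. representation B (T b) c * representation B (S c) b)"
    using S T by (subst tr_basis[OF B]) (auto simp: lin_comp * S T)
  also have "\<dots> = (\<Sum>c\<in>B. \<Sum>b\<in>B. representation B (S c) b * representation B (T b) c)"
    by (subst sum.swap) (simp add: mult.commute)
  also have "\<dots> = tr M (T \<circ> S)"
    using S T by (subst tr_basis[OF B]) (auto simp: lin_comp * S T)
  finally show ?thesis .
qed

lemma tr_add:
  assumes M: "subspace M" and S: "lin S" "\<And>v. v \<in> M \<Longrightarrow> S v \<in> M"
    and T: "lin T" "\<And>v. v \<in> M \<Longrightarrow> T v \<in> M"
  shows "tr M (\<lambda>v. S v + T v) = tr M S + tr M T"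
proof -
  obtain B where B: "finite B" "independent B" "span B = M"
    using finite_subspace_basis[OF M] by blast
  have inB: "c \<in> B \<Longrightarrow> c \<in> M" for c using B span_base by blast
  have "lin (\<lambda>v. S v + T v)"
    using S T by (intro linI) (auto simp: lin_add lin_scale algebra_simps)
  then show ?thesis
    using S T B inB M
    by (simp add: tr_basis[OF B] subspace_add representation_add sum.distrib)
qed

lemma tr_scale:
  assumes M: "subspace M" and S: "lin S" "\<And>v. v \<in> M \<Longrightarrow> S v \<in> M"
  shows "tr M (\<lambda>v. c \<cdot> S v) = c * tr M S"
proof -
  obtain B where B: "finite B" "independent B" "span B = M"
    using finite_subspace_basis[OF M] by blast
  have inB: "c \<in> B \<Longrightarrow> c \<in> M" for c using B span_base by blast
  have "lin (\<lambda>v. c \<cdot> S v)"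
    using S by (intro linI) (auto simp: lin_add lin_scale algebra_simps)
  then show ?thesis
    using S B inB M
    by (simp add: tr_basis[OF B] subspace_scale representation_scale sum_distrib_left)
qed

lemma tr_diff:
  assumes M: "subspace M" and S: "lin S" "\<And>v. v \<in> M \<Longrightarrow> S v \<in> M"
    and T: "lin T" "\<And>v. v \<in> M \<Longrightarrow> T v \<in> M"
  shows "tr M (\<lambda>v. S v - T v) = tr M S - tr M T"
proof -
  have "lin (\<lambda>v. (-1) \<cdot> T v)"
    using T by (intro linI) (auto simp: lin_add lin_scale algebra_simps)
  from tr_add[OF M S this] tr_scale[OF M T, of "-1"] T(2) show ?thesis
    by (auto simp: scale_minus_left subspace_neg[OF M])
qed

lemma tr_commutator:
  assumes M: "subspace M" and S: "lin S" "\<And>v. v \<in> M \<Longrightarrow> S v \<in> M"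
    and T: "lin T" "\<And>v. v \<in> M \<Longrightarrow> T v \<in> M"
  shows "tr M (\<lambda>v. S (T v) - T (S v)) = 0"
  using tr_diff[OF M lin_comp[OF S(1) T(1)] _ lin_comp[OF T(1) S(1)]] tr_commute[OF M S T] S T
  by simp

lemma tr_scalar:
  assumes M: "subspace M" and S: "lin S" "\<And>v. v \<in> M \<Longrightarrow> S v = c \<cdot> v"
  shows "tr M S = c * of_nat (dim M)"
proof -
  obtain B where B: "finite B" "independent B" "span B = M" "card B = dim M"
    using finite_subspace_basis[OF M] by blast
  have inB: "c \<in> B \<Longrightarrow> c \<in> M" for c using B span_base by blast
  have "tr M S = (\<Sum>b\<in>B. representation B (S b) b)"
    using S M by (subst tr_basis[OF B(1-3)]) (auto intro: subspace_scale)
  also have "\<dots> = (\<Sum>b\<in>B. c)"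
    using S(2) inB B by (intro sum.cong) (auto simp: representation_scale representation_basis)
  finally show ?thesis using B(4) by (simp add: mult.commute)
qed

lemma tr_zero_space: "lin T \<Longrightarrow> tr {0} T = 0"
  by (subst tr_basis[of "{}"]) (auto simp: lin_0 independent_empty)

text \<open>Modulo \<open>U\<close> the operator is the scalar \<open>c\<close> on the added line,
  so its matrix is block triangular. Trace computations along a flag are built from this
  step.\<close>

lemma tr_insert:
  assumes U: "subspace U" and x: "x \<notin> U" and T: "lin T" "\<And>v. v \<in> U \<Longrightarrow> T v \<in> U"
    and Tx: "T x - c \<cdot> x \<in> U"
  shows "tr (span (insert x U)) T = tr U T + c"
proof -
  obtain B where B: "finite B" "independent B" "span B = U"
    using finite_subspace_basis[OF U] by blast
  have inB: "c \<in> B \<Longrightarrow> c \<in> U" for c using B span_base by blast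
  have xB: "x \<notin> B" using inB x by blast
  have B': "finite (insert x B)" "independent (insert x B)" "span (insert x B) = span (insert x U)"
    using B x independent_insertI by (auto simp: span_insert span_eq_iff[THEN iffD2, OF U])
  have stab: "T v \<in> span (insert x U)" if v: "v \<in> span (insert x U)" for v
  proof -
    obtain k u where ku: "u \<in> U" "v = u + k \<cdot> x" using in_span_insertE[OF U v] .
    have "T v = T u + (k \<cdot> (T x - c \<cdot> x) + (k * c) \<cdot> x)"
      using ku T(1) by (simp add: lin_add lin_scale algebra_simps)
    then show ?thesis using ku T Tx
      by (auto intro!: span_add span_scale intro: span_base)
  qed
  have indep: "independent (insert x B)" by fact
  have ext: "representation (insert x B) v = representation B v" if "v \<in> U" for v
    using representation_extend[OF indep, of v B] that B by auto
  have 1: "representation (insert x B) (T x) x = c"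
  proof -
    have "T x = c \<cdot> x + (T x - c \<cdot> x)" by simp
    then have "representation (insert x B) (T x)
        = representation (insert x B) (c \<cdot> x + (T x - c \<cdot> x))" by simp
    then have "representation (insert x B) (T x) x
        = representation (insert x B) (c \<cdot> x + (T x - c \<cdot> x)) x" by simp
    also have "\<dots> = c * representation (insert x B) x x + representation (insert x B) (T x - c \<cdot> x) x"
      using indep Tx B' by (subst representation_add)
        (auto simp: representation_scale span_base span_scale)
    also have "representation (insert x B) x x = 1"
      using indep by (subst representation_basis) auto
    also have "representation (insert x B) (T x - c \<cdot> x) x = 0"
      using ext[OF Tx] representation_ne_zero[of B "T x - c \<cdot> x" x] xB by auto
    finally show ?thesis by simp
  qed
  have "tr (span (insert x U)) T = (\<Sum>b\<in>insert x B. representation (insert x B) (T b) b)"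
    by (rule tr_basis[OF B' T(1) stab])
  also have "\<dots> = c + (\<Sum>b\<in>B. representation B (T b) b)"
    using 1 xB B inB T(2) ext by simp
  also have "\<dots> = tr U T + c" using tr_basis[OF B T] by simp
  finally show ?thesis .
qed

section \<open>Polynomials in an operator and eigenvectors modulo a subspace\<close>

definition opoly :: "('g \<Rightarrow> 'g) \<Rightarrow> complex poly \<Rightarrow> 'g \<Rightarrow> 'g" where
  "opoly T p v = (\<Sum>i\<le>degree p. coeff p i \<cdot> (T ^^ i) v)"

lemma opoly_bound:
  assumes "degree p \<le> n" shows "opoly T p v = (\<Sum>i\<le>n. coeff p i \<cdot> (T ^^ i) v)"
  unfolding opoly_def using assms
  by (intro sum.mono_neutral_left) (auto simp: coeff_eq_0)

lemma opoly_linear_factor: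
  assumes T: "lin T"
  shows "opoly T ([:- c, 1:] * q) v = T (opoly T q v) - c \<cdot> opoly T q v"
proof -
  define n where "n = degree q"
  have "degree ([:- c, 1:] * q) \<le> Suc n"
    using degree_mult_le[of "[:- c, 1:]" q] by (simp add: n_def)
  then have "opoly T ([:- c, 1:] * q) v = (\<Sum>i\<le>Suc n. coeff ([:- c, 1:] * q) i \<cdot> (T ^^ i) v)"
    by (rule opoly_bound)
  also have "\<dots> = (\<Sum>i\<le>Suc n. coeff (pCons 0 q) i \<cdot> (T ^^ i) v) - (\<Sum>i\<le>Suc n. (c * coeff q i) \<cdot> (T ^^ i) v)"
    by (simp add: sum_subtractf[symmetric] algebra_simps del: sum.atMost_Suc)
  also have "(\<Sum>i\<le>Suc n. coeff (pCons 0 q) i \<cdot> (T ^^ i) v) = (\<Sum>i\<le>n. coeff q i \<cdot> T ((T ^^ i) v))"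
    by (subst sum.atMost_Suc_shift) simp
  also have "\<dots> = T (opoly T q v)"
    by (simp add: opoly_def n_def lin_sum[OF T] lin_scale[OF T])
  also have "(\<Sum>i\<le>Suc n. (c * coeff q i) \<cdot> (T ^^ i) v) = c \<cdot> opoly T q v"
    by (subst opoly_bound[of q "Suc n"]) (simp_all add: n_def scale_sum_right scale_right_distrib)
  finally show ?thesis .
qed

text \<open>The \<open>dimension + 1\<close> iterates of \<open>v\<close> are linearly dependent.
  Dependence is a property of sets, so a repeated iterate is treated separately: then a difference
  of two monomials serves.\<close>

lemma exists_annihilating_poly: "\<exists>p. p \<noteq> 0 \<and> opoly T p v = 0"
proof (cases "inj_on (\<lambda>i. (T ^^ i) v) {..dimension}")
  case True
  let ?A = "(\<lambda>i. (T ^^ i) v) ` {..dimension}"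
  have "card ?A = Suc dimension" using card_image[OF True] by simp
  then have "dependent ?A"
    using independent_bound_general[of ?A] dim_subset_UNIV[of ?A] by fastforce
  then obtain u w where u: "(\<Sum>w\<in>?A. u w \<cdot> w) = 0" "w \<in> ?A" "u w \<noteq> 0"
    using dependent_finite[of ?A] by auto
  define p where "p = (\<Sum>i\<le>dimension. monom (u ((T ^^ i) v)) i)"
  have cp: "coeff p j = (if j \<le> dimension then u ((T ^^ j) v) else 0)" for j
    by (simp add: p_def coeff_sum)
  have "opoly T p v = (\<Sum>i\<le>dimension. coeff p i \<cdot> (T ^^ i) v)"
    by (rule opoly_bound) (simp add: cp degree_le)
  also have "\<dots> = (\<Sum>i\<le>dimension. u ((T ^^ i) v) \<cdot> (T ^^ i) v)"
    by (simp add: cp)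
  also have "\<dots> = 0" using u(1) by (subst (asm) sum.reindex[OF True]) simp
  finally have "opoly T p v = 0" .
  moreover have "p \<noteq> 0"
  proof -
    obtain j where "j \<le> dimension" "w = (T ^^ j) v" using u(2) by blast
    then have "coeff p j \<noteq> 0" using cp[of j] u(3) by simp
    then show ?thesis by auto
  qed
  ultimately show ?thesis by blast
next
  case False
  then obtain i j where ij: "i < j" "(T ^^ i) v = (T ^^ j) v"
    by (auto simp: inj_on_def) (metis linorder_neqE_nat)
  define p where "p = monom (1::complex) j - monom 1 i"
  have cp: "coeff p k = (if k = j then 1 else if k = i then -1 else 0)" for k
    using ij by (auto simp: p_def)
  have "opoly T p v = (\<Sum>k\<le>j. coeff p k \<cdot> (T ^^ k) v)"
    by (rule opoly_bound) (use ij in \<open>auto simp: cp intro!: degree_le\<close>)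
  also have "\<dots> = (\<Sum>k\<in>{i,j}. coeff p k \<cdot> (T ^^ k) v)"
    using ij by (intro sum.mono_neutral_right) (auto simp: cp)
  also have "\<dots> = 0" using ij by (simp add: cp scale_minus_left)
  finally have "opoly T p v = 0" .
  moreover have "p \<noteq> 0" using cp[of j] by auto
  ultimately show ?thesis by blast
qed

lemma pow_stable:
  assumes "\<And>v. v \<in> M \<Longrightarrow> T v \<in> M" "v \<in> M" shows "(T ^^ i) v \<in> M"
  by (induction i) (use assms in auto)

lemma opoly_stable:
  assumes "subspace M" "\<And>v. v \<in> M \<Longrightarrow> T v \<in> M" "v \<in> M" shows "opoly T p v \<in> M"
  unfolding opoly_def
  by (rule subspace_sum[OF assms(1)], rule subspace_scale[OF assms(1)], rule pow_stable)
     (use assms in auto)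

text \<open>Among the nonzero polynomials carrying \<open>v\<close> into \<open>N\<close> one of
  least degree has a complex root \<open>c\<close>. Removing the factor X - c leaves
  \<open>q\<close>, whose value at \<open>v\<close> is outside \<open>N\<close> by minimality; that
  value is the eigenvector modulo \<open>N\<close>.\<close>

lemma relative_eigenvector:
  assumes T: "lin T" and N: "subspace N" and M: "subspace M"
    and TM: "\<And>v. v \<in> M \<Longrightarrow> T v \<in> M" and NM: "N \<subset> M"
  obtains x c where "x \<in> M" "x \<notin> N" "T x - c \<cdot> x \<in> N"
proof -
  obtain v where v: "v \<in> M" "v \<notin> N" using NM by blast
  define P where "P p \<longleftrightarrow> p \<noteq> 0 \<and> opoly T p v \<in> N" for p
  obtain p0 where "P p0" using exists_annihilating_poly subspace_0[OF N] by (metis P_def)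
  define p where "p = arg_min degree P"
  have p: "P p" and min: "\<And>q. P q \<Longrightarrow> degree p \<le> degree q"
    using arg_min_nat_lemma[of P p0 degree] \<open>P p0\<close> by (auto simp: p_def)
  have "degree p \<noteq> 0"
  proof
    assume d: "degree p = 0"
    then have "coeff p 0 \<cdot> v \<in> N" using p by (simp add: P_def opoly_def)
    moreover have "coeff p 0 \<noteq> 0" using d p by (metis P_def leading_coeff_0_iff)
    ultimately have "inverse (coeff p 0) \<cdot> coeff p 0 \<cdot> v \<in> N" using N subspace_scale by blast
    then show False using v \<open>coeff p 0 \<noteq> 0\<close> by simp
  qed
  then obtain c where "poly p c = 0"
    using fundamental_theorem_of_algebra[of p] constant_degree[of p] by auto
  then obtain q where q: "p = [:- c, 1:] * q" by (metis dvdE poly_eq_0_iff_dvd)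
  then have "q \<noteq> 0" using p by (auto simp: P_def)
  then have "degree p = Suc (degree q)" using q by (simp add: degree_mult_eq del: mult_pCons_left)
  then have nq: "opoly T q v \<notin> N" using min[of q] \<open>q \<noteq> 0\<close> by (auto simp: P_def)
  have "T (opoly T q v) - c \<cdot> opoly T q v \<in> N"
    using p opoly_linear_factor[OF T, of c q v] by (simp add: q P_def)
  with nq show ?thesis using that opoly_stable[of M T v q, OF M TM v(1)] by blast
qed

section \<open>Generalized eigenspaces and operators that are scalar on each of them\<close>

definition geig :: "('g \<Rightarrow> 'g) \<Rightarrow> complex \<Rightarrow> 'g set" where
  "geig T c = {v. \<exists>n. ((\<lambda>x. T x - c \<cdot> x) ^^ n) v = 0}"

lemma lin_pow: "lin T \<Longrightarrow> lin (T ^^ n)"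
  by (induction n) (auto simp: lin_comp lin_def)

lemma pow_zero_mono:
  assumes "lin T" "(T ^^ n) v = 0" "n \<le> m" shows "(T ^^ m) v = 0"
proof -
  have "(T ^^ m) v = (T ^^ (m - n)) ((T ^^ n) v)"
    using assms(3) by (metis comp_apply funpow_add le_add_diff_inverse2)
  then show ?thesis using assms lin_0[OF lin_pow] by simp
qed

lemma subspace_geig:
  assumes "lin T" shows "subspace (geig T c)"
proof -
  let ?S = "\<lambda>x. T x - c \<cdot> x"
  note L = lin_shift[OF assms, of c]
  show ?thesis
  proof (rule subspaceI)
    show "0 \<in> geig T c" unfolding geig_def using lin_0[OF lin_pow[OF L]] by auto
    show "x + y \<in> geig T c" if xy: "x \<in> geig T c" "y \<in> geig T c" for x y
    proof -
      obtain n m where "(?S ^^ n) x = 0" "(?S ^^ m) y = 0" using xy by (auto simp: geig_def)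
      then have "(?S ^^ (max n m)) x = 0" "(?S ^^ (max n m)) y = 0"
        using pow_zero_mono[OF L] by auto
      then show ?thesis unfolding geig_def
        by (intro CollectI exI[of _ "max n m"]) (simp add: lin_add[OF lin_pow[OF L]])
    qed
    show "a \<cdot> x \<in> geig T c" if x: "x \<in> geig T c" for a x
      using x unfolding geig_def using lin_scale[OF lin_pow[OF L]] by force
  qed
qed

lemma shift_in_geig: "T v - c \<cdot> v \<in> geig T c \<longleftrightarrow> v \<in> geig T c" if "lin T"
proof
  assume "T v - c \<cdot> v \<in> geig T c"
  then obtain n where "((\<lambda>x. T x - c \<cdot> x) ^^ n) (T v - c \<cdot> v) = 0" by (auto simp: geig_def)
  then have "((\<lambda>x. T x - c \<cdot> x) ^^ Suc n) v = 0" by (simp add: funpow_Suc_right del: funpow.simps)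
  then show "v \<in> geig T c" unfolding geig_def by blast
next
  assume "v \<in> geig T c"
  then obtain n where "((\<lambda>x. T x - c \<cdot> x) ^^ n) v = 0" by (auto simp: geig_def)
  then have "((\<lambda>x. T x - c \<cdot> x) ^^ Suc n) v = 0"
    using lin_0[OF that] by simp
  then have "((\<lambda>x. T x - c \<cdot> x) ^^ n) (T v - c \<cdot> v) = 0" by (simp add: funpow_Suc_right del: funpow.simps)
  then show "T v - c \<cdot> v \<in> geig T c" unfolding geig_def by blast
qed

lemma geig_stable: "lin T \<Longrightarrow> v \<in> geig T c \<Longrightarrow> T v \<in> geig T c"
  using shift_in_geig[of T v c] subspace_add[OF subspace_geig, of T "T v - c \<cdot> v" c "c \<cdot> v"]
    subspace_scale[OF subspace_geig, of T v c c] by auto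

text \<open>The exponent that kills \<open>v\<close> drops by one under T - c, so the shifted vector
  may serve as the smaller instance and exponents need not be carried along.\<close>

lemma geig_induct [consumes 2, case_names zero step]:
  assumes "lin T" "v \<in> geig T c" "P 0"
    and "\<And>v. v \<in> geig T c \<Longrightarrow> P (T v - c \<cdot> v) \<Longrightarrow> P v"
  shows "P v"
proof -
  obtain n where "((\<lambda>x. T x - c \<cdot> x) ^^ n) v = 0" using assms(2) by (auto simp: geig_def)
  with assms(2) show ?thesis
  proof (induction n arbitrary: v)
    case 0
    then show ?case using assms(3) by simp
  next
    case (Suc n)
    have "((\<lambda>x. T x - c \<cdot> x) ^^ n) (T v - c \<cdot> v) = 0"
      using Suc.prems(2) by (simp add: funpow_Suc_right del: funpow.simps)
    then have "P (T v - c \<cdot> v)"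
      using Suc.IH[of "T v - c \<cdot> v"] Suc.prems shift_in_geig[OF assms(1)] by blast
    then show ?case using assms(4) Suc.prems by blast
  qed
qed

text \<open>On the generalized eigenspace for \<open>d\<close>, T - c is the nonzero scalar d - c
  plus the locally nilpotent T - d, hence onto. The induction sums the geometric series of the
  inverse.\<close>

lemma geig_shift_surj:
  assumes T: "lin T" and M: "subspace M" "\<And>v. v \<in> M \<Longrightarrow> T v \<in> M"
    and cd: "c \<noteq> d" and w: "w \<in> M" "w \<in> geig T d"
  obtains u where "u \<in> M" "u \<in> geig T d" "T u - c \<cdot> u = w"
proof -
  have "w \<in> M \<longrightarrow> (\<exists>u \<in> M \<inter> geig T d. T u - c \<cdot> u = w)"
    using T w(2)
  proof (induction rule: geig_induct)
    case zero
    show ?case using lin_0[OF T] subspace_0 M(1) subspace_geig[OF T, of d] by (auto intro!: bexI[of _ 0])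
  next
    case (step v)
    show ?case
    proof
      assume v: "v \<in> M"
      then have "T v - d \<cdot> v \<in> M" using M by (auto intro: subspace_diff subspace_scale)
      with step obtain u' where u': "u' \<in> M" "u' \<in> geig T d" "T u' - c \<cdot> u' = T v - d \<cdot> v" by blast
      \<comment> \<open>From (T - c) u' = (T - d) v it follows that (T - c)(v - u') = (d - c)
        v.\<close>
      let ?u = "inverse (d - c) \<cdot> (v - u')"
      have "T ?u - c \<cdot> ?u = inverse (d - c) \<cdot> ((T v - c \<cdot> v) - (T u' - c \<cdot> u'))"
        by (simp add: lin_scale[OF T] lin_diff[OF T] algebra_simps)
      also have "\<dots> = inverse (d - c) \<cdot> (d - c) \<cdot> v"
        unfolding u' by (simp add: algebra_simps)
      also have "\<dots> = v" using cd by simp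
      finally have "T ?u - c \<cdot> ?u = v" .
      moreover have "?u \<in> M" using v u' M by (auto intro: subspace_diff subspace_scale)
      moreover have "?u \<in> geig T d"
        using step u' subspace_geig[OF T, of d] by (auto intro: subspace_diff subspace_scale)
      ultimately show "\<exists>u\<in>M \<inter> geig T d. T u - c \<cdot> u = v" by blast
    qed
  qed
  with w that show ?thesis by blast
qed

lemma span_UN_sum:
  assumes "\<And>i. subspace (A i)" "v \<in> span (\<Union>i. A i)"
  shows "\<exists>F f. finite F \<and> (\<forall>i\<in>F. f i \<in> A i) \<and> v = sum f F"
  using assms(2)
proof (induction rule: span_induct_alt)
  case base
  show ?case by (rule exI[of _ "{}"]) auto
next
  case (step c x y)
  then obtain F f where F: "finite F" "\<forall>i\<in>F. f i \<in> A i" "y = sum f F" by blast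
  obtain j where j: "x \<in> A j" using step by blast
  let ?f = "\<lambda>i. (if i = j then c \<cdot> x else 0) + (if i \<in> F then f i else 0)"
  have "sum ?f (insert j F) = c \<cdot> x + y"
  proof -
    have "(\<Sum>i\<in>insert j F. if i \<in> F then f i else 0) = sum f F"
      using F(1) by (intro sum.mono_neutral_cong_right) auto
    then show ?thesis using F(1,3) by (simp only: sum.distrib) (simp add: sum.delta)
  qed
  moreover have "\<forall>i\<in>insert j F. ?f i \<in> A i"
    using F j assms(1) by (auto intro!: subspace_add subspace_scale simp: subspace_0)
  moreover have "finite (insert j F)" using F(1) by simp
  ultimately show ?case by (intro exI[of _ "insert j F"] exI[of _ ?f]) simp
qed

text \<open>If the pieces spanned less than \<open>M\<close>, take \<open>x\<close> that is an
  eigenvector for \<open>c\<close> modulo their span. The components of (T - c) x with eigenvalue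
  other than \<open>c\<close> can be removed by \<open>geig_shift_surj\<close>, so a corrected
  \<open>x\<close> lies in \<open>geig T c\<close>, hence in the span after all.\<close>

lemma geig_decomp:
  assumes T: "lin T" and M: "subspace M" "\<And>v. v \<in> M \<Longrightarrow> T v \<in> M"
  shows "M = span (\<Union>c. M \<inter> geig T c)"
proof (rule ccontr)
  let ?M' = "span (\<Union>c. M \<inter> geig T c)"
  assume ne: "M \<noteq> ?M'"
  have sub: "?M' \<subseteq> M" by (rule span_minimal) (use M in auto)
  have sG: "subspace (M \<inter> geig T c)" for c using M subspace_geig[OF T] subspace_inter by blast
  obtain x c where x: "x \<in> M" "x \<notin> ?M'" "T x - c \<cdot> x \<in> ?M'"
    using relative_eigenvector[OF T subspace_span M] sub ne by (metis psubsetI)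
  obtain F f where F: "finite F" "\<forall>d\<in>F. f d \<in> M \<inter> geig T d" "T x - c \<cdot> x = sum f F"
    using span_UN_sum[OF sG x(3)] by blast
  have "\<exists>u. u \<in> M \<inter> geig T d \<and> (d \<noteq> c \<longrightarrow> T u - c \<cdot> u = f d)" if "d \<in> F" for d
    using geig_shift_surj[OF T M, of c d "f d"] F that subspace_0[OF sG] by (metis IntD1 IntD2 IntI)
  then obtain g where g: "\<And>d. d \<in> F \<Longrightarrow> g d \<in> M \<inter> geig T d"
      "\<And>d. d \<in> F \<Longrightarrow> d \<noteq> c \<Longrightarrow> T (g d) - c \<cdot> g d = f d" by metis
  let ?y = "x - (\<Sum>d\<in>F - {c}. g d)"
  have "T ?y - c \<cdot> ?y = (T x - c \<cdot> x) - (\<Sum>d\<in>F - {c}. T (g d) - c \<cdot> g d)"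
    by (simp add: lin_diff[OF T] lin_sum[OF T] scale_right_diff_distrib scale_sum_right sum_subtractf algebra_simps)
  also have "\<dots> = sum f F - sum f (F - {c})" using g F by simp
  also have "\<dots> = (if c \<in> F then f c else 0)" using F(1) by (auto simp: sum_diff1)
  also have "\<dots> \<in> geig T c" using F(2) subspace_0[OF subspace_geig[OF T]] by auto
  finally have "?y \<in> geig T c" using shift_in_geig[OF T] by blast
  moreover have gs: "(\<Sum>d\<in>F - {c}. g d) \<in> ?M'"
    by (rule span_sum) (use g in \<open>blast intro: span_base\<close>)
  then have "?y \<in> M" using x(1) sub M(1) by (blast intro: subspace_diff)
  ultimately have "?y \<in> ?M'" by (blast intro: span_base)
  from span_add[OF this gs] have "x \<in> ?M'" by simp
  with x(2) show False by simp
qed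

text \<open>Products of shifts T - d. They commute, so the annihilators of two vectors can be
  concatenated to annihilate their sum.\<close>

primrec oplist :: "('g \<Rightarrow> 'g) \<Rightarrow> complex list \<Rightarrow> 'g \<Rightarrow> 'g" where
  "oplist T [] v = v"
| "oplist T (d # ds) v = T (oplist T ds v) - d \<cdot> oplist T ds v"

lemma oplist_append: "oplist T (ds @ es) v = oplist T ds (oplist T es v)"
  by (induction ds) auto

lemma lin_oplist: "lin T \<Longrightarrow> lin (oplist T ds)"
  by (induction ds) (auto simp: lin_def algebra_simps)

lemma oplist_shift:
  "lin T \<Longrightarrow> oplist T ds (T v - d \<cdot> v) = T (oplist T ds v) - d \<cdot> oplist T ds v"
proof (induction ds)
  case (Cons a ds)
  then show ?case
    by (simp only: oplist.simps Cons.IH[OF Cons.prems] lin_diff lin_scale)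
      (simp add: scale_right_diff_distrib mult.commute)
qed simp

lemma oplist_commute: "lin T \<Longrightarrow> oplist T ds (oplist T es v) = oplist T es (oplist T ds v)"
  by (induction es) (auto simp: oplist_shift)

lemma oplist_replicate: "oplist T (replicate n d) v = ((\<lambda>x. T x - d \<cdot> x) ^^ n) v"
  by (induction n) auto

lemma geig_disjoint:
  assumes T: "lin T" and v: "v \<in> geig T c" "T v = d \<cdot> v" "c \<noteq> d"
  shows "v = 0"
proof -
  obtain n where n: "((\<lambda>x. T x - c \<cdot> x) ^^ n) v = 0" using v by (auto simp: geig_def)
  have "((\<lambda>x. T x - c \<cdot> x) ^^ n) v = (d - c) ^ n \<cdot> v" for n
    by (induction n) (auto simp: lin_scale[OF T] v(2) algebra_simps)
  with n v(3) show ?thesis by simp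
qed

text \<open>Vectors from the other eigenspaces are killed by products of shifts T - d with d
  different from \<open>c\<close>. Each such shift is injective on \<open>geig T c\<close>, so the
  factors can be peeled off one by one.\<close>

lemma geig_inter_span_others:
  assumes T: "lin T" and v: "v \<in> geig T c" "v \<in> span (\<Union>d\<in>-{c}. geig T d)"
  shows "v = 0"
proof -
  define N where "N = {w. \<exists>ds. c \<notin> set ds \<and> oplist T ds w = 0}"
  have N: "subspace N"
  proof (rule subspaceI)
    show "0 \<in> N" by (auto simp: N_def intro!: exI[of _ "[]"])
    show "x + y \<in> N" if xy: "x \<in> N" "y \<in> N" for x y
    proof -
      obtain ds es where de: "c \<notin> set ds" "oplist T ds x = 0" "c \<notin> set es" "oplist T es y = 0"
        using xy unfolding N_def by blast
      have "oplist T (ds @ es) (x + y) = 0"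
        using de oplist_commute[OF T, of ds es x] lin_0[OF lin_oplist[OF T]]
        by (simp add: oplist_append lin_add[OF lin_oplist[OF T]])
      then show ?thesis using de unfolding N_def by (intro CollectI exI[of _ "ds @ es"]) auto
    qed
    show "a \<cdot> x \<in> N" if "x \<in> N" for a x
      using that unfolding N_def by (auto simp: lin_scale[OF lin_oplist[OF T]])
  qed
  have "geig T d \<subseteq> N" if "d \<noteq> c" for d
  proof
    fix x assume "x \<in> geig T d"
    then obtain n where "oplist T (replicate n d) x = 0"
      by (auto simp: geig_def oplist_replicate)
    then show "x \<in> N" using that unfolding N_def by (intro CollectI exI[of _ "replicate n d"]) auto
  qed
  then have "span (\<Union>d\<in>-{c}. geig T d) \<subseteq> N" using N by (intro span_minimal) auto
  with v(2) obtain ds where ds: "c \<notin> set ds" "oplist T ds v = 0" by (auto simp: N_def)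
  have stab: "oplist T ds v \<in> geig T c" for ds
    by (induction ds) (use v geig_stable[OF T] subspace_geig[OF T, of c] in \<open>auto intro!: subspace_diff subspace_scale\<close>)
  show ?thesis using ds
  proof (induction ds)
    case (Cons d ds)
    then have "oplist T ds v = 0"
      using geig_disjoint[OF T stab, of ds d] by auto
    with Cons show ?case by simp
  qed simp
qed

text \<open>Generalized eigenspaces form a direct sum, so a basis of generalized eigenvectors may be
  scaled at will on each of them. No polynomial expression in \<open>T\<close> is sought, and
  \<open>\<phi>\<close> may be any function.\<close>

lemma exists_spectral_operator:
  assumes T: "lin T"
  obtains S where "lin S" "\<And>c v. v \<in> geig T c \<Longrightarrow> S v = \<phi> c \<cdot> v"
proof -
  let ?G = "\<Union>c. geig T c"
  obtain B where B: "B \<subseteq> ?G" "independent B" "?G \<subseteq> span B"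
    using maximal_independent_subset[of ?G] by auto
  have fB: "finite B" by (rule finiteI_independent[OF B(2)])
  have "span B = UNIV"
    using geig_decomp[OF T, of UNIV] B(3) span_minimal[of ?G "span B"] by auto
  define ev where "ev b = (SOME c. b \<in> geig T c)" for b
  have ev: "b \<in> geig T (ev b)" if "b \<in> B" for b
    unfolding ev_def by (rule someI_ex) (use B that in auto)
  define S where "S v = (\<Sum>b\<in>B. (representation B v b * \<phi> (ev b)) \<cdot> b)" for v
  have S: "lin S"
    unfolding S_def using B \<open>span B = UNIV\<close>
    by (intro linI) (auto simp: representation_add representation_scale sum.distrib
        scale_sum_right algebra_simps)
  have "S v = \<phi> c \<cdot> v" if v: "v \<in> geig T c" for c v
  proof -
    let ?r = "representation B v"
    let ?B1 = "{b \<in> B. ev b = c}" and ?B2 = "{b \<in> B. ev b \<noteq> c}"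
    have BB: "B = ?B1 \<union> ?B2" "?B1 \<inter> ?B2 = {}" by auto
    have exp: "v = (\<Sum>b\<in>B. ?r b \<cdot> b)" using rep_expand[OF fB B(2), of v] \<open>span B = UNIV\<close> by simp
    also have "\<dots> = (\<Sum>b\<in>?B1. ?r b \<cdot> b) + (\<Sum>b\<in>?B2. ?r b \<cdot> b)"
      using fB BB by (subst BB(1), subst sum.union_disjoint) auto
    finally have eq: "(\<Sum>b\<in>?B2. ?r b \<cdot> b) = v - (\<Sum>b\<in>?B1. ?r b \<cdot> b)" by (simp add: algebra_simps)
    have s1: "(\<Sum>b\<in>?B1. ?r b \<cdot> b) \<in> geig T c"
      using subspace_geig[OF T] ev by (intro subspace_sum subspace_scale) auto
    have "(\<Sum>b\<in>?B2. ?r b \<cdot> b) \<in> geig T c"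
      unfolding eq using v s1 subspace_geig[OF T] by (intro subspace_diff) auto
    moreover have "(\<Sum>b\<in>?B2. ?r b \<cdot> b) \<in> span (\<Union>d\<in>-{c}. geig T d)"
      using ev by (intro span_sum span_scale span_base) auto
    ultimately have z: "(\<Sum>b\<in>?B2. ?r b \<cdot> b) = 0" using geig_inter_span_others[OF T] by blast
    have r0: "?r b = 0" if "b \<in> ?B2" for b
    proof (rule ccontr)
      assume "?r b \<noteq> 0"
      then have "dependent B" unfolding dependent_explicit using z that fB
        by (intro exI[of _ ?B2] exI[of _ ?r]) auto
      with B(2) show False by simp
    qed
    have "S v = (\<Sum>b\<in>B. \<phi> c \<cdot> ?r b \<cdot> b)"
      unfolding S_def using r0 by (intro sum.cong) (auto simp: mult.commute)
    also have "\<dots> = \<phi> c \<cdot> v" by (subst exp) (simp add: scale_sum_right)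
    finally show ?thesis .
  qed
  with S that show ?thesis by blast
qed

text \<open>Multiples by \<open>\<phi>\<close> of generalized eigenvectors for nonzero eigenvalues already lie in the
  image of \<open>T\<close>, so the spectral operator inherits inclusions from \<open>T\<close>.\<close>
lemma spectral_operator_image:
  assumes T: "lin T" and S: "lin S" "\<And>c v. v \<in> geig T c \<Longrightarrow> S v = \<phi> c \<cdot> v" and "\<phi> 0 = 0"
    and M: "subspace M" and N: "subspace N" "N \<subseteq> M" "\<And>v. v \<in> M \<Longrightarrow> T v \<in> N" and v: "v \<in> M"
  shows "S v \<in> N"
proof -
  have TM: "\<And>v. v \<in> M \<Longrightarrow> T v \<in> M" using N by blast
  have "v \<in> span (\<Union>c. M \<inter> geig T c)" using geig_decomp[OF T M TM] v by simp
  then show ?thesis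
  proof (rule lin_span_subset[OF S(1) N(1), rotated])
    fix w assume "w \<in> (\<Union>c. M \<inter> geig T c)"
    then obtain c where w: "w \<in> M" "w \<in> geig T c" by blast
    show "S w \<in> N"
    proof (cases "c = 0")
      case True
      then show ?thesis using S(2)[OF w(2)] assms(4) subspace_0[OF N(1)] by simp
    next
      case False
      then obtain u where u: "u \<in> M" "T u - 0 \<cdot> u = w"
        using geig_shift_surj[OF T M TM, of 0 c w] w by blast
      then have "w \<in> N" using N(3) by auto
      then show ?thesis using S(2)[OF w(2)] subspace_scale[OF N(1)] by simp
    qed
  qed
qed

text \<open>A subspace of maximal dimension with \<open>P\<close> must be everything, since the step
  would enlarge it by a line. The step chooses the new vector, so \<open>P\<close> can carry
  invariance under several operators at once.\<close>

lemma flag_induct [case_names zero step]: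
  assumes "P {0}"
    and "\<And>U. subspace U \<Longrightarrow> U \<noteq> UNIV \<Longrightarrow> P U \<Longrightarrow> \<exists>x. x \<notin> U \<and> P (span (insert x U))"
  shows "P UNIV"
proof -
  define Q where "Q n \<longleftrightarrow> (\<exists>U. subspace U \<and> P U \<and> dim U = n)" for n
  have "Q 0" unfolding Q_def using assms(1) by (intro exI[of _ "{0}"]) auto
  moreover have "n \<le> dimension" if "Q n" for n
    using that dim_subset_UNIV by (auto simp: Q_def)
  ultimately obtain m where m: "Q m" "\<And>n. Q n \<Longrightarrow> n \<le> m"
    by (metis Greatest_le_nat GreatestI_nat)
  then obtain U where U: "subspace U" "P U" "dim U = m" by (auto simp: Q_def)
  have "U = UNIV"
  proof (rule ccontr)
    assume "U \<noteq> UNIV"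
    then obtain x where x: "x \<notin> U" "P (span (insert x U))" using assms(2)[OF U(1) _ U(2)] by blast
    then have "dim (span (insert x U)) = Suc m"
      using U by (simp add: dim_insert span_eq_iff[THEN iffD2, OF U(1)])
    then have "Q (Suc m)" unfolding Q_def using x(2) by (intro exI[of _ "span (insert x U)"]) auto
    then show False using m(2) by fastforce
  qed
  with U show ?thesis by simp
qed

text \<open>A relative eigenvector found anywhere need not be one for a spectral operator of
  \<open>T\<close>. Searching inside a generalized eigenspace not contained in \<open>U\<close>
  yields a vector on which that operator is exactly scalar.\<close>

lemma relative_eigenvector_in_geig:
  assumes T: "lin T" and U: "subspace U" "\<And>v. v \<in> U \<Longrightarrow> T v \<in> U" "U \<noteq> UNIV"
  obtains x c where "x \<notin> U" "x \<in> geig T c" "T x - c \<cdot> x \<in> U"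
proof -
  obtain c where c: "\<not> geig T c \<subseteq> U"
  proof (rule ccontr)
    assume "\<not> thesis"
    then have "(\<Union>c. UNIV \<inter> geig T c) \<subseteq> U" using that by auto
    then have "span (\<Union>c. UNIV \<inter> geig T c) \<subseteq> U" by (rule span_minimal[OF _ U(1)])
    moreover have "UNIV = span (\<Union>c. UNIV \<inter> geig T c)" by (rule geig_decomp[OF T]) auto
    ultimately show False using U(3) by blast
  qed
  have "subspace (U \<inter> geig T c)" using U(1) subspace_geig[OF T] subspace_inter by blast
  from relative_eigenvector[OF T this subspace_geig[OF T, of c]] geig_stable[OF T] c
  obtain x d where x: "x \<in> geig T c" "x \<notin> U" "T x - d \<cdot> x \<in> U" by (metis Int_iff Int_lower2 inf.absorb_iff2 psubsetI)
  \<comment> \<open>Modulo \<open>U\<close> the n-th power of T - c multiplies \<open>x\<close> by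
    the n-th power of d - c, and for some n it kills \<open>x\<close>.\<close>
  have "d = c"
  proof (rule ccontr)
    assume dc: "d \<noteq> c"
    obtain n where n: "((\<lambda>x. T x - c \<cdot> x) ^^ n) x = 0" using x by (auto simp: geig_def)
    have "((\<lambda>x. T x - c \<cdot> x) ^^ n) x - (d - c) ^ n \<cdot> x \<in> U" for n
    proof (induction n)
      case 0
      show ?case using subspace_0[OF U(1)] by simp
    next
      case (Suc n)
      define y where "y = ((\<lambda>x. T x - c \<cdot> x) ^^ n) x"
      define k where "k = (d - c) ^ n"
      have "(T y - c \<cdot> y) - ((d - c) * k) \<cdot> x = (T (y - k \<cdot> x) - c \<cdot> (y - k \<cdot> x)) + k \<cdot> (T x - d \<cdot> x)"
        by (simp add: lin_diff[OF T] lin_scale[OF T] algebra_simps)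
      also have "\<dots> \<in> U"
        using Suc x U by (auto simp: y_def k_def intro!: subspace_add subspace_diff subspace_scale)
      finally show ?case by (simp add: y_def k_def)
    qed
    from this[of n] n have "(d - c) ^ n \<cdot> x \<in> U" using subspace_neg[OF U(1)] by fastforce
    then have "inverse ((d - c) ^ n) \<cdot> (d - c) ^ n \<cdot> x \<in> U" using subspace_scale[OF U(1)] by blast
    with x(2) dc show False by simp
  qed
  with x that show ?thesis by blast
qed

lemma span_insert_stable:
  assumes "subspace U" "lin T" "\<And>v. v \<in> U \<Longrightarrow> T v \<in> U" "T x - c \<cdot> x \<in> U" "v \<in> span (insert x U)"
  shows "T v \<in> span (insert x U)"
proof -
  obtain k u where ku: "u \<in> U" "v = u + k \<cdot> x" using in_span_insertE[OF assms(1,5)] .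
  have "T v = T u + (k \<cdot> (T x - c \<cdot> x) + (k * c) \<cdot> x)"
    using ku assms(2) by (simp add: lin_add lin_scale algebra_simps)
  then show ?thesis using ku assms
    by (auto intro!: span_add span_scale intro: span_base)
qed

lemma nilpotent_if_relative:
  assumes U: "subspace U" and T: "lin T" "T x \<in> U" "\<And>v. v \<in> U \<Longrightarrow> \<exists>n. (T ^^ n) v = 0"
    and v: "v \<in> span (insert x U)"
  shows "\<exists>n. (T ^^ n) v = 0"
proof -
  have "span (insert x U) \<subseteq> geig T 0"
  proof (rule span_minimal[OF _ subspace_geig[OF T(1)]])
    have "U \<subseteq> geig T 0" using T(3) by (auto simp: geig_def)
    moreover have "x \<in> geig T 0" using shift_in_geig[OF T(1), of x 0] T(2) calculation by auto
    ultimately show "insert x U \<subseteq> geig T 0" by simp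
  qed
  then show ?thesis using v by (auto simp: geig_def)
qed

text \<open>Here the trace of \<open>T \<circ> S\<close> is the sum of \<open>|c|\<^sup>2\<close> over the eigenvalues \<open>c\<close> of \<open>T\<close>.\<close>
lemma trace_conj_nilpotent:
  assumes T: "lin T" and S: "lin S" "\<And>c v. v \<in> geig T c \<Longrightarrow> S v = cnj c \<cdot> v"
    and tr0: "tr UNIV (T \<circ> S) = 0"
  shows "\<exists>n. (T ^^ n) v = 0"
proof -
  \<comment> \<open>The witness \<open>r\<close> records that the trace stays real and nonnegative
    along the flag, so it can vanish only if every eigenvalue met so far is 0.\<close>
  define P where "P U \<longleftrightarrow> (\<forall>v\<in>U. T v \<in> U) \<and> (\<forall>v\<in>U. S v \<in> U) \<and>
     (\<exists>r\<ge>0. tr U (T \<circ> S) = of_real r \<and> (r = 0 \<longrightarrow> (\<forall>v\<in>U. \<exists>n. (T ^^ n) v = 0)))" for U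
  have "P UNIV"
  proof (induction rule: flag_induct)
    case zero
    show ?case using tr_zero_space[OF lin_comp[OF T S(1)]] lin_0[OF T] lin_0[OF S(1)]
      by (auto simp: P_def intro!: exI[of _ 0])
  next
    case (step U)
    have U: "subspace U" "\<And>v. v \<in> U \<Longrightarrow> T v \<in> U" "\<And>v. v \<in> U \<Longrightarrow> S v \<in> U"
      using step by (auto simp: P_def)
    obtain r where r: "r \<ge> 0" "tr U (T \<circ> S) = of_real r" "r = 0 \<Longrightarrow> \<forall>v\<in>U. \<exists>n. (T ^^ n) v = 0"
      using step by (auto simp: P_def)
    obtain x c where x: "x \<notin> U" "x \<in> geig T c" "T x - c \<cdot> x \<in> U"
      using relative_eigenvector_in_geig[OF T U(1,2) step(2)] by blast
    have Sx: "S x - cnj c \<cdot> x \<in> U" using S(2)[OF x(2)] subspace_0[OF U(1)] by simp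
    have "(T \<circ> S) x - (c * cnj c) \<cdot> x = cnj c \<cdot> (T x - c \<cdot> x)"
      using S(2)[OF x(2)] by (simp add: lin_scale[OF T] algebra_simps)
    then have TSx: "(T \<circ> S) x - (c * cnj c) \<cdot> x \<in> U" using x(3) subspace_scale[OF U(1)] by simp
    have "tr (span (insert x U)) (T \<circ> S) = tr U (T \<circ> S) + c * cnj c"
      by (rule tr_insert[OF U(1) x(1) lin_comp[OF T S(1)] _ TSx]) (use U in auto)
    also have "\<dots> = of_real (r + (cmod c)\<^sup>2)" using r complex_norm_square[of c] by simp
    finally have "tr (span (insert x U)) (T \<circ> S) = of_real (r + (cmod c)\<^sup>2)" .
    moreover have "\<forall>v\<in>span (insert x U). \<exists>n. (T ^^ n) v = 0" if "r + (cmod c)\<^sup>2 = 0"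
    proof -
      have "r = 0" "c = 0" using that r(1) by (auto simp: add_nonneg_eq_0_iff)
      then show ?thesis using r(3) nilpotent_if_relative[OF U(1) T, of x] x(3) by auto
    qed
    ultimately have "P (span (insert x U))" unfolding P_def
      using span_insert_stable[OF U(1) T U(2) x(3)] span_insert_stable[OF U(1) S(1) U(3) Sx] r(1)
      by (intro conjI ballI exI[of _ "r + (cmod c)\<^sup>2"]) auto
    with x(1) show ?case by blast
  qed
  then obtain r where r: "tr UNIV (T \<circ> S) = of_real r" "r = 0 \<Longrightarrow> (\<forall>v. \<exists>n. (T ^^ n) v = 0)"
    unfolding P_def by (elim conjE exE) auto
  from r(1) tr0 have "r = 0" by simp
  with r(2) show ?thesis by blast
qed

lemma tr_nilpotent:
  assumes T: "lin T" and nil: "\<And>v. \<exists>n. (T ^^ n) v = 0"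
  shows "tr UNIV T = 0"
proof -
  define P where "P U \<longleftrightarrow> (\<forall>v\<in>U. T v \<in> U) \<and> tr U T = 0" for U
  have "P UNIV"
  proof (induction rule: flag_induct)
    case zero
    show ?case using tr_zero_space[OF T] lin_0[OF T] by (auto simp: P_def)
  next
    case (step U)
    have U: "subspace U" "\<And>v. v \<in> U \<Longrightarrow> T v \<in> U" "tr U T = 0"
      using step by (auto simp: P_def)
    obtain x c where x: "x \<notin> U" "x \<in> geig T c" "T x - c \<cdot> x \<in> U"
      using relative_eigenvector_in_geig[OF T U(1,2) step(2)] by blast
    have "c = 0"
    proof (rule ccontr)
      assume "c \<noteq> 0"
      have "x \<in> geig T 0" using nil by (auto simp: geig_def)
      then have "x \<in> span (\<Union>d\<in>-{c}. geig T d)" using \<open>c \<noteq> 0\<close> by (intro span_base) auto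
      then have "x = 0" using geig_inter_span_others[OF T x(2)] by simp
      with x(1) subspace_0[OF U(1)] show False by simp
    qed
    then have "tr (span (insert x U)) T = 0"
      using tr_insert[OF U(1) x(1) T U(2) x(3)] U(3) by simp
    then show ?case using x(1) span_insert_stable[OF U(1) T U(2) x(3)] by (auto simp: P_def)
  qed
  then show ?thesis by (simp add: P_def)
qed

end

section \<open>Lie's theorem, Engel's theorem and Cartan's criterion\<close>

locale lie_alg = fd_cspace sm Basis
  for sm :: "complex \<Rightarrow> 'g::ab_group_add \<Rightarrow> 'g" (infixr \<open>\<cdot>\<close> 75) and Basis :: "'g set" +
  fixes br :: "'g \<Rightarrow> 'g \<Rightarrow> 'g"
  assumes lie: "lie_algebra sm br"
begin

section \<open>Bracket identities, derived algebras and solvability\<close>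

lemma br_add_left: "br (x + y) z = br x z + br y z"
  and br_add_right: "br x (y + z) = br x y + br x z"
  and br_scale_left: "br (c \<cdot> x) y = c \<cdot> br x y"
  and br_scale_right: "br x (c \<cdot> y) = c \<cdot> br x y"
  and br_self [simp]: "br x x = 0"
  and jacobi: "br x (br y z) + br y (br z x) + br z (br x y) = 0"
  using lie by (auto simp: lie_algebra_def)

lemma lin_br: "lin (br x)"
  by (rule linI) (auto simp: br_add_right br_scale_right)

lemma lin_br_left: "lin (\<lambda>x. br x y)"
  by (rule linI) (auto simp: br_add_left br_scale_left)

lemma br_0 [simp]: "br x 0 = 0" "br 0 x = 0"
  using lin_0[OF lin_br] lin_0[OF lin_br_left] by auto

lemma br_minus: "br x (- y) = - br x y" "br (- x) y = - br x y"
  using lin_minus[OF lin_br] lin_minus[OF lin_br_left] by auto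

lemma br_diff: "br x (y - z) = br x y - br x z" "br (x - y) z = br x z - br y z"
  using lin_diff[OF lin_br] lin_diff[OF lin_br_left] by auto

lemma br_swap: "br y x = - br x y"
proof -
  have "br x (x + y) + br y (x + y) = 0"
    using br_self[of "x + y"] by (simp only: br_add_left)
  then have "br y x + br x y = 0" by (simp add: br_add_right add.commute)
  then show ?thesis by (simp only: eq_neg_iff_add_eq_0)
qed

lemma br_br: "br (br x y) z = br x (br y z) - br y (br x z)"
proof -
  have "br y (br z x) = - br y (br x z)" by (subst br_swap[of z x]) (simp add: br_minus)
  with jacobi[of x y z] br_swap[of z "br x y"]
  have "br x (br y z) - br y (br x z) - br (br x y) z = 0" by simp
  then show ?thesis by (simp only: right_minus_eq)
qed

lemma br_derivation: "br x (br y z) = br (br x y) z + br y (br x z)"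
  by (simp add: br_br)

lemma cspan_eq: "cspan sm = span" and csubspace_eq: "csubspace sm = subspace"
  and cdim_eq: "cdim sm = dim"
  by (auto simp: cspan_def csubspace_def cdim_def)

lemma subalgebra_iff: "subalgebra sm br S \<longleftrightarrow> subspace S \<and> (\<forall>x\<in>S. \<forall>y\<in>S. br x y \<in> S)"
  by (auto simp: subalgebra_def csubspace_eq brs_def)

lemma subalgebraD: "subalgebra sm br S \<Longrightarrow> subspace S"
    "subalgebra sm br S \<Longrightarrow> x \<in> S \<Longrightarrow> y \<in> S \<Longrightarrow> br x y \<in> S"
  by (auto simp: subalgebra_iff)

abbreviation drv :: "'g set \<Rightarrow> 'g set" where "drv S \<equiv> span (brs br S S)"

lemma br_in_drv: "x \<in> S \<Longrightarrow> y \<in> S \<Longrightarrow> br x y \<in> drv S"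
  by (rule span_base) (auto simp: brs_def)

lemma brs_mono: "A \<subseteq> A' \<Longrightarrow> C \<subseteq> C' \<Longrightarrow> brs br A C \<subseteq> brs br A' C'"
  by (auto simp: brs_def)

lemma drv_subset: "subalgebra sm br S \<Longrightarrow> drv S \<subseteq> S"
  by (rule span_minimal) (auto simp: subalgebra_iff brs_def)

lemma subalgebra_drv: "subalgebra sm br S \<Longrightarrow> subalgebra sm br (drv S)"
  using drv_subset[of S] br_in_drv[of _ S] unfolding subalgebra_iff[of "drv S"]
  by (auto simp: subset_iff)

lemma derived_mono: "A \<subseteq> C \<Longrightarrow> derived sm br A k \<subseteq> derived sm br C k"
  by (induction k) (simp_all add: cspan_eq span_mono brs_mono)

lemma derived_Suc_drv: "derived sm br S (Suc k) = derived sm br (drv S) k"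
  by (induction k) (auto simp: cspan_eq)

lemma derived_0: "0 \<in> S \<Longrightarrow> 0 \<in> derived sm br S k"
  by (cases k) (auto simp: cspan_eq span_zero)

lemma solvable_subset:
  assumes "solvable sm br C" "A \<subseteq> C" "0 \<in> A" shows "solvable sm br A"
  using assms derived_mono[OF assms(2)] derived_0[OF assms(3)]
  unfolding solvable_def by (metis empty_iff subset_singletonD)

lemma solvable_by_drv:
  assumes "solvable sm br K" "drv S \<subseteq> K" shows "solvable sm br S"
proof -
  have "solvable sm br (drv S)" by (rule solvable_subset[OF assms]) (rule span_zero)
  then show ?thesis unfolding solvable_def by (metis derived_Suc_drv)
qed

lemma solvable_drv_proper:
  assumes "solvable sm br S" "subalgebra sm br S" "S \<noteq> {0}"
  shows "drv S \<subset> S"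
proof -
  have "drv S \<noteq> S"
  proof
    assume eq: "drv S = S"
    have "derived sm br S k = S" for k
      by (induction k) (auto simp: cspan_eq eq)
    then show False using assms by (auto simp: solvable_def)
  qed
  then show ?thesis using drv_subset[OF assms(2)] by blast
qed

text \<open>Meant for \<open>D = drv B\<close>: every subspace between \<open>drv B\<close> and
  \<open>B\<close> is an ideal of \<open>B\<close>, so this supplies an ideal of codimension
  one.\<close>

lemma exists_hyperplane:
  assumes "subspace D" "subspace B" "D \<subset> B"
  obtains K z where "subspace K" "D \<subseteq> K" "K \<subseteq> B" "z \<in> B" "z \<notin> K" "span (insert z K) = B"
proof -
  have "\<exists>K z. subspace K \<and> D \<subseteq> K \<and> K \<subseteq> B \<and> z \<in> B \<and> z \<notin> K \<and> span (insert z K) = B"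
    using assms
  proof (induction "dim B - dim D" arbitrary: D rule: less_induct)
    case less
    obtain z where z: "z \<in> B" "z \<notin> D" using less.prems by blast
    let ?D = "span (insert z D)"
    have sub: "?D \<subseteq> B" using z less.prems by (intro span_minimal) auto
    show ?case
    proof (cases "?D = B")
      case True
      then show ?thesis using z less.prems by blast
    next
      case False
      have "dim ?D = Suc (dim D)"
        using z less.prems by (simp add: dim_insert span_eq_iff[THEN iffD2])
      moreover have "dim ?D \<le> dim B" by (rule dim_subset[OF sub])
      ultimately have "dim B - dim ?D < dim B - dim D" by simp
      from less.hyps[OF this subspace_span less.prems(2)] False sub
      obtain K w where K: "subspace K" "?D \<subseteq> K" "K \<subseteq> B" "w \<in> B" "w \<notin> K" "span (insert w K) = B"
        by blast
      moreover have "D \<subseteq> K" using K(2) span_superset[of "insert z D"] by auto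
      ultimately show ?thesis by blast
    qed
  qed
  with that show ?thesis by blast
qed

text \<open>The heart of Lie's theorem. On the Krylov space of \<open>z\<close> generated by \<open>v\<close> modulo \<open>U\<close>, an element
  \<open>k\<close> of the ideal is triangular with constant diagonal \<open>\<mu> k\<close>, while the commutator \<open>[k, z]\<close> is traceless.\<close>
lemma weight_vanishes_on_commutators:
  assumes U: "subspace U" "\<And>u. u \<in> U \<Longrightarrow> br z u \<in> U" "\<And>k u. k \<in> K \<Longrightarrow> u \<in> U \<Longrightarrow> br k u \<in> U"
    and K: "\<And>k. k \<in> K \<Longrightarrow> br k z \<in> K"
    and v: "v \<notin> U" "\<And>k. k \<in> K \<Longrightarrow> br k v - \<mu> k \<cdot> v \<in> U"
    and k: "k \<in> K"
  shows "\<mu> (br k z) = 0"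
proof -
  define w where "w i = (br z ^^ i) v" for i
  define W where "W i = span (U \<union> w ` {..<i})" for i
  have W0: "W 0 = U" by (simp add: W_def U(1) span_eq_iff)
  have WSuc: "W (Suc i) = span (insert (w i) (W i))" for i
    by (simp add: W_def lessThan_Suc span_insert span_span)
  have sW: "subspace (W i)" for i by (simp add: W_def)
  have WU: "U \<subseteq> W i" for i unfolding W_def by (meson Un_upper1 span_superset subset_trans)
  have wW: "j < i \<Longrightarrow> w j \<in> W i" for i j unfolding W_def by (rule span_base) auto
  have Wmono: "i \<le> j \<Longrightarrow> W i \<subseteq> W j" for i j unfolding W_def by (intro span_mono) auto
  have zW: "br z x \<in> W (Suc i)" if "x \<in> W i" for x i
  proof (rule lin_span_subset[OF lin_br sW _ that[unfolded W_def]])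
    fix y assume y: "y \<in> U \<union> w ` {..<i}"
    show "br z y \<in> W (Suc i)"
    proof (cases "y \<in> U")
      case True
      then show ?thesis using U(2) WU by blast
    next
      case False
      then obtain j where "j < i" "y = w j" using y by blast
      then have "br z y = w (Suc j)" by (simp add: w_def)
      then show ?thesis using wW[of "Suc j" "Suc i"] \<open>j < i\<close> by simp
    qed
  qed
  \<comment> \<open>All \<open>k\<close> must be treated together, because moving \<open>k\<close>
    past \<open>z\<close> produces the further element \<open>br k z\<close> of
    \<open>K\<close>.\<close>
  have kw: "\<forall>k\<in>K. br k (w i) - \<mu> k \<cdot> w i \<in> W i" for i
  proof (induction i)
    case 0
    then show ?case using v(2) by (simp add: w_def W0)
  next
    case (Suc i)
    show ?case
    proof
      fix k assume k: "k \<in> K"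
      have "br k (w (Suc i)) - \<mu> k \<cdot> w (Suc i)
          = (br (br k z) (w i) - \<mu> (br k z) \<cdot> w i) + \<mu> (br k z) \<cdot> w i + br z (br k (w i) - \<mu> k \<cdot> w i)"
        by (simp add: w_def br_br br_diff br_scale_right)
      moreover have "br (br k z) (w i) - \<mu> (br k z) \<cdot> w i \<in> W (Suc i)"
        using Suc K[OF k] Wmono[of i "Suc i"] by auto
      moreover have "\<mu> (br k z) \<cdot> w i \<in> W (Suc i)"
        by (rule subspace_scale[OF sW wW]) simp
      moreover have "br z (br k (w i) - \<mu> k \<cdot> w i) \<in> W (Suc i)"
        by (rule zW) (use Suc k in blast)
      ultimately show "br k (w (Suc i)) - \<mu> k \<cdot> w (Suc i) \<in> W (Suc i)"
        by (simp only: subspace_add[OF sW])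
    qed
  qed
  have kW: "br k x \<in> W i" if "k \<in> K" "x \<in> W i" for k x i
    using that(2)
  proof (induction i arbitrary: x)
    case 0
    then show ?case using U(3) that(1) by (simp add: W0)
  next
    case (Suc i)
    show ?case unfolding WSuc
      by (rule span_insert_stable[OF sW lin_br Suc.IH _ Suc.prems[unfolded WSuc]])
        (use kw that(1) in auto)
  qed
  \<comment> \<open>In finite dimension the Krylov vectors become dependent. The first such index
    \<open>n\<close> makes \<open>W n\<close> stable under \<open>z\<close>, while each earlier step
    still adds exactly one dimension.\<close>
  have "\<exists>n. w n \<in> W n"
  proof (rule ccontr)
    assume no: "\<nexists>n. w n \<in> W n"
    have "dim (W n) \<ge> n" for n
    proof (induction n)
      case (Suc n)
      then show ?case using no by (simp add: WSuc dim_insert span_eq_iff[THEN iffD2, OF sW])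
    qed simp
    from this[of "Suc dimension"] dim_subset_UNIV[of "W (Suc dimension)"] show False by simp
  qed
  then obtain n where n: "w n \<in> W n" "\<And>m. m < n \<Longrightarrow> w m \<notin> W m"
    using LeastI_ex[of "\<lambda>n. w n \<in> W n"] not_less_Least by blast
  have "n \<noteq> 0" using n(1) v(1) by (intro notI) (simp add: W0 w_def)
  have trW: "i \<le> n \<Longrightarrow> tr (W i) (br k) = tr U (br k) + of_nat i * \<mu> k" if "k \<in> K" for i k
  proof (induction i)
    case (Suc i)
    have "tr (W (Suc i)) (br k) = tr (W i) (br k) + \<mu> k"
      unfolding WSuc by (rule tr_insert[OF sW _ lin_br kW])
        (use n(2) Suc.prems kw that in auto)
    then show ?case using Suc by (simp add: algebra_simps)
  qed (simp add: W0)
  have "W (Suc n) = W n" unfolding WSuc using n(1) sW by (simp add: insert_absorb span_eq_iff)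
  then have zWn: "br z x \<in> W n" if "x \<in> W n" for x using zW[OF that] by simp
  have comm: "br (br k z) = (\<lambda>x. br k (br z x) - br z (br k x))"
    by (rule ext) (simp add: br_br)
  \<comment> \<open>Both traces vanish because \<open>br (br k z)\<close> is a commutator of
    operators preserving \<open>W n\<close> and \<open>U\<close>. By \<open>trW\<close> only n times
    \<open>\<mu> (br k z)\<close> remains, and n is positive.\<close>
  have "tr (W n) (br (br k z)) = 0"
    unfolding comm by (rule tr_commutator[OF sW lin_br kW[OF k] lin_br zWn])
  moreover have "tr U (br (br k z)) = 0"
    unfolding comm by (rule tr_commutator[OF U(1) lin_br U(3)[OF k] lin_br U(2)])
  ultimately show ?thesis using trW[OF K[OF k], of n] \<open>n \<noteq> 0\<close> by simp
qed

text \<open>Stated for the action on \<open>V / U\<close>, the only kind of module in use. Induction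
  on \<open>dim B\<close>: an ideal \<open>K\<close> of codimension one has a weight vector, the
  whole weight space \<open>W\<close> is stable under the complementary \<open>z\<close> by
  \<open>weight_vanishes_on_commutators\<close>, and an eigenvector of \<open>z\<close> in
  \<open>W\<close> modulo \<open>U\<close> serves all of \<open>B\<close>.\<close>

theorem lie_theorem:
  assumes "subalgebra sm br B" "solvable sm br B"
    and "subspace U" "\<And>b u. b \<in> B \<Longrightarrow> u \<in> U \<Longrightarrow> br b u \<in> U"
    and "subspace V" "\<And>b v. b \<in> B \<Longrightarrow> v \<in> V \<Longrightarrow> br b v \<in> V"
    and "U \<subset> V"
  obtains x \<mu> where "x \<in> V" "x \<notin> U" "\<And>b. b \<in> B \<Longrightarrow> br b x - \<mu> b \<cdot> x \<in> U"
proof -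
  have "\<exists>x \<mu>. x \<in> V \<and> x \<notin> U \<and> (\<forall>b\<in>B. br b x - \<mu> b \<cdot> x \<in> U)"
    using assms(1,2,4,6)
  proof (induction "dim B" arbitrary: B rule: less_induct)
    case less
    note U = assms(3) and V = assms(5)
    show ?case
    proof (cases "B = {0}")
      case True
      then show ?thesis using assms(7) subspace_0[OF U]
        by (auto intro!: exI[of _ "\<lambda>_. 0"])
    next
      case False
      obtain K z where K: "subspace K" "drv B \<subseteq> K" "K \<subseteq> B" "z \<in> B" "z \<notin> K" "span (insert z K) = B"
        using exists_hyperplane[OF subspace_span subalgebraD(1)[OF less.prems(1)]
            solvable_drv_proper[OF less.prems(2,1) False]] .
      have KB: "br k b \<in> K" if "k \<in> B" "b \<in> B" for k b
        using br_in_drv[OF that] K(2) by blast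
      have Ksub: "subalgebra sm br K" unfolding subalgebra_iff using K KB by blast
      have "dim (span (insert z K)) = Suc (dim K)"
        using K(5) by (simp add: dim_insert span_eq_iff[THEN iffD2, OF K(1)])
      then have "dim K < dim B" using K(6) by simp
      moreover have "solvable sm br K" using solvable_subset[OF less.prems(2) K(3)] subspace_0 K(1) by blast
      ultimately obtain x0 \<mu> where x0: "x0 \<in> V" "x0 \<notin> U" "\<forall>b\<in>K. br b x0 - \<mu> b \<cdot> x0 \<in> U"
        using less.hyps[of K] Ksub less.prems(3,4) K(3) by (metis subsetD)
      define W where "W = {v \<in> V. \<forall>k\<in>K. br k v - \<mu> k \<cdot> v \<in> U}"
      have W: "subspace W"
        unfolding W_def
      proof (rule subspaceI)
        show "0 \<in> {v \<in> V. \<forall>k\<in>K. br k v - \<mu> k \<cdot> v \<in> U}"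
          using subspace_0 U V by simp
      next
        fix x y assume "x \<in> {v \<in> V. \<forall>k\<in>K. br k v - \<mu> k \<cdot> v \<in> U}" "y \<in> {v \<in> V. \<forall>k\<in>K. br k v - \<mu> k \<cdot> v \<in> U}"
        moreover have "br k (x + y) - \<mu> k \<cdot> (x + y) = (br k x - \<mu> k \<cdot> x) + (br k y - \<mu> k \<cdot> y)" for k
          by (simp add: br_add_right scale_right_distrib)
        ultimately show "x + y \<in> {v \<in> V. \<forall>k\<in>K. br k v - \<mu> k \<cdot> v \<in> U}"
          using U V by (auto simp: subspace_add)
      next
        fix c x assume "x \<in> {v \<in> V. \<forall>k\<in>K. br k v - \<mu> k \<cdot> v \<in> U}"
        moreover have "br k (c \<cdot> x) - \<mu> k \<cdot> (c \<cdot> x) = c \<cdot> (br k x - \<mu> k \<cdot> x)" for k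
          by (simp add: br_scale_right scale_right_diff_distrib mult.commute)
        ultimately show "c \<cdot> x \<in> {v \<in> V. \<forall>k\<in>K. br k v - \<mu> k \<cdot> v \<in> U}"
          using U V by (auto simp: subspace_scale)
      qed
      have UW: "U \<subseteq> W"
        using less.prems(3) K(3) assms(7) U
        by (auto simp: W_def intro!: subspace_diff[OF U] subspace_scale[OF U])
      have zW: "br z v \<in> W" if v: "v \<in> W" for v
      proof (cases "v \<in> U")
        case True
        then show ?thesis using less.prems(3) K(4) UW by blast
      next
        case False
        have "br k (br z v) - \<mu> k \<cdot> br z v \<in> U" if k: "k \<in> K" for k
        proof -
          have "\<mu> (br k z) = 0"
            by (rule weight_vanishes_on_commutators[OF U _ _ _ False _ k])
              (use less.prems(3) K KB v in \<open>auto simp: W_def\<close>)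
          moreover have "br k z \<in> K" using KB k K by blast
          ultimately have "br (br k z) v \<in> U" using v by (auto simp: W_def)
          moreover have "br z (br k v - \<mu> k \<cdot> v) \<in> U"
            using less.prems(3)[OF K(4)] v k by (auto simp: W_def)
          moreover have "br k (br z v) - \<mu> k \<cdot> br z v = br (br k z) v + br z (br k v - \<mu> k \<cdot> v)"
            by (simp add: br_br br_diff br_scale_right)
          ultimately show ?thesis by (simp only: subspace_add[OF U])
        qed
        then show ?thesis using v less.prems(4) K(4) by (auto simp: W_def)
      qed
      have "U \<subset> W" using UW x0 by (auto simp: W_def)
      then obtain x c where x: "x \<in> W" "x \<notin> U" "br z x - c \<cdot> x \<in> U"
        using relative_eigenvector[OF lin_br U W zW] by blast
      have "\<exists>\<nu>. br b x - \<nu> \<cdot> x \<in> U" if b: "b \<in> B" for b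
      proof -
        obtain a k where k: "k \<in> K" "b = k + a \<cdot> z"
          using in_span_insertE[OF K(1), of b z] b K(6) by blast
        have "br b x - (\<mu> k + a * c) \<cdot> x = (br k x - \<mu> k \<cdot> x) + a \<cdot> (br z x - c \<cdot> x)"
          by (simp add: k br_add_left br_scale_left algebra_simps)
        also have "\<dots> \<in> U" using x k U by (auto simp: W_def intro!: subspace_add subspace_scale)
        finally show ?thesis by blast
      qed
      then obtain \<nu> where "\<forall>b\<in>B. br b x - \<nu> b \<cdot> x \<in> U" by metis
      then show ?thesis using x by (auto simp: W_def)
    qed
  qed
  with that show ?thesis by blast
qed

text \<open>Modulo \<open>U\<close> the iterates multiply \<open>x\<close> by powers of
  \<open>c\<close>, so a nonzero \<open>c\<close> would never let them reach
  \<open>U\<close>.\<close>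

lemma nilpotent_weight_zero:
  assumes U: "subspace U" and x: "x \<notin> U" "T x - c \<cdot> x \<in> U" and T: "lin T" "\<And>u. u \<in> U \<Longrightarrow> T u \<in> U"
    and n: "(T ^^ n) x \<in> U"
  shows "c = 0"
proof (rule ccontr)
  assume c: "c \<noteq> 0"
  have "(T ^^ n) x - c ^ n \<cdot> x \<in> U" for n
  proof (induction n)
    case 0
    show ?case using subspace_0[OF U] by simp
  next
    case (Suc n)
    have "(T ^^ Suc n) x - c ^ Suc n \<cdot> x = T ((T ^^ n) x - c ^ n \<cdot> x) + c ^ n \<cdot> (T x - c \<cdot> x)"
      by (simp add: lin_diff[OF T(1)] lin_scale[OF T(1)] scale_right_diff_distrib mult.commute)
    then show ?case using Suc x(2) T(2) U by (auto intro!: subspace_add subspace_scale)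
  qed
  from subspace_diff[OF U n this[of n]] have "c ^ n \<cdot> x \<in> U" by simp
  then have "inverse (c ^ n) \<cdot> c ^ n \<cdot> x \<in> U" using subspace_scale[OF U] by blast
  then show False using c x(1) by simp
qed

text \<open>By Lie's theorem, a solvable subalgebra of maximal dimension can be extended unless it is everything.\<close>
theorem engel_solvable:
  assumes D: "subalgebra sm br D" and nil: "\<And>x v. x \<in> D \<Longrightarrow> v \<in> D \<Longrightarrow> \<exists>n. (br x ^^ n) v = 0"
  shows "solvable sm br D"
proof -
  define P where "P n \<longleftrightarrow> (\<exists>K. subalgebra sm br K \<and> solvable sm br K \<and> K \<subseteq> D \<and> dim K = n)" for n
  have "P 0" unfolding P_def
    using subspace_0[OF subalgebraD(1)[OF D]]
    by (intro exI[of _ "{0}"]) (auto simp: subalgebra_iff solvable_def intro: exI[of _ 0])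
  moreover have "n \<le> dimension" if "P n" for n
    using that dim_subset_UNIV by (auto simp: P_def)
  ultimately obtain m where m: "P m" "\<And>n. P n \<Longrightarrow> n \<le> m"
    by (metis Greatest_le_nat GreatestI_nat)
  then obtain K where K: "subalgebra sm br K" "solvable sm br K" "K \<subseteq> D" "dim K = m"
    by (auto simp: P_def)
  note sK = subalgebraD(1)[OF K(1)]
  have "K = D"
  proof (rule ccontr)
    assume "K \<noteq> D"
    then have "K \<subset> D" using K by blast
    then obtain x \<mu> where x: "x \<in> D" "x \<notin> K" "\<And>k. k \<in> K \<Longrightarrow> br k x - \<mu> k \<cdot> x \<in> K"
      using lie_theorem[OF K(1,2) sK subalgebraD(2)[OF K(1)] subalgebraD(1)[OF D], of thesis]
        subalgebraD(2)[OF D] K(3) by blast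
    have kx: "br k x \<in> K" if k: "k \<in> K" for k
    proof -
      obtain n where "(br k ^^ n) x = 0" using nil x(1) k K(3) by blast
      then have "(br k ^^ n) x \<in> K" using subspace_0[OF sK] by simp
      then have "\<mu> k = 0"
        by (rule nilpotent_weight_zero[where T = "br k", OF sK x(2) x(3)[OF k] lin_br, rotated])
          (use subalgebraD(2)[OF K(1)] k in auto)
      then show ?thesis using x(3)[OF k] by simp
    qed
    have xk: "br x k \<in> K" if "k \<in> K" for k
      using kx[OF that] subspace_neg[OF sK] br_swap[of x k] by auto
    let ?L = "span (insert x K)"
    \<comment> \<open>The brackets of \<open>x\<close> with \<open>K\<close> fall into
      \<open>K\<close> and \<open>br x x = 0\<close>, so even the derived algebra of the extension
      lies in \<open>K\<close>; this gives subalgebra and solvability at once.\<close>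
    have LL: "br a b \<in> K" if a: "a \<in> ?L" and b: "b \<in> ?L" for a b
    proof -
      obtain s k where "k \<in> K" "a = k + s \<cdot> x" using in_span_insertE[OF sK a] .
      moreover obtain t l where "l \<in> K" "b = l + t \<cdot> x" using in_span_insertE[OF sK b] .
      ultimately show ?thesis using kx xk subalgebraD(2)[OF K(1)] sK
        by (auto simp: br_add_left br_add_right br_scale_left br_scale_right
            intro!: subspace_add subspace_scale)
    qed
    have KL: "K \<subseteq> ?L" using span_superset[of "insert x K"] by auto
    have "subalgebra sm br ?L" using LL KL by (auto simp: subalgebra_iff)
    moreover have "solvable sm br ?L"
      by (rule solvable_by_drv[OF K(2)]) (rule span_minimal, use LL sK in \<open>auto simp: brs_def\<close>)
    moreover have "?L \<subseteq> D" using x(1) K(3) subalgebraD(1)[OF D] by (intro span_minimal) auto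
    moreover have "dim ?L = Suc m"
      using K(4) x(2) by (simp add: dim_insert span_eq_iff[THEN iffD2, OF sK])
    ultimately have "P (Suc m)" unfolding P_def by blast
    then show False using m(2) by fastforce
  qed
  with K show ?thesis by simp
qed

section \<open>The Killing form, Cartan's criterion and its converse\<close>

definition kappa :: "'g \<Rightarrow> 'g \<Rightarrow> complex" where
  "kappa x y = tr UNIV (br x \<circ> br y)"

lemma trU_commute: "lin S \<Longrightarrow> lin T \<Longrightarrow> tr UNIV (S \<circ> T) = tr UNIV (T \<circ> S)"
  and trU_add: "lin S \<Longrightarrow> lin T \<Longrightarrow> tr UNIV (\<lambda>v. S v + T v) = tr UNIV S + tr UNIV T"
  and trU_diff: "lin S \<Longrightarrow> lin T \<Longrightarrow> tr UNIV (\<lambda>v. S v - T v) = tr UNIV S - tr UNIV T"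
  and trU_scale: "lin S \<Longrightarrow> tr UNIV (\<lambda>v. c \<cdot> S v) = c * tr UNIV S"
  by (auto intro!: tr_commute tr_add tr_diff tr_scale)

lemma tr_br_add: "lin S \<Longrightarrow> tr UNIV (br (x + y) \<circ> S) = tr UNIV (br x \<circ> S) + tr UNIV (br y \<circ> S)"
  using trU_add[OF lin_comp[OF lin_br] lin_comp[OF lin_br], of S S x y]
  by (simp add: comp_def br_add_left)

lemma tr_br_scale: "lin S \<Longrightarrow> tr UNIV (br (c \<cdot> x) \<circ> S) = c * tr UNIV (br x \<circ> S)"
  using trU_scale[OF lin_comp[OF lin_br], of S c x]
  by (simp add: comp_def br_scale_left)

lemma kappa_sym: "kappa x y = kappa y x"
  unfolding kappa_def by (rule trU_commute[OF lin_br lin_br])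

lemma kappa_add_left: "kappa (x + y) z = kappa x z + kappa y z"
  and kappa_scale_left: "kappa (c \<cdot> x) z = c * kappa x z"
  by (simp_all add: kappa_def tr_br_add tr_br_scale lin_br)

lemma kappa_add_right: "kappa z (x + y) = kappa z x + kappa z y"
  and kappa_scale_right: "kappa z (c \<cdot> x) = c * kappa z x"
  by (simp_all add: kappa_sym[of z] kappa_add_left kappa_scale_left)

lemma kappa_0 [simp]: "kappa 0 x = 0" "kappa x 0 = 0"
  using kappa_scale_left[of 0 0 x] kappa_scale_right[of x 0 0] by auto

lemma kappa_minus: "kappa (- x) y = - kappa x y" "kappa x (- y) = - kappa x y"
  using kappa_scale_left[of "-1" x y] kappa_scale_right[of x "-1" y] by (auto simp: scale_minus_left)

lemma kappa_diff: "kappa (x - y) z = kappa x z - kappa y z" "kappa z (x - y) = kappa z x - kappa z y"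
  using kappa_add_left[of x "- y" z] kappa_add_right[of z x "- y"] by (auto simp: kappa_minus)

lemma kappa_invariant: "kappa (br x y) z = kappa x (br y z)"
proof -
  have "kappa (br x y) z = tr UNIV (\<lambda>v. (br x \<circ> (br y \<circ> br z)) v - (br y \<circ> (br x \<circ> br z)) v)"
    by (simp add: kappa_def comp_def br_br)
  also have "\<dots> = tr UNIV (br x \<circ> (br y \<circ> br z)) - tr UNIV (br y \<circ> (br x \<circ> br z))"
    by (intro trU_diff lin_comp lin_br)
  also have "tr UNIV (br y \<circ> (br x \<circ> br z)) = tr UNIV ((br x \<circ> br z) \<circ> br y)"
    by (intro trU_commute lin_comp lin_br)
  also have "tr UNIV (br x \<circ> (br y \<circ> br z)) - tr UNIV ((br x \<circ> br z) \<circ> br y)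
      = tr UNIV (\<lambda>v. (br x \<circ> (br y \<circ> br z)) v - ((br x \<circ> br z) \<circ> br y) v)"
    by (intro trU_diff[symmetric] lin_comp lin_br)
  also have "\<dots> = kappa x (br y z)"
    by (simp add: kappa_def comp_def br_br br_diff)
  finally show ?thesis .
qed

lemma subspace_kappa_perp: "subspace {x. \<forall>y\<in>A. kappa x y = 0}"
  by (auto simp: subspace_def kappa_add_left kappa_scale_left)

lemma kappa_span_right:
  assumes "\<And>y. y \<in> A \<Longrightarrow> kappa x y = 0" "y \<in> span A" shows "kappa x y = 0"
proof -
  have "span A \<subseteq> {y. \<forall>z\<in>{x}. kappa y z = 0}"
    by (rule span_minimal[OF _ subspace_kappa_perp]) (use assms kappa_sym in auto)
  then show ?thesis using assms(2) kappa_sym by auto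
qed

text \<open>The shift of the bracket by c + d is the sum of the brackets with one factor shifted.
  This calls for nested inductions, on the exponent of \<open>x\<close> and then on that of
  \<open>y\<close>.\<close>

lemma geig_derivation:
  assumes D: "lin D" "\<And>x y. D (br x y) = br (D x) y + br x (D y)"
    and xy: "x \<in> geig D c" "y \<in> geig D d"
  shows "br x y \<in> geig D (c + d)"
proof -
  note sG = subspace_geig[OF D(1), of "c + d"]
  have "\<forall>y\<in>geig D d. br x y \<in> geig D (c + d)"
    using D(1) xy(1)
  proof (induction rule: geig_induct)
    case zero
    show ?case using subspace_0[OF sG] by simp
  next
    case (step x)
    show ?case
    proof
      fix y assume "y \<in> geig D d"
      with D(1) show "br x y \<in> geig D (c + d)"
      proof (induction rule: geig_induct)
        case zero
        show ?case using subspace_0[OF sG] by simp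
      next
        case (step y)
        have "D (br x y) - (c + d) \<cdot> br x y = br (D x - c \<cdot> x) y + br x (D y - d \<cdot> y)"
          by (simp add: D(2) br_diff br_scale_left br_scale_right algebra_simps)
        also have "\<dots> \<in> geig D (c + d)"
          using step \<open>\<forall>y\<in>geig D d. br (D x - c \<cdot> x) y \<in> geig D (c + d)\<close>
          by (intro subspace_add[OF sG]) auto
        finally show ?case using shift_in_geig[OF D(1)] by blast
      qed
    qed
  qed
  with xy(2) show ?thesis by blast
qed

text \<open>On generalized eigenvectors for c and d the Leibniz rule reads
  \<open>\<phi> (c + d) = \<phi> c + \<phi> d\<close>; bilinearity does the rest. Both the identity
  and \<open>cnj\<close> are additive.\<close>

lemma spectral_derivation:
  assumes D: "lin D" "\<And>x y. D (br x y) = br (D x) y + br x (D y)"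
    and S: "lin S" "\<And>c v. v \<in> geig D c \<Longrightarrow> S v = \<phi> c \<cdot> v"
    and \<phi>: "\<And>c d. \<phi> (c + d) = \<phi> c + \<phi> d"
  shows "S (br x y) = br (S x) y + br x (S y)"
proof -
  have G: "v \<in> span (\<Union>c. UNIV \<inter> geig D c)" for v
    using geig_decomp[OF D(1), of UNIV] by auto
  have 1: "S (br x y) - br (S x) y - br x (S y) = 0" if x: "x \<in> geig D c" for c x y
  proof -
    have "lin (\<lambda>y. S (br x y) - br (S x) y - br x (S y))"
      by (rule linI) (auto simp: lin_add[OF S(1)] lin_scale[OF S(1)] br_add_right br_scale_right algebra_simps)
    then have "S (br x y) - br (S x) y - br x (S y) \<in> {0}"
    proof (rule lin_span_subset[OF _ _ _ G])
      fix y assume "y \<in> (\<Union>c. UNIV \<inter> geig D c)"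
      then obtain d where y: "y \<in> geig D d" by blast
      show "S (br x y) - br (S x) y - br x (S y) \<in> {0}"
        using S(2)[OF x] S(2)[OF y] S(2)[OF geig_derivation[OF D x y]]
        by (simp add: \<phi> br_scale_left br_scale_right algebra_simps)
    qed auto
    then show ?thesis by simp
  qed
  have "lin (\<lambda>x. S (br x y) - br (S x) y - br x (S y))"
    by (rule linI) (auto simp: lin_add[OF S(1)] lin_scale[OF S(1)] br_add_left br_scale_left algebra_simps)
  then have "S (br x y) - br (S x) y - br x (S y) \<in> {0}"
    by (rule lin_span_subset[OF _ _ _ G]) (use 1 in auto)
  then show ?thesis by (simp add: algebra_simps)
qed

text \<open>Take \<open>S\<close> acting as conjugate eigenvalues of \<open>br z\<close>. Being a
  derivation, it satisfies tr (ad [u,v] S) = - kappa u (S v), and \<open>S v\<close> lies in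
  \<open>drv L\<close> because \<open>br z\<close> maps \<open>L\<close> there. Orthogonality makes
  the trace vanish on \<open>drv L\<close>, in particular at \<open>z\<close>, where it is the sum
  of the squared moduli of the eigenvalues.\<close>

lemma cartan_nilpotent:
  assumes L: "subalgebra sm br L" and orth: "\<And>a z. a \<in> L \<Longrightarrow> z \<in> drv L \<Longrightarrow> kappa a z = 0"
    and z: "z \<in> drv L"
  shows "\<exists>n. (br z ^^ n) v = 0"
proof -
  obtain S where S: "lin S" "\<And>c v. v \<in> geig (br z) c \<Longrightarrow> S v = cnj c \<cdot> v"
    using exists_spectral_operator[OF lin_br, where \<phi> = cnj] by blast
  have der: "S (br x y) = br (S x) y + br x (S y)" for x y
    by (rule spectral_derivation[OF lin_br br_derivation S]) auto
  have zL: "z \<in> L" using drv_subset[OF L] z by blast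
  have SL: "S v \<in> drv L" if "v \<in> L" for v
    by (rule spectral_operator_image[OF lin_br S _ subalgebraD(1)[OF L] subspace_span drv_subset[OF L] br_in_drv[OF zL]])
      (use that in auto)
  let ?Z = "{z. tr UNIV (br z \<circ> S) = 0}"
  have "brs br L L \<subseteq> ?Z"
  proof
    fix b assume "b \<in> brs br L L"
    then obtain u v where uv: "u \<in> L" "v \<in> L" "b = br u v" by (auto simp: brs_def)
    have "tr UNIV (br b \<circ> S) = tr UNIV (\<lambda>w. (br u \<circ> (br v \<circ> S)) w - (br v \<circ> (br u \<circ> S)) w)"
      by (simp add: uv comp_def br_br)
    also have "\<dots> = tr UNIV (br u \<circ> (br v \<circ> S)) - tr UNIV (br v \<circ> (br u \<circ> S))"
      by (intro trU_diff lin_comp lin_br S)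
    also have "tr UNIV (br v \<circ> (br u \<circ> S)) = tr UNIV ((br u \<circ> S) \<circ> br v)"
      by (intro trU_commute lin_comp lin_br S)
    also have "tr UNIV (br u \<circ> (br v \<circ> S)) - \<dots>
        = tr UNIV (\<lambda>w. (br u \<circ> (br v \<circ> S)) w - ((br u \<circ> S) \<circ> br v) w)"
      by (intro trU_diff[symmetric] lin_comp lin_br S)
    also have "\<dots> = kappa u (- S v)"
      by (simp add: kappa_def comp_def der br_add_right br_minus)
    also have "\<dots> = 0" using orth[OF uv(1) SL[OF uv(2)]] by (simp add: kappa_minus)
    finally show "b \<in> ?Z" by (simp add: comp_def)
  qed
  moreover have "subspace ?Z"
    using tr_br_scale[OF S(1), of 0 0] by (auto simp: subspace_def tr_br_add[OF S(1)] tr_br_scale[OF S(1)])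
  ultimately have "tr UNIV (br z \<circ> S) = 0" using span_minimal[of "brs br L L" ?Z] z by auto
  from trace_conj_nilpotent[OF lin_br S this] show ?thesis .
qed

theorem cartan_criterion:
  assumes L: "subalgebra sm br L" and orth: "\<And>a z. a \<in> L \<Longrightarrow> z \<in> drv L \<Longrightarrow> kappa a z = 0"
  shows "solvable sm br L"
proof -
  have "solvable sm br (drv L)"
    by (rule engel_solvable[OF subalgebra_drv[OF L]]) (rule cartan_nilpotent[OF L orth])
  then show ?thesis by (rule solvable_by_drv) simp
qed

text \<open>On the line spanned by \<open>x\<close> modulo \<open>U\<close> the elements of
  \<open>B\<close> act by scalars, and scalars commute.\<close>

lemma solvable_weight_drv:
  assumes B: "subalgebra sm br B" and U: "subspace U" "\<And>b u. b \<in> B \<Longrightarrow> u \<in> U \<Longrightarrow> br b u \<in> U"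
    and x: "x \<notin> U" "\<And>b. b \<in> B \<Longrightarrow> br b x - \<mu> b \<cdot> x \<in> U" and c: "c \<in> drv B"
  shows "br c x \<in> U"
proof (rule lin_span_subset[OF lin_br_left U(1) _ c])
  fix b assume "b \<in> brs br B B"
  then obtain u v where uv: "u \<in> B" "v \<in> B" "b = br u v" by (auto simp: brs_def)
  have "br b x = br u (br v x - \<mu> v \<cdot> x) + \<mu> v \<cdot> (br u x - \<mu> u \<cdot> x)
      - (br v (br u x - \<mu> u \<cdot> x) + \<mu> u \<cdot> (br v x - \<mu> v \<cdot> x))"
    by (simp add: uv(3) br_br br_diff br_scale_right scale_right_diff_distrib mult.commute)
  moreover have "br u (br v x - \<mu> v \<cdot> x) \<in> U" "\<mu> v \<cdot> (br u x - \<mu> u \<cdot> x) \<in> U"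
      "br v (br u x - \<mu> u \<cdot> x) \<in> U" "\<mu> u \<cdot> (br v x - \<mu> v \<cdot> x) \<in> U"
    using uv(1,2) x(2) U(2) subspace_scale[OF U(1)] by blast+
  ultimately show "br b x \<in> U"
    by (simp only: subspace_diff[OF U(1)] subspace_add[OF U(1)])
qed

text \<open>Lie's theorem triangulates \<open>B\<close> on the whole algebra along a flag;
  \<open>drv B\<close> acts strictly triangularly, so each product with it has zero
  diagonal.\<close>

lemma kappa_solvable:
  assumes B: "subalgebra sm br B" "solvable sm br B" and b: "b \<in> B" and c: "c \<in> drv B"
  shows "kappa b c = 0"
proof -
  have cB: "c \<in> B" using drv_subset[OF B(1)] c by blast
  define P where "P U \<longleftrightarrow> (\<forall>b\<in>B. \<forall>u\<in>U. br b u \<in> U) \<and> tr U (br b \<circ> br c) = 0" for U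
  have "P UNIV"
  proof (induction rule: flag_induct)
    case zero
    show ?case by (simp add: P_def tr_zero_space lin_comp lin_br)
  next
    case (step U)
    then have U: "\<And>b u. b \<in> B \<Longrightarrow> u \<in> U \<Longrightarrow> br b u \<in> U" "tr U (br b \<circ> br c) = 0"
      by (auto simp: P_def)
    obtain x \<mu> where x: "x \<notin> U" "\<And>b. b \<in> B \<Longrightarrow> br b x - \<mu> b \<cdot> x \<in> U"
      using lie_theorem[OF B step(1) U(1) subspace_UNIV, of thesis] step(2) by blast
    have "br c x \<in> U" by (rule solvable_weight_drv[OF B(1) step(1) U(1) x c])
    then have "(br b \<circ> br c) x - 0 \<cdot> x \<in> U" using U(1)[OF b] by simp
    then have "tr (span (insert x U)) (br b \<circ> br c) = 0"
      using tr_insert[OF step(1) x(1) lin_comp[OF lin_br lin_br], of b c 0] U b cB by simp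
    moreover have "br b' u \<in> span (insert x U)" if "b' \<in> B" "u \<in> span (insert x U)" for b' u
      by (rule span_insert_stable[OF step(1) lin_br U(1)[OF that(1)] x(2)[OF that(1)] that(2)])
    ultimately show ?case using x(1) by (auto simp: P_def)
  qed
  then show ?thesis by (simp add: P_def kappa_def)
qed

lemma lin_imp_linear: "lin T \<Longrightarrow> Vector_Spaces.linear sm sm T"
  by (simp add: Vector_Spaces.linear_iff lin_def vector_space_axioms)

end

section \<open>Consequences of semisimplicity: nondegenerate Killing form, inner derivations\<close>

locale semisimple_lie = lie_alg +
  assumes ss: "semisimple sm br"
begin

text \<open>The radical of the Killing form is an ideal, solvable by Cartan's criterion because it
  is orthogonal to everything, hence zero.\<close>

lemma kappa_nondegenerate:
  assumes "\<And>y. kappa x y = 0" shows "x = 0"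
proof -
  define S where "S = {x. \<forall>y\<in>UNIV. kappa x y = 0}"
  have sS: "subspace S" unfolding S_def by (rule subspace_kappa_perp)
  have ideal: "br a b \<in> S" if "b \<in> S" for a b
  proof -
    have "kappa (br a b) y = - kappa b (br a y)" for y
      by (simp only: br_swap[of a b] kappa_minus kappa_invariant)
    then show ?thesis using that by (simp add: S_def)
  qed
  have "subalgebra sm br S" using sS ideal by (simp add: subalgebra_iff)
  moreover have "kappa a z = 0" if "a \<in> S" for a z using that by (simp add: S_def)
  ultimately have "solvable sm br S" using cartan_criterion by blast
  moreover have "lie_ideal sm br S" using sS ideal by (auto simp: lie_ideal_def csubspace_eq brs_def)
  ultimately have "S = {0}" using ss by (simp add: semisimple_def)
  then show ?thesis using assms by (auto simp: S_def)
qed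

lemma ad_injective: "(\<And>y. br x y = 0) \<Longrightarrow> x = 0"
proof (rule kappa_nondegenerate)
  fix y assume "\<And>y. br x y = 0"
  then have "br x \<circ> br y = (\<lambda>_. 0)" by auto
  then show "kappa x y = 0"
    using trU_scale[OF lin_br, of 0] by (simp add: kappa_def)
qed

text \<open>Functionals are encoded by their values on \<open>Basis\<close>, read as coordinates of
  a vector. The Killing form then becomes an injective endomorphism \<open>F\<close>, which is
  surjective by dimension.\<close>

lemma kappa_represents:
  assumes \<phi>: "\<And>x y. \<phi> (x + y) = \<phi> x + \<phi> y" "\<And>c x. \<phi> (c \<cdot> x) = c * \<phi> x"
  obtains d where "\<And>y. kappa d y = \<phi> y"
proof -
  define F where "F v = (\<Sum>b\<in>Basis. kappa v b \<cdot> b)" for v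
  have F: "lin F"
    by (rule linI) (simp_all add: F_def kappa_add_left kappa_scale_left scale_left_distrib
        sum.distrib scale_sum_right)
  have coord: "f b = g b" if "(\<Sum>b\<in>Basis. f b \<cdot> b) = (\<Sum>b\<in>Basis. g b \<cdot> b)" "b \<in> Basis" for f g b
  proof (rule ccontr)
    assume "f b \<noteq> g b"
    moreover have "(\<Sum>b\<in>Basis. (f b - g b) \<cdot> b) = 0"
      using that(1) by (simp add: scale_left_diff_distrib sum_subtractf)
    ultimately have "dependent Basis" unfolding dependent_explicit
      using that(2) finite_Basis by (intro exI[of _ Basis] exI[of _ "\<lambda>b. f b - g b"]) auto
    then show False using independent_Basis by simp
  qed
  have "inj F"
  proof (rule injI)
    fix x y assume "F x = F y"
    then have "kappa x b = kappa y b" if "b \<in> Basis" for b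
      using coord[of "kappa x" "kappa y" b] that by (simp add: F_def)
    then have "kappa (x - y) z = 0" for z
      using kappa_span_right[of Basis "x - y" z] span_Basis by (auto simp: kappa_diff)
    then show "x = y" using kappa_nondegenerate[of "x - y"] by simp
  qed
  then have "surj F" by (rule linear_inj_imp_surj[OF lin_imp_linear[OF F]])
  then obtain d where d: "F d = (\<Sum>b\<in>Basis. \<phi> b \<cdot> b)" by (metis surjD)
  have "subspace {y. kappa d y - \<phi> y = 0}"
    using \<phi>(2)[of 0 0] by (auto simp: subspace_def \<phi> kappa_add_right kappa_scale_right algebra_simps)
  moreover have "Basis \<subseteq> {y. kappa d y - \<phi> y = 0}"
    using coord[of "kappa d" \<phi>] d by (auto simp: F_def)
  ultimately have "span Basis \<subseteq> {y. kappa d y - \<phi> y = 0}" by (rule span_minimal[rotated])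
  then have "kappa d y = \<phi> y" for y using span_Basis by auto
  with that show ?thesis by blast
qed

text \<open>Choose \<open>d\<close> so that \<open>br d\<close> and \<open>D\<close> have the same
  trace against every \<open>br y\<close>. The difference \<open>E\<close> is a derivation with tr
  (ad y E) = 0 for all y, and cyclicity gives kappa (E a) b = tr (E ad [a,b]) = 0.\<close>

lemma derivation_inner:
  assumes D: "lin D" "\<And>x y. D (br x y) = br (D x) y + br x (D y)"
  obtains d where "D = br d"
proof -
  obtain d where d: "\<And>y. kappa d y = tr UNIV (br y \<circ> D)"
    using kappa_represents[of "\<lambda>y. tr UNIV (br y \<circ> D)"] tr_br_add[OF D(1)] tr_br_scale[OF D(1)] by blast
  define E where "E x = D x - br d x" for x
  have E: "lin E" by (rule linI) (auto simp: E_def lin_add[OF D(1)] lin_scale[OF D(1)] br_add_right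
        br_scale_right algebra_simps)
  have Eder: "E (br x y) = br (E x) y + br x (E y)" for x y
    by (simp add: E_def D(2) br_diff br_derivation[of d x y])
  have trE: "tr UNIV (br y \<circ> E) = 0" for y
  proof -
    have "tr UNIV (br y \<circ> E) = tr UNIV (\<lambda>v. (br y \<circ> D) v - (br y \<circ> br d) v)"
      by (simp add: E_def comp_def br_diff)
    also have "\<dots> = tr UNIV (br y \<circ> D) - kappa y d"
      unfolding kappa_def by (intro trU_diff lin_comp lin_br D)
    also have "\<dots> = 0" using d[of y] kappa_sym[of d y] by simp
    finally show ?thesis .
  qed
  have "kappa (E a) b = 0" for a b
  proof -
    have "kappa (E a) b = tr UNIV (\<lambda>v. (E \<circ> (br a \<circ> br b)) v - (br a \<circ> (E \<circ> br b)) v)"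
      by (simp add: kappa_def comp_def Eder)
    also have "\<dots> = tr UNIV (E \<circ> (br a \<circ> br b)) - tr UNIV (br a \<circ> (E \<circ> br b))"
      by (intro trU_diff lin_comp lin_br E)
    also have "tr UNIV (br a \<circ> (E \<circ> br b)) = tr UNIV ((E \<circ> br b) \<circ> br a)"
      by (intro trU_commute lin_comp lin_br E)
    also have "tr UNIV (E \<circ> (br a \<circ> br b)) - \<dots> =
        tr UNIV (\<lambda>v. (E \<circ> (br a \<circ> br b)) v - ((E \<circ> br b) \<circ> br a) v)"
      by (intro trU_diff[symmetric] lin_comp lin_br E)
    also have "\<dots> = tr UNIV (E \<circ> br (br a b))"
      by (simp add: comp_def br_br lin_diff[OF E])
    also have "\<dots> = tr UNIV (br (br a b) \<circ> E)" by (intro trU_commute lin_br E)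
    finally show ?thesis using trE by simp
  qed
  then have "E a = 0" for a using kappa_nondegenerate by blast
  then have "D = br d" by (auto simp: E_def)
  with that show ?thesis by blast
qed

end

section \<open>Cartan subalgebras and roots\<close>

text \<open>These are the properties that survive complexification of a real Cartan subalgebra, in
  the form in which they are applied: solvability for Lie's theorem, nilpotency one element at a
  time.\<close>

locale cartan_lie = semisimple_lie sm Basis br
  for sm :: "complex \<Rightarrow> 'g::ab_group_add \<Rightarrow> 'g" (infixr \<open>\<cdot>\<close> 75) and Basis :: "'g set"
    and br :: "'g \<Rightarrow> 'g \<Rightarrow> 'g" +
  fixes h :: "'g set"
  assumes h_subalgebra: "subalgebra sm br h"
    and h_solvable: "solvable sm br h"
    and h_nilpotent: "\<And>x y. x \<in> h \<Longrightarrow> y \<in> h \<Longrightarrow> \<exists>n. (br x ^^ n) y = 0"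
    and h_normalizer: "\<And>x. (\<And>y. y \<in> h \<Longrightarrow> br x y \<in> h) \<Longrightarrow> x \<in> h"
begin

section \<open>Weight spaces and diagonal action of the Cartan subalgebra\<close>

lemmas h_subspace = subalgebraD(1)[OF h_subalgebra]

lemma h_geig: "x \<in> h \<Longrightarrow> y \<in> h \<Longrightarrow> y \<in> geig (br x) 0"
  using h_nilpotent by (simp add: geig_def)

lemma geig_h_stable: "x \<in> h \<Longrightarrow> y \<in> h \<Longrightarrow> v \<in> geig (br x) c \<Longrightarrow> br y v \<in> geig (br x) c"
  using geig_derivation[OF lin_br br_derivation h_geig, of x y v c] by simp

definition gws :: "('g \<Rightarrow> complex) \<Rightarrow> 'g set" where
  "gws \<alpha> = {v. \<forall>x\<in>h. v \<in> geig (br x) (\<alpha> x)}"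

lemma subspace_gws: "subspace (gws \<alpha>)"
proof -
  have "gws \<alpha> = \<Inter> ((\<lambda>x. geig (br x) (\<alpha> x)) ` h)" by (auto simp: gws_def)
  then show ?thesis using subspace_geig[OF lin_br] by (auto intro: subspace_Inter)
qed

text \<open>Split \<open>M\<close> by an element of \<open>h\<close> having more than one eigenvalue
  on it. The smaller pieces remain \<open>h\<close>-stable since \<open>h\<close> is nilpotent, and
  a piece that no element splits is a single generalized weight space.\<close>

lemma gws_decomp:
  assumes "subspace M" "\<And>x v. x \<in> h \<Longrightarrow> v \<in> M \<Longrightarrow> br x v \<in> M"
  shows "M \<subseteq> span (\<Union>\<alpha>. M \<inter> gws \<alpha>)"
  using assms
proof (induction "dim M" arbitrary: M rule: less_induct)
  case less
  show ?case
  proof (cases "\<forall>x\<in>h. \<exists>c. M \<subseteq> geig (br x) c")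
    case True
    then obtain \<alpha> where "\<forall>x\<in>h. M \<subseteq> geig (br x) (\<alpha> x)" by metis
    then have "M \<subseteq> (\<Union>\<alpha>. M \<inter> gws \<alpha>)" by (auto simp: gws_def)
    then show ?thesis using span_superset by blast
  next
    case False
    then obtain x where x: "x \<in> h" "\<And>c. \<not> M \<subseteq> geig (br x) c" by blast
    have sG: "subspace (M \<inter> geig (br x) c)" for c
      using less.prems(1) subspace_geig[OF lin_br] subspace_inter by blast
    have "M \<inter> geig (br x) c \<subseteq> span (\<Union>\<alpha>. M \<inter> gws \<alpha>)" for c
    proof -
      have "dim (M \<inter> geig (br x) c) < dim M"
      proof (rule ccontr)
        assume "\<not> ?thesis"
        then have "M \<inter> geig (br x) c = M"
          by (intro subspace_dim_equal[OF sG less.prems(1)]) auto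
        with x(2) show False by blast
      qed
      from less.hyps[OF this sG] less.prems(2) geig_h_stable[OF x(1)]
      have "M \<inter> geig (br x) c \<subseteq> span (\<Union>\<alpha>. M \<inter> geig (br x) c \<inter> gws \<alpha>)" by blast
      also have "\<dots> \<subseteq> span (\<Union>\<alpha>. M \<inter> gws \<alpha>)" by (rule span_mono) blast
      finally show ?thesis .
    qed
    then have "span (\<Union>c. M \<inter> geig (br x) c) \<subseteq> span (\<Union>\<alpha>. M \<inter> gws \<alpha>)"
      by (intro span_minimal) auto
    then show ?thesis using geig_decomp[OF lin_br less.prems(1), of x] less.prems(2)[OF x(1)] by blast
  qed
qed

text \<open>If the zero weight space were larger, Lie's theorem modulo \<open>h\<close> would give
  an \<open>x\<close> outside \<open>h\<close>, with weight 0 by nilpotency. Such an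
  \<open>x\<close> normalizes \<open>h\<close>, against self-normalization.\<close>

lemma gws_zero: "gws (\<lambda>_. 0) = h"
proof (rule ccontr)
  let ?Z = "gws (\<lambda>_. 0)"
  assume "?Z \<noteq> h"
  moreover have "h \<subseteq> ?Z" using h_geig by (auto simp: gws_def)
  ultimately have "h \<subset> ?Z" by blast
  moreover have "br b v \<in> ?Z" if "b \<in> h" "v \<in> ?Z" for b v
    using that geig_h_stable by (auto simp: gws_def)
  ultimately obtain x \<mu> where x: "x \<in> ?Z" "x \<notin> h" "\<And>b. b \<in> h \<Longrightarrow> br b x - \<mu> b \<cdot> x \<in> h"
    using lie_theorem[OF h_subalgebra h_solvable h_subspace subalgebraD(2)[OF h_subalgebra]
        subspace_gws, of "\<lambda>_. 0" thesis] by blast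
  have "br x b \<in> h" if b: "b \<in> h" for b
  proof -
    obtain n where "(br b ^^ n) x = 0" using x(1) b by (auto simp: gws_def geig_def)
    then have n: "(br b ^^ n) x \<in> h" using subspace_0[OF h_subspace] by simp
    have "\<mu> b = 0"
      by (rule nilpotent_weight_zero[where T = "br b", OF h_subspace x(2) x(3)[OF b] lin_br _ n])
        (use subalgebraD(2)[OF h_subalgebra] b in auto)
    then show ?thesis using x(3)[OF b] br_swap[of x b] subspace_neg[OF h_subspace] by simp
  qed
  from h_normalizer[OF this] x(2) show False by blast
qed

lemma kappa_geig:
  assumes x: "x \<in> geig (br z) c" and y: "y \<in> geig (br z) d" and cd: "c + d \<noteq> 0"
  shows "kappa x y = 0"
proof -
  have key: "kappa (br z x - c \<cdot> x) y + kappa x (br z y - d \<cdot> y) = - (c + d) * kappa x y" for x y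
  proof -
    have "kappa (br z x) y = - kappa x (br z y)"
      by (simp only: br_swap[of z x] kappa_minus kappa_invariant)
    then show ?thesis by (simp add: kappa_diff kappa_scale_left kappa_scale_right algebra_simps)
  qed
  have "\<forall>y\<in>geig (br z) d. kappa x y = 0"
    using lin_br x
  proof (induction rule: geig_induct)
    case zero
    show ?case by simp
  next
    case (step x)
    show ?case
    proof
      fix y assume "y \<in> geig (br z) d"
      with lin_br show "kappa x y = 0"
      proof (induction rule: geig_induct)
        case zero
        show ?case by simp
      next
        case (step y)
        then show ?case using key[of x y] cd \<open>\<forall>y\<in>geig (br z) d. kappa (br z x - c \<cdot> x) y = 0\<close>
          by (auto simp: neg_eq_iff_add_eq_0)
      qed
    qed
  qed
  with y show ?thesis by blast
qed

text \<open>All nonzero weight spaces are orthogonal to \<open>h\<close>, so a vector orthogonal to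
  \<open>h\<close> within \<open>h\<close> is orthogonal to everything.\<close>

lemma kappa_h_nondegenerate:
  assumes z: "z \<in> h" and orth: "\<And>y. y \<in> h \<Longrightarrow> kappa z y = 0"
  shows "z = 0"
proof (rule kappa_nondegenerate)
  fix y
  have "y \<in> span (\<Union>\<alpha>. UNIV \<inter> gws \<alpha>)" using gws_decomp[of UNIV] by auto
  then show "kappa z y = 0"
  proof (rule kappa_span_right[rotated])
    fix v assume "v \<in> (\<Union>\<alpha>. UNIV \<inter> gws \<alpha>)"
    then obtain \<alpha> where v: "v \<in> gws \<alpha>" by blast
    show "kappa z v = 0"
    proof (cases "\<exists>x\<in>h. \<alpha> x \<noteq> 0")
      case True
      then obtain x where x: "x \<in> h" "\<alpha> x \<noteq> 0" by blast
      then show ?thesis using kappa_geig[OF h_geig[OF x(1) z], of v "\<alpha> x"] v by (auto simp: gws_def)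
    next
      case False
      then have "v \<in> gws (\<lambda>_. 0)" using v by (auto simp: gws_def)
      then show ?thesis using gws_zero orth by simp
    qed
  qed
qed

text \<open>A solvable algebra is orthogonal to its derived algebra, while the form is nondegenerate
  on \<open>h\<close>.\<close>

lemma h_abelian: "x \<in> h \<Longrightarrow> y \<in> h \<Longrightarrow> br x y = 0"
proof (rule kappa_h_nondegenerate)
  assume xy: "x \<in> h" "y \<in> h"
  then show "br x y \<in> h" by (rule subalgebraD(2)[OF h_subalgebra])
  show "kappa (br x y) z = 0" if "z \<in> h" for z
    using kappa_solvable[OF h_subalgebra h_solvable that br_in_drv[OF xy]] kappa_sym by simp
qed

text \<open>The diagonal part of \<open>ad x\<close> is a derivation, hence \<open>ad d\<close> for some \<open>d\<close> in the Cartan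
  subalgebra; then \<open>d - x\<close> is ad-nilpotent and commutes with \<open>h\<close>, so it is orthogonal to \<open>h\<close>.\<close>
lemma ad_h_diagonal:
  assumes x: "x \<in> h" and v: "v \<in> geig (br x) c"
  shows "br x v = c \<cdot> v"
proof -
  obtain D where D: "lin D" "\<And>c v. v \<in> geig (br x) c \<Longrightarrow> D v = c \<cdot> v"
    using exists_spectral_operator[OF lin_br, where \<phi> = "\<lambda>c. c"] by blast
  have "D (br a b) = br (D a) b + br a (D b)" for a b
    by (rule spectral_derivation[OF lin_br br_derivation D]) auto
  then obtain d where d: "D = br d" using derivation_inner[OF D(1)] by blast
  have "br d y \<in> h" if "y \<in> h" for y
    using D(2)[OF h_geig[OF x that]] d subspace_0[OF h_subspace] by simp
  then have dh: "d \<in> h" by (rule h_normalizer)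
  define z where "z = d - x"
  have zh: "z \<in> h" unfolding z_def using dh x subspace_diff[OF h_subspace] by blast
  \<comment> \<open>Here \<open>br d\<close> is the scalar \<open>c\<close>, so \<open>br z\<close>
    is the negative of the locally nilpotent \<open>br x\<close> - c.\<close>
  have "geig (br x) c \<subseteq> geig (br z) 0" for c
  proof
    fix v assume "v \<in> geig (br x) c"
    with lin_br show "v \<in> geig (br z) 0"
    proof (induction rule: geig_induct)
      case zero
      show ?case by (rule subspace_0[OF subspace_geig[OF lin_br]])
    next
      case (step v)
      have "br z v - 0 \<cdot> v = - (br x v - c \<cdot> v)"
        using D(2)[OF step(1)] d by (simp add: z_def br_diff)
      then have "br z v - 0 \<cdot> v \<in> geig (br z) 0"
        using subspace_neg[OF subspace_geig[OF lin_br] step(2)] by simp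
      then show ?case using shift_in_geig[OF lin_br] by blast
    qed
  qed
  then have "span (\<Union>c. UNIV \<inter> geig (br x) c) \<subseteq> geig (br z) 0"
    using subspace_geig[OF lin_br] by (intro span_minimal) auto
  moreover have "UNIV = span (\<Union>c. UNIV \<inter> geig (br x) c)" by (rule geig_decomp[OF lin_br]) auto
  ultimately have znil: "\<exists>n. (br z ^^ n) w = 0" for w by (auto simp: geig_def)
  have "kappa z y = 0" if y: "y \<in> h" for y
  proof -
    have comm: "br z (br y w) = br y (br z w)" for w
      using br_derivation[of z y w] h_abelian[OF zh y] by simp
    \<comment> \<open>Commuting operators: the product inherits local nilpotency from
      \<open>br z\<close>, so its trace, which is \<open>kappa z y\<close>, vanishes.\<close>
    have pow: "((br z \<circ> br y) ^^ n) w = (br y ^^ n) ((br z ^^ n) w)" for n w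
    proof (induction n arbitrary: w)
      case (Suc n)
      have "((br z \<circ> br y) ^^ Suc n) w = br z (br y ((br y ^^ n) ((br z ^^ n) w)))"
        by (simp only: funpow.simps comp_apply Suc)
      also have "\<dots> = br z ((br y ^^ Suc n) ((br z ^^ n) w))" by simp
      also have "\<dots> = (br y ^^ Suc n) (br z ((br z ^^ n) w))"
      proof -
        have "br z ((br y ^^ m) u) = (br y ^^ m) (br z u)" for m u
          by (induction m) (simp_all add: comm)
        then show ?thesis .
      qed
      finally show ?case by (simp only: funpow.simps comp_def)
    qed simp
    have "\<exists>n. ((br z \<circ> br y) ^^ n) w = 0" for w
      using znil[of w] pow lin_0[OF lin_pow[OF lin_br]] by metis
    then show ?thesis unfolding kappa_def by (rule tr_nilpotent[OF lin_comp[OF lin_br lin_br]])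
  qed
  then have "z = 0" by (rule kappa_h_nondegenerate[OF zh])
  then show ?thesis using D(2)[OF v] d by (simp add: z_def)
qed

section \<open>Roots, root spaces and their Killing duality\<close>

abbreviation RS :: "('g \<Rightarrow> complex) \<Rightarrow> 'g set" where "RS \<equiv> rootspace sm br h"

abbreviation R :: "('g \<Rightarrow> complex) set" where "R \<equiv> roots sm br h"

lemma RS_D: "v \<in> RS \<alpha> \<Longrightarrow> x \<in> h \<Longrightarrow> br x v = \<alpha> x \<cdot> v"
  by (simp add: rootspace_def)

lemma RS_I: "(\<And>x. x \<in> h \<Longrightarrow> br x v = \<alpha> x \<cdot> v) \<Longrightarrow> v \<in> RS \<alpha>"
  by (simp add: rootspace_def)

lemma RS_cong: "(\<And>x. x \<in> h \<Longrightarrow> \<alpha> x = \<beta> x) \<Longrightarrow> RS \<alpha> = RS \<beta>"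
  by (auto simp: rootspace_def)

lemma gws_eq_RS: "gws \<alpha> = RS \<alpha>"
proof
  show "gws \<alpha> \<subseteq> RS \<alpha>" by (auto simp: gws_def intro!: RS_I ad_h_diagonal)
  show "RS \<alpha> \<subseteq> gws \<alpha>"
    by (auto simp: gws_def rootspace_def geig_def intro!: exI[of _ 1])
qed

lemma subspace_RS: "subspace (RS \<alpha>)"
  using subspace_gws gws_eq_RS by simp

lemma RS_zero: "RS (\<lambda>_. 0) = h"
  using gws_zero gws_eq_RS by simp

lemma roots_D: "\<alpha> \<in> R \<Longrightarrow> x \<notin> h \<Longrightarrow> \<alpha> x = 0"
  by (auto simp: roots_def)

lemma roots_nonzero: "\<alpha> \<in> R \<Longrightarrow> \<exists>y\<in>h. \<alpha> y \<noteq> 0"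
  by (auto simp: roots_def)

lemma root_vector: assumes "\<alpha> \<in> R" obtains e where "e \<in> RS \<alpha>" "e \<noteq> 0"
  using assms subspace_0[OF subspace_RS, of \<alpha>] by (auto simp: roots_def)

lemma rootsI:
  assumes "\<And>x. x \<notin> h \<Longrightarrow> \<alpha> x = 0" "v \<in> RS \<alpha>" "v \<noteq> 0" "y \<in> h" "\<alpha> y \<noteq> 0"
  shows "\<alpha> \<in> R"
  using assms by (auto simp: roots_def)

lemma RS_bracket: "x \<in> RS \<alpha> \<Longrightarrow> y \<in> RS \<beta> \<Longrightarrow> br x y \<in> RS (\<lambda>z. \<alpha> z + \<beta> z)"
  by (rule RS_I) (simp add: br_derivation[of _ x y] RS_D br_scale_left br_scale_right algebra_simps)

lemma weight_decomp:
  assumes M: "subspace M" "\<And>x v. x \<in> h \<Longrightarrow> v \<in> M \<Longrightarrow> br x v \<in> M"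
  shows "M = span ((M \<inter> h) \<union> (\<Union>\<alpha>\<in>R. M \<inter> RS \<alpha>))" (is "M = span ?A")
proof
  show "span ?A \<subseteq> M" by (rule span_minimal[OF _ M(1)]) auto
  have "M \<inter> gws \<alpha> \<subseteq> span ?A" for \<alpha>
  proof
    fix v assume v: "v \<in> M \<inter> gws \<alpha>"
    \<comment> \<open>Elements of \<open>R\<close> vanish outside \<open>h\<close>, whereas a weight
      is an arbitrary function there; cutting it off changes no weight space.\<close>
    define \<beta> where "\<beta> x = (if x \<in> h then \<alpha> x else 0)" for x
    have vb: "v \<in> RS \<beta>" using v RS_cong[of \<alpha> \<beta>] gws_eq_RS by (auto simp: \<beta>_def)
    show "v \<in> span ?A"
    proof (cases "v = 0 \<or> \<beta> \<in> R")
      case True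
      then show ?thesis using vb v by (auto intro: span_base span_zero)
    next
      case False
      then have "\<forall>y\<in>h. \<beta> y = 0" using rootsI[of \<beta> v] vb by (auto simp: \<beta>_def)
      then have "v \<in> h" using vb RS_cong[of \<beta> "\<lambda>_. 0"] RS_zero by auto
      then show ?thesis using v by (auto intro: span_base)
    qed
  qed
  then have "span (\<Union>\<alpha>. M \<inter> gws \<alpha>) \<subseteq> span ?A" by (intro span_minimal) auto
  with gws_decomp[OF M] show "M \<subseteq> span ?A" by blast
qed

lemma UNIV_decomp: "v \<in> span (h \<union> (\<Union>\<alpha>\<in>R. RS \<alpha>))"
  using weight_decomp[of UNIV] by auto

lemma kappa_RS:
  assumes "x \<in> RS \<alpha>" "y \<in> RS \<beta>" "z \<in> h" "\<alpha> z + \<beta> z \<noteq> 0"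
  shows "kappa x y = 0"
  using assms kappa_geig[of x z "\<alpha> z" y "\<beta> z"] gws_eq_RS by (auto simp: gws_def)

lemma kappa_h_RS:
  assumes "x \<in> h" "y \<in> RS \<beta>" "\<beta> \<in> R" shows "kappa x y = 0"
  using roots_nonzero[OF assms(3)] kappa_RS[of x "\<lambda>_. 0" y \<beta>] assms RS_zero by auto

lemma root_eqI: "\<alpha> \<in> R \<Longrightarrow> \<beta> \<in> R \<Longrightarrow> (\<And>x. x \<in> h \<Longrightarrow> \<alpha> x = \<beta> x) \<Longrightarrow> \<alpha> = \<beta>"
  by (rule ext) (metis roots_D)

text \<open>\<open>RS \<alpha>\<close> is orthogonal to \<open>h\<close> and to all root spaces
  except \<open>RS (- \<alpha>)\<close>, so nondegeneracy must be witnessed there.\<close>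

lemma kappa_dual_vector:
  assumes \<alpha>: "\<alpha> \<in> R" and e: "e \<in> RS \<alpha>" "e \<noteq> 0"
  obtains f where "f \<in> RS (- \<alpha>)" "kappa e f \<noteq> 0"
proof -
  have "\<exists>f\<in>RS (- \<alpha>). kappa e f \<noteq> 0"
  proof (rule ccontr)
    assume no: "\<not> ?thesis"
    have "kappa e y = 0" for y
    proof (rule kappa_span_right[OF _ UNIV_decomp])
      fix w assume w: "w \<in> h \<union> (\<Union>\<beta>\<in>R. RS \<beta>)"
      show "kappa e w = 0"
      proof (cases "w \<in> h")
        case True
        then show ?thesis using kappa_h_RS[OF _ e(1) \<alpha>] kappa_sym[of e w] by simp
      next
        case False
        then obtain \<beta> where b: "\<beta> \<in> R" "w \<in> RS \<beta>" using w by blast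
        show ?thesis
        proof (cases "\<exists>z\<in>h. \<alpha> z + \<beta> z \<noteq> 0")
          case True
          then show ?thesis using kappa_RS[OF e(1) b(2)] by blast
        next
          case False
          then have "RS \<beta> = RS (- \<alpha>)" by (intro RS_cong) (simp add: eq_neg_iff_add_eq_0 add.commute)
          then show ?thesis using no b by blast
        qed
      qed
    qed
    then show False using kappa_nondegenerate[of e] e by blast
  qed
  with that show ?thesis by blast
qed

text \<open>Linearity is not part of the definition of a root; it is read off from the action on a
  nonzero root vector.\<close>

lemma root_add: "\<alpha> \<in> R \<Longrightarrow> x \<in> h \<Longrightarrow> y \<in> h \<Longrightarrow> \<alpha> (x + y) = \<alpha> x + \<alpha> y"
  and root_scale: "\<alpha> \<in> R \<Longrightarrow> x \<in> h \<Longrightarrow> \<alpha> (c \<cdot> x) = c * \<alpha> x"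
proof -
  assume \<alpha>: "\<alpha> \<in> R" and x: "x \<in> h"
  obtain e where e: "e \<in> RS \<alpha>" "e \<noteq> 0" using root_vector[OF \<alpha>] .
  show "\<alpha> (x + y) = \<alpha> x + \<alpha> y" if y: "y \<in> h"
  proof -
    have "\<alpha> (x + y) \<cdot> e = (\<alpha> x + \<alpha> y) \<cdot> e"
      using RS_D[OF e(1)] x y subspace_add[OF h_subspace x y]
      by (metis br_add_left scale_left_distrib)
    then show ?thesis using e(2) by simp
  qed
  have "\<alpha> (c \<cdot> x) \<cdot> e = (c * \<alpha> x) \<cdot> e"
    using RS_D[OF e(1)] x subspace_scale[OF h_subspace x] by (metis br_scale_left scale_scale)
  then show "\<alpha> (c \<cdot> x) = c * \<alpha> x" using e(2) by simp
qed

lemma root_minus: "\<alpha> \<in> R \<Longrightarrow> x \<in> h \<Longrightarrow> \<alpha> (- x) = - \<alpha> x"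
  using root_scale[of \<alpha> x "-1"] by (simp add: scale_minus_left)

lemma neg_root: assumes "\<alpha> \<in> R" shows "- \<alpha> \<in> R"
proof -
  obtain e where e: "e \<in> RS \<alpha>" "e \<noteq> 0" using root_vector[OF assms] .
  obtain f where f: "f \<in> RS (- \<alpha>)" "kappa e f \<noteq> 0" using kappa_dual_vector[OF assms e] .
  obtain y where "y \<in> h" "\<alpha> y \<noteq> 0" using roots_nonzero[OF assms] by blast
  with f show ?thesis by (intro rootsI[of _ f y]) (auto simp: roots_D[OF assms])
qed

lemma kappa_bracket_h:
  assumes "e \<in> RS \<alpha>" "f \<in> RS (- \<alpha>)" "y \<in> h"
  shows "kappa (br e f) y = \<alpha> y * kappa e f"
proof -
  have "br f y = \<alpha> y \<cdot> f" using RS_D[OF assms(2,3)] br_swap[of f y] by (simp add: scale_minus_left)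
  then show ?thesis by (simp add: kappa_invariant kappa_scale_right)
qed

lemma bracket_opposite_in_h: "e \<in> RS \<alpha> \<Longrightarrow> f \<in> RS (- \<alpha>) \<Longrightarrow> br e f \<in> h"
  using RS_bracket[of e \<alpha> f "- \<alpha>"] RS_zero by simp

section \<open>Copies of sl2 and root strings\<close>

definition sl2_triple :: "('g \<Rightarrow> complex) \<Rightarrow> 'g \<Rightarrow> 'g \<Rightarrow> 'g \<Rightarrow> bool" where
  "sl2_triple \<alpha> e f t \<longleftrightarrow> \<alpha> \<in> R \<and> e \<in> RS \<alpha> \<and> f \<in> RS (- \<alpha>) \<and> t = br e f \<and> \<alpha> t = 2"

lemma sl2_tripleD:
  assumes "sl2_triple \<alpha> e f t"
  shows "\<alpha> \<in> R" "e \<in> RS \<alpha>" "f \<in> RS (- \<alpha>)" "t = br e f" "\<alpha> t = 2" "t \<in> h" "e \<noteq> 0" "f \<noteq> 0"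
  using assms bracket_opposite_in_h[of e \<alpha> f] root_scale[of \<alpha> t 0]
  by (auto simp: sl2_triple_def)

text \<open>The point is that \<open>\<alpha> t\<close> is nonzero. Otherwise
  \<open>t = br e f\<close> commutes with \<open>e\<close> and \<open>f\<close>, which then preserve
  each eigenspace of \<open>br t\<close>; there \<open>br t\<close> is a commutator, hence
  traceless, and its eigenvalue is 0. So the diagonalizable \<open>br t\<close> is zero, against
  \<open>t \<noteq> 0\<close>.\<close>

lemma sl2_triple_exists:
  assumes \<alpha>: "\<alpha> \<in> R"
  obtains e f t where "sl2_triple \<alpha> e f t"
proof -
  obtain e where e: "e \<in> RS \<alpha>" "e \<noteq> 0" using root_vector[OF \<alpha>] .
  obtain f where f: "f \<in> RS (- \<alpha>)" "kappa e f \<noteq> 0" using kappa_dual_vector[OF \<alpha> e] .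
  define t where "t = br e f"
  have th: "t \<in> h" unfolding t_def by (rule bracket_opposite_in_h[OF e(1) f(1)])
  have "t \<noteq> 0"
  proof
    assume "t = 0"
    obtain y where "y \<in> h" "\<alpha> y \<noteq> 0" using roots_nonzero[OF \<alpha>] by blast
    then show False using kappa_bracket_h[OF e(1) f(1), of y] f(2) \<open>t = 0\<close> by (simp add: t_def)
  qed
  have "\<alpha> t \<noteq> 0"
  proof
    assume at: "\<alpha> t = 0"
    have brt: "br t = (\<lambda>v. br e (br f v) - br f (br e v))" by (simp add: t_def br_br fun_eq_iff)
    have te: "br t e = 0" "br t f = 0" using RS_D[OF e(1) th] RS_D[OF f(1) th] at by auto
    have ev0: "c = 0" if v: "br t v = c \<cdot> v" "v \<noteq> 0" for c v
    proof -
      define M where "M = {v. br t v = c \<cdot> v}"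
      have M: "subspace M" by (auto simp: M_def subspace_def br_add_right br_scale_right
          scale_right_distrib mult.commute)
      have st: "br e v \<in> M" "br f v \<in> M" if "v \<in> M" for v
        using that te br_derivation[of t e v] br_derivation[of t f v]
        by (auto simp: M_def br_scale_right)
      have "tr M (br t) = 0"
        unfolding brt by (rule tr_commutator[OF M lin_br st(1) lin_br st(2)])
      moreover have "tr M (br t) = c * of_nat (dim M)"
        by (rule tr_scalar[OF M lin_br]) (simp add: M_def)
      moreover have "dim M \<noteq> 0" using v by (auto simp: M_def)
      ultimately show ?thesis by simp
    qed
    have "br t v \<in> {0}" for v
    proof (rule lin_span_subset[OF lin_br _ _ UNIV_decomp])
      fix w assume w: "w \<in> h \<union> (\<Union>\<beta>\<in>R. RS \<beta>)"
      show "br t w \<in> {0}"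
      proof (cases "w \<in> h")
        case True
        then show ?thesis using h_abelian[OF th] by simp
      next
        case False
        then obtain \<beta> where "\<beta> \<in> R" "w \<in> RS \<beta>" using w by blast
        then show ?thesis using RS_D[of w \<beta> t] th ev0[of w "\<beta> t"] by (cases "w = 0") auto
      qed
    qed auto
    then have "t = 0" using ad_injective[of t] by simp
    with \<open>t \<noteq> 0\<close> show False by simp
  qed
  \<comment> \<open>The factor normalizes the value of the root at the bracket to 2.\<close>
  define f' where "f' = (2 / \<alpha> t) \<cdot> f"
  have "f' \<in> RS (- \<alpha>)" unfolding f'_def by (rule subspace_scale[OF subspace_RS f(1)])
  moreover have "br e f' = (2 / \<alpha> t) \<cdot> t" by (simp add: f'_def br_scale_right t_def)
  then have "\<alpha> (br e f') = 2" using root_scale[OF \<alpha> th] \<open>\<alpha> t \<noteq> 0\<close> by simp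
  ultimately have "sl2_triple \<alpha> e f' (br e f')" using e \<alpha> by (simp add: sl2_triple_def)
  with that show ?thesis .
qed

lemma sl2_triple_neg:
  assumes "sl2_triple \<alpha> e f t" shows "sl2_triple (- \<alpha>) f e (- t)"
proof -
  note T = sl2_tripleD[OF assms]
  have "- (- \<alpha>) = \<alpha>" by (simp add: fun_eq_iff)
  moreover have "- t = br f e" using T(4) br_swap[of f e] by simp
  ultimately show ?thesis using T neg_root root_minus[OF T(1) T(6)] by (simp add: sl2_triple_def)
qed

lemma kappa_triple_nonzero: assumes "sl2_triple \<alpha> e f t" shows "kappa e f \<noteq> 0"
proof
  note T = sl2_tripleD[OF assms]
  assume "kappa e f = 0"
  then have "t = 0" using kappa_h_nondegenerate[OF T(6)] kappa_bracket_h[OF T(2,3)] T(4) by simp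
  with T(5) root_scale[OF T(1) T(6), of 0] show False by simp
qed

text \<open>Both sides lie in \<open>h\<close> and have the same Killing products with
  \<open>h\<close>. Opposite root spaces thus bracket into one line, which makes the coroot well
  defined.\<close>

lemma bracket_opposite:
  assumes T: "sl2_triple \<alpha> e f t" and x: "x \<in> RS \<alpha>" and y: "y \<in> RS (- \<alpha>)"
  shows "br x y = (kappa x y / kappa e f) \<cdot> t"
proof -
  note T' = sl2_tripleD[OF T]
  let ?z = "br x y - (kappa x y / kappa e f) \<cdot> t"
  have "?z = 0"
  proof (rule kappa_h_nondegenerate)
    show "?z \<in> h" using bracket_opposite_in_h[OF x y] T'(6) h_subspace
      by (intro subspace_diff subspace_scale) auto
    show "kappa ?z w = 0" if "w \<in> h" for w
      using kappa_bracket_h[OF x y that] kappa_bracket_h[OF T'(2,3) that] kappa_triple_nonzero[OF T]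
        T'(4) by (simp add: kappa_diff kappa_scale_left)
  qed
  then show ?thesis by simp
qed

lemma coroot_triple:
  assumes T: "sl2_triple \<alpha> e f t" shows "coroot sm br h \<alpha> = t"
  unfolding coroot_def
proof (rule the_equality)
  note T' = sl2_tripleD[OF T]
  have "t \<in> brs br (RS \<alpha>) (RS (- \<alpha>))" using T' by (auto simp: brs_def)
  then show "t \<in> cspan sm (brs br (RS \<alpha>) (RS (- \<alpha>))) \<and> \<alpha> t = 2"
    using T'(5) by (simp add: cspan_eq span_base)
  fix s assume s: "s \<in> cspan sm (brs br (RS \<alpha>) (RS (- \<alpha>))) \<and> \<alpha> s = 2"
  have "span (brs br (RS \<alpha>) (RS (- \<alpha>))) \<subseteq> span {t}"
  proof (rule span_minimal)
    show "brs br (RS \<alpha>) (RS (- \<alpha>)) \<subseteq> span {t}"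
      using bracket_opposite[OF T] by (auto simp: brs_def intro!: span_scale[OF span_base])
  qed simp
  then obtain c where "s = c \<cdot> t" using s by (auto simp: cspan_eq span_singleton)
  then show "s = t" using s T' root_scale[OF T'(1) T'(6), of c] by simp
qed

text \<open>One nonzero vector per root gives an independent set: a Killing-dual vector in the
  opposite root space detects it and is orthogonal to all the others.\<close>

lemma finite_roots: "finite R"
proof -
  have "\<forall>\<alpha>\<in>R. \<exists>e. e \<in> RS \<alpha> \<and> e \<noteq> 0" using root_vector by metis
  then obtain e where e: "\<And>\<alpha>. \<alpha> \<in> R \<Longrightarrow> e \<alpha> \<in> RS \<alpha>" "\<And>\<alpha>. \<alpha> \<in> R \<Longrightarrow> e \<alpha> \<noteq> 0" by metis
  have key: "e \<alpha> \<notin> span (e ` (R - {\<alpha>}))" if \<alpha>: "\<alpha> \<in> R" for \<alpha>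
  proof
    assume s: "e \<alpha> \<in> span (e ` (R - {\<alpha>}))"
    obtain f where f: "f \<in> RS (- \<alpha>)" "kappa (e \<alpha>) f \<noteq> 0" using kappa_dual_vector[OF \<alpha> e[OF \<alpha>]] .
    have "kappa f (e \<alpha>) = 0"
    proof (rule kappa_span_right[OF _ s])
      fix w assume "w \<in> e ` (R - {\<alpha>})"
      then obtain \<beta> where b: "\<beta> \<in> R" "\<beta> \<noteq> \<alpha>" "w \<in> RS \<beta>" using e by blast
      then obtain z where "z \<in> h" "\<beta> z \<noteq> \<alpha> z" using root_eqI[OF b(1) \<alpha>] by blast
      then show "kappa f w = 0" using kappa_RS[OF f(1) b(3)] by simp
    qed
    with f(2) kappa_sym show False by simp
  qed
  have inj: "inj_on e R"
  proof (rule inj_onI, rule ccontr)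
    fix \<alpha> \<beta> assume ab: "\<alpha> \<in> R" "\<beta> \<in> R" "e \<alpha> = e \<beta>" "\<alpha> \<noteq> \<beta>"
    then have "e \<alpha> \<in> span (e ` (R - {\<alpha>}))" by (auto intro!: span_base)
    with key ab show False by blast
  qed
  have "independent (e ` R)"
  proof
    assume "dependent (e ` R)"
    then obtain \<alpha> where a: "\<alpha> \<in> R" "e \<alpha> \<in> span (e ` R - {e \<alpha>})" by (auto simp: dependent_def)
    have "e ` R - {e \<alpha>} = e ` (R - {\<alpha>})" using inj a(1) by (auto simp: inj_on_def)
    with a key show False by simp
  qed
  then have "finite (e ` R)" by (rule finiteI_independent)
  then show ?thesis using inj finite_image_iff by blast
qed

lemma RS_pow:
  assumes e: "e \<in> RS \<alpha>" and v: "v \<in> RS \<gamma>"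
  shows "(br e ^^ n) v \<in> RS (\<lambda>x. \<gamma> x + of_nat n * \<alpha> x)"
proof (induction n)
  case 0
  then show ?case using v by simp
next
  case (Suc n)
  from RS_bracket[OF e Suc] show ?case by (simp add: algebra_simps)
qed

text \<open>Otherwise all functionals \<gamma> + n \<alpha> would be weights, infinitely many of
  them.\<close>

lemma ad_root_vector_nilpotent:
  assumes \<alpha>: "\<alpha> \<in> R" and e: "e \<in> RS \<alpha>" and v: "v \<in> RS \<gamma>"
  shows "\<exists>n. (br e ^^ n) v = 0"
proof (rule ccontr)
  assume no: "\<not> ?thesis"
  define \<delta> where "\<delta> n x = (if x \<in> h then \<gamma> x + of_nat n * \<alpha> x else 0)" for n :: nat and x
  have "\<delta> n \<in> insert (\<lambda>_. 0) R" for n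
  proof (cases "\<forall>x\<in>h. \<delta> n x = 0")
    case True
    then have "\<delta> n = (\<lambda>_. 0)" by (auto simp: \<delta>_def)
    then show ?thesis by simp
  next
    case False
    then obtain y where y: "y \<in> h" "\<delta> n y \<noteq> 0" by blast
    have "(br e ^^ n) v \<in> RS (\<delta> n)"
      using RS_pow[OF e v, of n] RS_cong[of "\<delta> n" "\<lambda>x. \<gamma> x + of_nat n * \<alpha> x"] by (simp add: \<delta>_def)
    then have "\<delta> n \<in> R" using no y by (intro rootsI) (auto simp: \<delta>_def)
    then show ?thesis by simp
  qed
  then have "finite (range \<delta>)" using finite_roots finite_subset[of "range \<delta>" "insert (\<lambda>_. 0) R"] by blast
  moreover have "inj \<delta>"
  proof (rule injI)
    fix n m assume "\<delta> n = \<delta> m"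
    moreover obtain y where "y \<in> h" "\<alpha> y \<noteq> 0" using roots_nonzero[OF \<alpha>] by blast
    ultimately show "n = m" by (auto simp: \<delta>_def fun_eq_iff split: if_splits)
  qed
  ultimately show False using finite_imageD by blast
qed

lemma nilpotent_last:
  assumes "(T ^^ n) v = 0" "v \<noteq> 0"
  obtains m where "(T ^^ m) v \<noteq> 0" "T ((T ^^ m) v) = 0"
proof -
  define k where "k = (LEAST n. (T ^^ n) v = 0)"
  have k: "(T ^^ k) v = 0" unfolding k_def by (rule LeastI[of _ n]) (rule assms)
  then obtain m where m: "k = Suc m" using assms(2) by (cases k) auto
  then have "(T ^^ m) v \<noteq> 0" using not_less_Least[of m "\<lambda>n. (T ^^ n) v = 0"] by (auto simp: k_def)
  with k m that show ?thesis by auto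
qed

lemma sl2_chain:
  assumes T: "sl2_triple \<alpha> e f t" and u: "br t u = d \<cdot> u" "br e u = 0"
  shows "br t ((br f ^^ i) u) = (d - 2 * of_nat i) \<cdot> (br f ^^ i) u"
    and "br e ((br f ^^ Suc i) u) = (of_nat (Suc i) * (d - of_nat i)) \<cdot> (br f ^^ i) u"
proof -
  note T' = sl2_tripleD[OF T]
  have tf: "br t f = (-2) \<cdot> f" using RS_D[OF T'(3,6)] T'(5) by simp
  show 1: "br t ((br f ^^ i) u) = (d - 2 * of_nat i) \<cdot> (br f ^^ i) u" for i
  proof (induction i)
    case 0
    then show ?case using u by simp
  next
    case (Suc i)
    have "br t (br f ((br f ^^ i) u)) = br (br t f) ((br f ^^ i) u) + br f (br t ((br f ^^ i) u))"
      by (rule br_derivation)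
    also have "\<dots> = (d - 2 * of_nat (Suc i)) \<cdot> br f ((br f ^^ i) u)"
      by (simp only: tf Suc br_scale_left br_scale_right scale_left_distrib[symmetric]) (simp add: algebra_simps)
    finally show ?case by simp
  qed
  show "br e ((br f ^^ Suc i) u) = (of_nat (Suc i) * (d - of_nat i)) \<cdot> (br f ^^ i) u"
  proof (induction i)
    case 0
    have "br e (br f u) = br (br e f) u + br f (br e u)" by (rule br_derivation)
    then show ?case using u T'(4) by simp
  next
    case (Suc i)
    have "br e (br f ((br f ^^ Suc i) u)) = br t ((br f ^^ Suc i) u) + br f (br e ((br f ^^ Suc i) u))"
      using br_derivation[of e f] T'(4) by simp
    also have "\<dots> = (d - 2 * of_nat (Suc i)) \<cdot> (br f ^^ Suc i) u
        + (of_nat (Suc i) * (d - of_nat i)) \<cdot> (br f ^^ Suc i) u"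
      by (simp only: 1[of "Suc i"] Suc br_scale_right) (simp only: funpow.simps comp_apply)
    also have "\<dots> = (of_nat (Suc (Suc i)) * (d - of_nat (Suc i))) \<cdot> (br f ^^ Suc i) u"
      by (simp only: scale_left_distrib[symmetric]) (simp add: algebra_simps)
    finally show ?case by simp
  qed
qed

text \<open>At the last nonzero vector of the chain \<open>sl2_chain\<close> gives (n +
  1)(\<open>\<gamma> t\<close> - n) = 0, so the weight equals the length of the chain.\<close>

lemma sl2_highest_weight:
  assumes T: "sl2_triple \<alpha> e f t" and u: "u \<in> RS \<gamma>" "u \<noteq> 0" "br e u = 0"
  obtains n where "\<gamma> t = of_nat n" "\<And>i. i \<le> n \<Longrightarrow> (br f ^^ i) u \<noteq> 0"
proof -
  note T' = sl2_tripleD[OF T]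
  have tu: "br t u = \<gamma> t \<cdot> u" by (rule RS_D[OF u(1) T'(6)])
  obtain m where "(br f ^^ m) u = 0"
    using ad_root_vector_nilpotent[OF neg_root[OF T'(1)] T'(3) u(1)] by blast
  from nilpotent_last[OF this u(2)] obtain n where n: "(br f ^^ n) u \<noteq> 0" "br f ((br f ^^ n) u) = 0" .
  have "(of_nat (Suc n) * (\<gamma> t - of_nat n)) \<cdot> (br f ^^ n) u = 0"
    using sl2_chain(2)[OF T tu u(3), of n] n(2) by simp
  then have "\<gamma> t = of_nat n" using n(1) by (simp del: of_nat_Suc)
  moreover have "(br f ^^ i) u \<noteq> 0" if "i \<le> n" for i
  proof
    assume "(br f ^^ i) u = 0"
    then have "(br f ^^ n) u = 0" using pow_zero_mono[OF lin_br _ that] by blast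
    with n(1) show False by simp
  qed
  ultimately show ?thesis using that by blast
qed

lemma sl2_string:
  assumes T: "sl2_triple \<alpha> e f t" and v: "v \<in> RS \<gamma>" "v \<noteq> 0"
  obtains u p n where "u \<in> RS (\<lambda>x. \<gamma> x + of_nat p * \<alpha> x)" "\<gamma> t = of_nat n - 2 * of_nat p"
    "\<And>i. i \<le> n \<Longrightarrow> (br f ^^ i) u \<noteq> 0"
proof -
  note T' = sl2_tripleD[OF T]
  obtain m where "(br e ^^ m) v = 0" using ad_root_vector_nilpotent[OF T'(1,2) v(1)] by blast
  from nilpotent_last[OF this v(2)] obtain p where p: "(br e ^^ p) v \<noteq> 0" "br e ((br e ^^ p) v) = 0" .
  note up = RS_pow[OF T'(2) v(1), of p]
  obtain n where n: "\<gamma> t + of_nat p * \<alpha> t = of_nat n" "\<And>i. i \<le> n \<Longrightarrow> (br f ^^ i) ((br e ^^ p) v) \<noteq> 0"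
    using sl2_highest_weight[OF T up p] by blast
  then have "\<gamma> t = of_nat n - 2 * of_nat p" using T'(5) by (simp add: algebra_simps)
  with n up that show ?thesis by blast
qed

lemma root_string_integer:
  assumes T: "sl2_triple \<alpha> e f t" and \<gamma>: "\<gamma> \<in> R"
  obtains k :: int where "\<gamma> t = of_int k"
proof -
  obtain v where v: "v \<in> RS \<gamma>" "v \<noteq> 0" using root_vector[OF \<gamma>] .
  obtain u p n where "\<gamma> t = of_nat n - 2 * of_nat p" using sl2_string[OF T v] by metis
  then have "\<gamma> t = of_int (int n - 2 * int p)" by simp
  with that show ?thesis by blast
qed

text \<open>Subtract from \<open>x\<close> the multiple of \<open>e\<close> with the same Killing
  product against \<open>f\<close>. The remainder commutes with \<open>f\<close>, so if nonzero it
  would be a highest weight vector of weight -2 for the opposite triple.\<close>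

lemma root_space_line:
  assumes T: "sl2_triple \<alpha> e f t" and x: "x \<in> RS \<alpha>"
  shows "\<exists>c. x = c \<cdot> e"
proof -
  note T' = sl2_tripleD[OF T]
  let ?c = "kappa x f / kappa e f"
  let ?y = "x - ?c \<cdot> e"
  have y: "?y \<in> RS \<alpha>" using x T'(2) subspace_RS by (auto intro: subspace_diff subspace_scale)
  have "kappa ?y f = 0" using kappa_triple_nonzero[OF T] by (simp add: kappa_diff kappa_scale_left)
  then have "br ?y f = 0" using bracket_opposite[OF T y T'(3)] by simp
  then have fy: "br f ?y = 0" using br_swap[of f ?y] by simp
  have "?y = 0"
  proof (rule ccontr)
    assume "?y \<noteq> 0"
    from sl2_highest_weight[OF sl2_triple_neg[OF T] y this fy]
    obtain n where "\<alpha> (- t) = of_nat n" by blast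
    then have "(of_nat n :: complex) = - 2" using root_minus[OF T'(1,6)] T'(5) by simp
    then have "of_nat (n + 2) = (0 :: complex)" by simp
    then show False by (simp only: of_nat_eq_0_iff)
  qed
  then have "x = ?c \<cdot> e" by simp
  then show ?thesis ..
qed

lemma root_space_line':
  assumes \<gamma>: "\<gamma> \<in> R" and v: "v \<in> RS \<gamma>" "v \<noteq> 0" and w: "w \<in> RS \<gamma>"
  obtains c where "w = c \<cdot> v"
proof -
  obtain e f t where T: "sl2_triple \<gamma> e f t" using sl2_triple_exists[OF \<gamma>] .
  obtain a b where ab: "v = a \<cdot> e" "w = b \<cdot> e" using root_space_line[OF T] v(1) w by blast
  then have "w = (b / a) \<cdot> v" using v(2) by simp
  with that show ?thesis .
qed

text \<open>From the bottom \<open>u\<close> of the string, \<open>e\<close> can be applied m + 2p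
  times without reaching 0, and after p times it gives a multiple of \<open>v\<close>, root spaces
  being lines. This exhibits a vector of the reflected root obtained from \<open>v\<close> by
  \<open>e\<close> alone, which a subalgebra containing both must contain.\<close>

lemma reflection_vector:
  assumes T: "sl2_triple \<alpha> e f t" and \<gamma>: "\<gamma> \<in> R" and m: "\<gamma> t = - of_nat m"
    and v: "v \<in> RS \<gamma>" "v \<noteq> 0"
  shows "(br e ^^ m) v \<noteq> 0"
proof -
  note T' = sl2_tripleD[OF T]
  obtain u p n where u: "u \<in> RS (\<lambda>x. \<gamma> x + of_nat p * (- \<alpha>) x)"
      "\<gamma> (- t) = of_nat n - 2 * of_nat p" "\<And>i. i \<le> n \<Longrightarrow> (br e ^^ i) u \<noteq> 0"
    using sl2_string[OF sl2_triple_neg[OF T] v] by blast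
  have "(of_nat m :: complex) + 2 * of_nat p = of_nat n"
    using u(2) root_minus[OF \<gamma> T'(6)] m by (simp add: algebra_simps)
  then have "of_nat (m + 2 * p) = (of_nat n :: complex)" by simp
  then have n: "n = m + 2 * p" by (simp only: of_nat_eq_iff)
  have up: "(br e ^^ p) u \<noteq> 0" using u(3) n by simp
  have "(br e ^^ p) u \<in> RS \<gamma>" using RS_pow[OF T'(2) u(1), of p] by simp
  from root_space_line'[OF \<gamma> v this] obtain c where c: "(br e ^^ p) u = c \<cdot> v" .
  have "(br e ^^ (m + p)) u \<noteq> 0" using u(3) n by simp
  also have "(br e ^^ (m + p)) u = c \<cdot> (br e ^^ m) v"
    by (simp add: funpow_add c lin_scale[OF lin_pow[OF lin_br]])
  finally show ?thesis by auto
qed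

section \<open>Coroots, Cartan integers and reflections\<close>

abbreviation cor :: "('g \<Rightarrow> complex) \<Rightarrow> 'g" where "cor \<equiv> coroot sm br h"

abbreviation rfl :: "('g \<Rightarrow> complex) \<Rightarrow> ('g \<Rightarrow> complex) \<Rightarrow> ('g \<Rightarrow> complex)" where
  "rfl \<equiv> reflection sm br h"

lemma root_triple: assumes "\<alpha> \<in> R" obtains e f where "sl2_triple \<alpha> e f (cor \<alpha>)"
  using sl2_triple_exists[OF assms] coroot_triple by metis

lemma coroot_in_h: "\<alpha> \<in> R \<Longrightarrow> cor \<alpha> \<in> h"
  and root_coroot: "\<alpha> \<in> R \<Longrightarrow> \<alpha> (cor \<alpha>) = 2"
  using root_triple sl2_tripleD(5,6) by metis+

lemma coroot_neg: "\<alpha> \<in> R \<Longrightarrow> cor (- \<alpha>) = - cor \<alpha>"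
  using root_triple sl2_triple_neg coroot_triple by metis

lemma cartan_integer: assumes "\<alpha> \<in> R" "\<gamma> \<in> R" obtains k :: int where "\<gamma> (cor \<alpha>) = of_int k"
  using root_triple[OF assms(1)] root_string_integer[OF _ assms(2)] by metis

lemma reflection_neg: "\<alpha> \<in> R \<Longrightarrow> \<gamma> \<in> R \<Longrightarrow> rfl (- \<alpha>) \<gamma> = rfl \<alpha> \<gamma>"
  by (simp add: reflection_def coroot_neg root_minus coroot_in_h fun_eq_iff)

lemma reflection_string:
  assumes T: "sl2_triple \<alpha> e f t" and \<gamma>: "\<gamma> \<in> R" and m: "\<gamma> t = - of_nat m"
    and v: "v \<in> RS \<gamma>" "v \<noteq> 0"
  shows "rfl \<alpha> \<gamma> \<in> R" "(br e ^^ m) v \<in> RS (rfl \<alpha> \<gamma>)"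
proof -
  note T' = sl2_tripleD[OF T]
  have eq: "rfl \<alpha> \<gamma> = (\<lambda>x. \<gamma> x + of_nat m * \<alpha> x)"
    using coroot_triple[OF T] m by (simp add: reflection_def)
  show 1: "(br e ^^ m) v \<in> RS (rfl \<alpha> \<gamma>)" unfolding eq by (rule RS_pow[OF T'(2) v(1)])
  have "\<exists>y\<in>h. rfl \<alpha> \<gamma> y \<noteq> 0"
  proof (rule ccontr)
    assume "\<not> ?thesis"
    then have z: "\<gamma> y + of_nat m * \<alpha> y = 0" if "y \<in> h" for y using that eq by simp
    from z[OF T'(6)] have "m = 0" using m T'(5) by simp
    then have "\<forall>y\<in>h. \<gamma> y = 0" using z by simp
    with roots_nonzero[OF \<gamma>] show False by blast
  qed
  then obtain y where "y \<in> h" "rfl \<alpha> \<gamma> y \<noteq> 0" by blast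
  then show "rfl \<alpha> \<gamma> \<in> R" using 1 reflection_vector[OF T \<gamma> m v]
    by (intro rootsI) (auto simp: eq roots_D[OF \<gamma>] roots_D[OF T'(1)])
qed

lemma reflection_root: assumes \<alpha>: "\<alpha> \<in> R" and \<gamma>: "\<gamma> \<in> R" shows "rfl \<alpha> \<gamma> \<in> R"
proof -
  have *: "rfl \<alpha> \<gamma> \<in> R" if \<alpha>: "\<alpha> \<in> R" and k: "\<gamma> (cor \<alpha>) = of_int k" "k \<le> 0" for \<alpha> k
  proof -
    obtain e f where T: "sl2_triple \<alpha> e f (cor \<alpha>)" using root_triple[OF \<alpha>] .
    obtain v where v: "v \<in> RS \<gamma>" "v \<noteq> 0" using root_vector[OF \<gamma>] .
    have "\<gamma> (cor \<alpha>) = - of_nat (nat (- k))" using k by simp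
    from reflection_string(1)[OF T \<gamma> this v] show ?thesis .
  qed
  obtain k where k: "\<gamma> (cor \<alpha>) = of_int k" using cartan_integer[OF \<alpha> \<gamma>] .
  show ?thesis
  proof (cases "k \<le> 0")
    case True
    then show ?thesis using * \<alpha> k by blast
  next
    case False
    have "\<gamma> (cor (- \<alpha>)) = of_int (- k)"
      using k by (simp add: coroot_neg[OF \<alpha>] root_minus[OF \<gamma> coroot_in_h[OF \<alpha>]])
    from *[OF neg_root[OF \<alpha>] this] False reflection_neg[OF \<alpha> \<gamma>] show ?thesis by simp
  qed
qed

end

section \<open>Parabolic subalgebras and the reflection argument\<close>

lemma polarization_card:
  fixes k :: "'a \<Rightarrow> real"
  assumes "finite S" "X \<subseteq> S" "Y \<subseteq> S"
    and r: "\<And>b. b \<in> S \<Longrightarrow> r b \<in> S" "\<And>b. b \<in> S \<Longrightarrow> r (r b) = b" "\<And>b. b \<in> S \<Longrightarrow> k (r b) = - k b"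
    and X: "\<And>b. b \<in> S \<Longrightarrow> k b > 0 \<Longrightarrow> r b \<in> X \<Longrightarrow> b \<in> X"
    and Y: "\<And>b. b \<in> S \<Longrightarrow> k b \<ge> 0 \<Longrightarrow> b \<in> Y \<Longrightarrow> r b \<in> Y"
  shows "card (X \<inter> Y) \<le> card (X \<inter> r ` Y)"
    and "\<lbrakk>d \<in> X; r d \<notin> X; d \<notin> Y; r d \<in> Y\<rbrakk> \<Longrightarrow> card (X \<inter> Y) < card (X \<inter> r ` Y)"
proof -
  define \<phi> where "\<phi> b = (if r b \<in> Y then b else r b)" for b
  have fin: "finite (X \<inter> r ` Y)" using assms(1,2) finite_subset by blast
  have img: "b \<in> r ` Y" if "b \<in> S" "r b \<in> Y" for b using r(2)[OF that(1)] that(2) by (metis imageI)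
  have sub: "\<phi> ` (X \<inter> Y) \<subseteq> X \<inter> r ` Y"
  proof
    fix c assume "c \<in> \<phi> ` (X \<inter> Y)"
    then obtain b where b: "b \<in> X" "b \<in> Y" "c = \<phi> b" by blast
    then have bS: "b \<in> S" using assms by blast
    show "c \<in> X \<inter> r ` Y"
    proof (cases "r b \<in> Y")
      case True
      then show ?thesis using b img[OF bS] by (simp add: \<phi>_def)
    next
      case False
      then have "\<not> k b \<ge> 0" using Y bS b by blast
      then have "k (r b) > 0" using r(3)[OF bS] by simp
      then have "r b \<in> X" using X[of "r b"] r(1,2)[OF bS] b by simp
      then show ?thesis using b False by (simp add: \<phi>_def)
    qed
  qed
  have inj: "inj_on \<phi> (X \<inter> Y)"
  proof (rule inj_onI)
    fix b c assume bc: "b \<in> X \<inter> Y" "c \<in> X \<inter> Y" "\<phi> b = \<phi> c"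
    then have "b \<in> S" "c \<in> S" using assms by auto
    then show "b = c" using bc r(2) by (auto simp: \<phi>_def split: if_splits) metis+
  qed
  show "card (X \<inter> Y) \<le> card (X \<inter> r ` Y)"
    using card_mono[OF fin sub] card_image[OF inj] by simp
  assume d: "d \<in> X" "r d \<notin> X" "d \<notin> Y" "r d \<in> Y"
  have dS: "d \<in> S" using d assms by blast
  have "d \<notin> \<phi> ` (X \<inter> Y)"
  proof
    assume "d \<in> \<phi> ` (X \<inter> Y)"
    then obtain b where b: "b \<in> X" "b \<in> Y" "d = \<phi> b" by blast
    then have "b \<in> S" using assms by blast
    then show False using b d r(2) by (auto simp: \<phi>_def split: if_splits)
  qed
  then have "\<phi> ` (X \<inter> Y) \<subset> X \<inter> r ` Y" using sub d img[OF dS] by blast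
  from psubset_card_mono[OF fin this] show "card (X \<inter> Y) < card (X \<inter> r ` Y)"
    using card_image[OF inj] by simp
qed

section \<open>Positivity of the Killing form and coroots of reflected roots\<close>

context cartan_lie
begin

text \<open>The value is the sum of the squares of the eigenvalues of \<open>br t\<close>,
  accumulated along an \<open>h\<close>-stable flag built from weight vectors. If it is 0 then
  \<open>br t\<close> is zero.\<close>

lemma kappa_square_real:
  assumes t: "t \<in> h" and real: "\<And>\<alpha>. \<alpha> \<in> R \<Longrightarrow> \<alpha> t \<in> \<real>"
  obtains r where "r \<ge> 0" "kappa t t = of_real r" "r = 0 \<Longrightarrow> t = 0"
proof -
  define P where "P U \<longleftrightarrow> (\<forall>x\<in>h. \<forall>u\<in>U. br x u \<in> U) \<and>
    (\<exists>r\<ge>0. tr U (br t \<circ> br t) = of_real r \<and> (r = 0 \<longrightarrow> (\<forall>u\<in>U. br t u = 0)))" for U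
  have "P UNIV"
  proof (induction rule: flag_induct)
    case zero
    show ?case by (auto simp: P_def tr_zero_space lin_comp lin_br intro!: exI[of _ 0])
  next
    case (step U)
    then obtain r where r: "r \<ge> 0" "tr U (br t \<circ> br t) = of_real r" "r = 0 \<Longrightarrow> \<forall>u\<in>U. br t u = 0"
      and U: "\<And>x u. x \<in> h \<Longrightarrow> u \<in> U \<Longrightarrow> br x u \<in> U" by (auto simp: P_def)
    have "\<not> h \<union> (\<Union>\<alpha>\<in>R. RS \<alpha>) \<subseteq> U"
      using UNIV_decomp span_minimal[OF _ step(1), of "h \<union> (\<Union>\<alpha>\<in>R. RS \<alpha>)"] step(2) by blast
    then obtain x where x: "x \<notin> U" "x \<in> h \<union> (\<Union>\<alpha>\<in>R. RS \<alpha>)" by blast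
    have "\<exists>\<alpha>. x \<in> RS \<alpha> \<and> \<alpha> t \<in> \<real>"
    proof (cases "x \<in> h")
      case True
      then show ?thesis using RS_zero by (auto intro!: exI[of _ "\<lambda>_. 0"])
    next
      case False
      then show ?thesis using x(2) real by blast
    qed
    then obtain \<alpha> a where a: "x \<in> RS \<alpha>" "\<alpha> t = of_real a" by (auto elim: Reals_cases)
    have stab: "br y u \<in> span (insert x U)" if "y \<in> h" "u \<in> span (insert x U)" for y u
      by (rule span_insert_stable[OF step(1) lin_br U[OF that(1)] _ that(2), where c = "\<alpha> y"])
        (use RS_D[OF a(1) that(1)] subspace_0[OF step(1)] in auto)
    have tx: "br t x = of_real a \<cdot> x" using RS_D[OF a(1) t] a(2) by simp
    have "(br t \<circ> br t) x - of_real (a\<^sup>2) \<cdot> x \<in> U"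
      using subspace_0[OF step(1)] by (simp add: tx br_scale_right power2_eq_square)
    then have "tr (span (insert x U)) (br t \<circ> br t) = of_real (r + a\<^sup>2)"
      using tr_insert[OF step(1) x(1) lin_comp[OF lin_br lin_br], of t t "of_real (a\<^sup>2)"] U t r by simp
    moreover have "\<forall>u\<in>span (insert x U). br t u = 0" if "r + a\<^sup>2 = 0"
    proof -
      have "r = 0" "a = 0" using that r(1) by (auto simp: add_nonneg_eq_0_iff)
      then have "insert x U \<subseteq> {u. br t u \<in> {0}}" using r(3) tx by auto
      then have "span (insert x U) \<subseteq> {u. br t u \<in> {0}}"
        by (rule span_minimal[OF _ subspace_preimage[OF lin_br]]) simp
      then show ?thesis by auto
    qed
    ultimately have "P (span (insert x U))" unfolding P_def using stab r(1)
      by (intro conjI ballI exI[of _ "r + a\<^sup>2"]) auto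
    with x(1) show ?case by blast
  qed
  then obtain r where "r \<ge> 0" "kappa t t = of_real r" "r = 0 \<Longrightarrow> \<forall>u. br t u = 0"
    by (auto simp: P_def kappa_def)
  with that ad_injective show ?thesis by blast
qed

lemma kappa_coroot:
  assumes "\<alpha> \<in> R" "y \<in> h"
  shows "kappa (cor \<alpha>) y = \<alpha> y * (kappa (cor \<alpha>) (cor \<alpha>) / 2)"
proof -
  obtain e f where T: "sl2_triple \<alpha> e f (cor \<alpha>)" using root_triple[OF assms(1)] .
  note T' = sl2_tripleD[OF T]
  show ?thesis
    using kappa_bracket_h[OF T'(2,3) assms(2)] kappa_bracket_h[OF T'(2,3,6)] T'(4,5) by simp
qed

lemma kappa_coroot_nonzero: assumes "\<alpha> \<in> R" shows "kappa (cor \<alpha>) (cor \<alpha>) \<noteq> 0"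
proof
  assume "kappa (cor \<alpha>) (cor \<alpha>) = 0"
  then have "cor \<alpha> = 0"
    using kappa_h_nondegenerate[OF coroot_in_h[OF assms]] kappa_coroot[OF assms] by simp
  then show False using root_coroot[OF assms] root_scale[OF assms coroot_in_h[OF assms], of 0] by simp
qed

text \<open>Equal pairings in both directions force the coroots to have the same square length n.
  Then \<open>cor \<alpha> + cor \<beta>\<close> has square length n (2 + k), which for k at most -2
  is nonpositive; hence the sum vanishes and the roots are opposite.\<close>

lemma pairing_ge_minus_one:
  assumes \<alpha>: "\<alpha> \<in> R" and \<beta>: "\<beta> \<in> R" and k: "\<beta> (cor \<alpha>) = of_int k" "\<alpha> (cor \<beta>) = of_int k"
    and ne: "\<beta> \<noteq> - \<alpha>"
  shows "k \<ge> -1"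
proof (rule ccontr)
  assume "\<not> ?thesis"
  then have k2: "k \<le> -2" by simp
  note ch = coroot_in_h[OF \<alpha>] coroot_in_h[OF \<beta>]
  have real: "\<gamma> (cor \<delta>) \<in> \<real>" if "\<gamma> \<in> R" "\<delta> \<in> R" for \<gamma> \<delta>
    using cartan_integer[OF that(2,1)] by (metis Reals_of_int)
  let ?N = "kappa (cor \<alpha>) (cor \<alpha>)"
  have "of_int k * ?N = of_int k * kappa (cor \<beta>) (cor \<beta>)"
    using kappa_coroot[OF \<alpha> ch(2)] kappa_coroot[OF \<beta> ch(1)] k kappa_sym[of "cor \<alpha>" "cor \<beta>"] by auto
  then have N: "kappa (cor \<beta>) (cor \<beta>) = ?N" using k2 by simp
  obtain n where n: "n \<ge> 0" "?N = of_real n" "n = 0 \<Longrightarrow> cor \<alpha> = 0"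
    using kappa_square_real[OF ch(1)] real \<alpha> by blast
  have "n \<noteq> 0" using n kappa_coroot_nonzero[OF \<alpha>] by auto
  let ?s = "cor \<alpha> + cor \<beta>"
  have sh: "?s \<in> h" using ch subspace_add[OF h_subspace] by blast
  have "\<gamma> ?s \<in> \<real>" if "\<gamma> \<in> R" for \<gamma>
    using root_add[OF that ch] real \<alpha> \<beta> that by simp
  then obtain r where r: "r \<ge> 0" "kappa ?s ?s = of_real r" "r = 0 \<Longrightarrow> ?s = 0"
    using kappa_square_real[OF sh] by blast
  have "kappa ?s ?s = ?N * (2 + of_int k)"
    using kappa_coroot[OF \<alpha> ch(2)] k N kappa_sym[of "cor \<alpha>" "cor \<beta>"]
    by (simp add: kappa_add_left kappa_add_right algebra_simps)
  then have "complex_of_real r = of_real (n * (2 + of_int k))" using n r by simp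
  then have "r = n * (2 + of_int k)" by (simp only: of_real_eq_iff)
  moreover have "n * (2 + real_of_int k) \<le> 0" using n(1) k2 by (intro mult_nonneg_nonpos) auto
  ultimately have "?s = 0" using r by simp
  then have cb: "cor \<beta> = - cor \<alpha>" by (simp add: eq_neg_iff_add_eq_0 add.commute)
  have "\<beta> y = - \<alpha> y" if y: "y \<in> h" for y
  proof -
    have "\<beta> y * ?N = (- \<alpha> y) * ?N"
      using kappa_coroot[OF \<alpha> y] kappa_coroot[OF \<beta> y] unfolding cb by (simp add: kappa_minus)
    then show ?thesis using kappa_coroot_nonzero[OF \<alpha>] mult_right_cancel by blast
  qed
  then have "\<beta> = - \<alpha>" by (intro root_eqI[OF \<beta> neg_root[OF \<alpha>]]) simp
  with ne show False by simp
qed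

lemma reflection_involutive: "\<alpha> \<in> R \<Longrightarrow> rfl \<alpha> (rfl \<alpha> \<beta>) = \<beta>"
  by (simp add: reflection_def root_coroot fun_eq_iff algebra_simps)

lemma reflection_pairing: "\<alpha> \<in> R \<Longrightarrow> rfl \<alpha> \<beta> (cor \<alpha>) = - \<beta> (cor \<alpha>)"
  by (simp add: reflection_def root_coroot)

lemma reflection_uminus: "rfl \<alpha> (- \<beta>) = - rfl \<alpha> \<beta>"
  by (simp add: reflection_def fun_eq_iff algebra_simps)

lemma reflection_self: "\<alpha> \<in> R \<Longrightarrow> rfl \<alpha> \<alpha> = - \<alpha>"
  by (simp add: reflection_def root_coroot fun_eq_iff)

text \<open>Both sides are Killing-dual to \<open>rfl \<alpha> \<delta>\<close> up to a factor. That
  factor is 1, as the root takes the value 2 on both.\<close>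

lemma coroot_reflection:
  assumes \<alpha>: "\<alpha> \<in> R" and \<delta>: "\<delta> \<in> R"
  shows "cor (rfl \<alpha> \<delta>) = cor \<delta> - \<alpha> (cor \<delta>) \<cdot> cor \<alpha>"
proof -
  define \<delta>' where "\<delta>' = \<alpha> (cor \<delta>)"
  let ?z = "cor \<delta> - \<delta>' \<cdot> cor \<alpha>"
  let ?\<rho> = "rfl \<alpha> \<delta>"
  let ?N = "\<lambda>\<alpha>. kappa (cor \<alpha>) (cor \<alpha>) / 2"
  note ch = coroot_in_h[OF \<alpha>] coroot_in_h[OF \<delta>]
  have \<rho>: "?\<rho> \<in> R" by (rule reflection_root[OF \<alpha> \<delta>])
  have zh: "?z \<in> h" using ch h_subspace by (intro subspace_diff subspace_scale)
  have ev: "\<gamma> ?z = \<gamma> (cor \<delta>) - \<delta>' * \<gamma> (cor \<alpha>)" if "\<gamma> \<in> R" for \<gamma>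
  proof -
    have m: "(- \<delta>') \<cdot> cor \<alpha> \<in> h" using ch(1) h_subspace by (intro subspace_scale)
    have "\<gamma> (cor \<delta> + (- \<delta>') \<cdot> cor \<alpha>) = \<gamma> (cor \<delta>) + (- \<delta>') * \<gamma> (cor \<alpha>)"
      by (simp only: root_add[OF that ch(2) m] root_scale[OF that ch(1)])
    then show ?thesis by (simp add: scale_minus_left)
  qed
  have z2: "?\<rho> ?z = 2"
    using ev[OF \<delta>] ev[OF \<alpha>] root_coroot[OF \<alpha>] root_coroot[OF \<delta>]
    by (simp add: reflection_def \<delta>'_def algebra_simps)
  have sym: "\<delta>' * ?N \<alpha> = \<delta> (cor \<alpha>) * ?N \<delta>"
    using kappa_coroot[OF \<alpha> ch(2)] kappa_coroot[OF \<delta> ch(1)] kappa_sym[of "cor \<alpha>" "cor \<delta>"]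
    by (simp add: \<delta>'_def)
  have kz: "kappa ?z y = ?\<rho> y * ?N \<delta>" if "y \<in> h" for y
  proof -
    have "kappa ?z y = \<delta> y * ?N \<delta> - \<delta>' * (\<alpha> y * ?N \<alpha>)"
      by (simp only: kappa_diff kappa_scale_left kappa_coroot[OF \<alpha> that] kappa_coroot[OF \<delta> that])
    also have "\<delta>' * (\<alpha> y * ?N \<alpha>) = \<alpha> y * (\<delta>' * ?N \<alpha>)" by (simp only: mult_ac)
    also have "\<dots> = \<alpha> y * (\<delta> (cor \<alpha>) * ?N \<delta>)" by (simp only: sym)
    finally show ?thesis by (simp add: reflection_def algebra_simps)
  qed
  let ?c = "?N ?\<rho> / ?N \<delta>"
  have "cor ?\<rho> - ?c \<cdot> ?z = 0"
  proof (rule kappa_h_nondegenerate)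
    show "cor ?\<rho> - ?c \<cdot> ?z \<in> h" 
      by (rule subspace_diff[OF h_subspace coroot_in_h[OF \<rho>] subspace_scale[OF h_subspace zh]])
    show "kappa (cor ?\<rho> - ?c \<cdot> ?z) y = 0" if "y \<in> h" for y
    proof -
      have "kappa (cor ?\<rho> - ?c \<cdot> ?z) y = ?\<rho> y * ?N ?\<rho> - ?c * (?\<rho> y * ?N \<delta>)"
        by (simp only: kappa_diff(1)[of "cor ?\<rho>" "?c \<cdot> ?z"] kappa_scale_left kz[OF that]
            kappa_coroot[OF \<rho> that])
      then show ?thesis using kappa_coroot_nonzero[OF \<delta>] by simp
    qed
  qed
  then have eq: "cor ?\<rho> = ?c \<cdot> ?z" by (simp only: right_minus_eq)
  have "2 = ?c * 2" using root_coroot[OF \<rho>] root_scale[OF \<rho> zh, of ?c] eq z2 by simp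
  then have "?c = 1" using kappa_coroot_nonzero[OF \<delta>] by (simp add: field_simps)
  with eq show ?thesis by (simp add: \<delta>'_def)
qed

lemma reflection_conjugate:
  assumes \<alpha>: "\<alpha> \<in> R" and \<delta>: "\<delta> \<in> R" and \<gamma>: "\<gamma> \<in> R"
  shows "rfl (rfl \<alpha> \<delta>) (rfl \<alpha> \<gamma>) = rfl \<alpha> (rfl \<delta> \<gamma>)"
    and "rfl \<alpha> \<gamma> (cor (rfl \<alpha> \<delta>)) = \<gamma> (cor \<delta>)"
proof -
  note ch = coroot_in_h[OF \<alpha>] coroot_in_h[OF \<delta>]
  have ev: "\<beta> (cor (rfl \<alpha> \<delta>)) = \<beta> (cor \<delta>) - \<alpha> (cor \<delta>) * \<beta> (cor \<alpha>)" if "\<beta> \<in> R" for \<beta>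
  proof -
    have m: "(- \<alpha> (cor \<delta>)) \<cdot> cor \<alpha> \<in> h" using ch(1) h_subspace by (intro subspace_scale)
    have "\<beta> (cor \<delta> + (- \<alpha> (cor \<delta>)) \<cdot> cor \<alpha>) = \<beta> (cor \<delta>) + (- \<alpha> (cor \<delta>)) * \<beta> (cor \<alpha>)"
      by (simp only: root_add[OF that ch(2) m] root_scale[OF that ch(1)])
    then show ?thesis using coroot_reflection[OF \<alpha> \<delta>] by (simp add: scale_minus_left)
  qed
  show 2: "rfl \<alpha> \<gamma> (cor (rfl \<alpha> \<delta>)) = \<gamma> (cor \<delta>)"
    using ev[OF \<gamma>] ev[OF \<alpha>] root_coroot[OF \<alpha>] by (simp add: reflection_def algebra_simps)
  show "rfl (rfl \<alpha> \<delta>) (rfl \<alpha> \<gamma>) = rfl \<alpha> (rfl \<delta> \<gamma>)"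
    unfolding reflection_def[of sm br h "rfl \<alpha> \<delta>" "rfl \<alpha> \<gamma>"] 2
    by (simp add: reflection_def fun_eq_iff algebra_simps)
qed

section \<open>Subspaces that contain \<open>h\<close> and are stable under it, and their
  dimensions\<close>

definition regsub :: "('g \<Rightarrow> complex) set \<Rightarrow> 'g set" where
  "regsub P = span (h \<union> (\<Union>\<beta>\<in>P. RS \<beta>))"

lemma subspace_regsub: "subspace (regsub P)" by (simp add: regsub_def)

lemma h_regsub: "h \<subseteq> regsub P" unfolding regsub_def by (meson Un_upper1 span_superset subset_trans)

lemma q_w_eq: "q_w sm br h Q w = regsub (w ` Q)"
proof -
  have "\<Union> {RS \<beta> | \<beta>. \<beta> \<in> w ` Q} = (\<Union>\<beta>\<in>w ` Q. RS \<beta>)" by blast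
  then show ?thesis by (simp add: q_w_def regsub_def cspan_eq)
qed

lemma RS_regsub_iff:
  assumes P: "P \<subseteq> R" and \<alpha>: "\<alpha> \<in> R" shows "RS \<alpha> \<subseteq> regsub P \<longleftrightarrow> \<alpha> \<in> P"
proof
  show "\<alpha> \<in> P \<Longrightarrow> RS \<alpha> \<subseteq> regsub P" by (auto simp: regsub_def intro: span_base)
  assume sub: "RS \<alpha> \<subseteq> regsub P"
  show "\<alpha> \<in> P"
  proof (rule ccontr)
    assume no: "\<alpha> \<notin> P"
    obtain e where e: "e \<in> RS \<alpha>" "e \<noteq> 0" using root_vector[OF \<alpha>] .
    obtain f where f: "f \<in> RS (- \<alpha>)" "kappa e f \<noteq> 0" using kappa_dual_vector[OF \<alpha> e] .
    have "kappa f e = 0"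
    proof (rule kappa_span_right)
      show "e \<in> span (h \<union> (\<Union>\<beta>\<in>P. RS \<beta>))" using sub e by (auto simp: regsub_def)
      fix w assume "w \<in> h \<union> (\<Union>\<beta>\<in>P. RS \<beta>)"
      then consider "w \<in> h" | \<beta> where "\<beta> \<in> P" "w \<in> RS \<beta>" by blast
      then show "kappa f w = 0"
      proof cases
        case 1
        then show ?thesis using kappa_h_RS[OF 1 f(1) neg_root[OF \<alpha>]] kappa_sym[of f w] by simp
      next
        case 2
        then have "\<beta> \<in> R" "\<beta> \<noteq> \<alpha>" using P no by auto
        then obtain z where "z \<in> h" "\<beta> z \<noteq> \<alpha> z" using root_eqI[OF _ \<alpha>] by blast
        then show ?thesis using kappa_RS[OF f(1) 2(2)] by simp
      qed
    qed
    with f(2) kappa_sym[of e f] show False by simp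
  qed
qed

text \<open>Root spaces are lines, so one meeting \<open>M\<close> nontrivially is contained in it.
  Both \<open>q\<close> and the intersections that define the CR dimension become sets of roots in
  this way.\<close>

lemma h_stable_eq_regsub:
  assumes M: "subspace M" "\<And>x v. x \<in> h \<Longrightarrow> v \<in> M \<Longrightarrow> br x v \<in> M" "h \<subseteq> M"
  shows "M = regsub {\<alpha> \<in> R. RS \<alpha> \<subseteq> M}"
proof
  show "regsub {\<alpha> \<in> R. RS \<alpha> \<subseteq> M} \<subseteq> M"
    unfolding regsub_def by (rule span_minimal[OF _ M(1)]) (use M(3) in auto)
  have "M \<inter> RS \<alpha> \<subseteq> regsub {\<alpha> \<in> R. RS \<alpha> \<subseteq> M}" if \<alpha>: "\<alpha> \<in> R" for \<alpha>
  proof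
    fix v assume v: "v \<in> M \<inter> RS \<alpha>"
    show "v \<in> regsub {\<alpha> \<in> R. RS \<alpha> \<subseteq> M}"
    proof (cases "v = 0")
      case True
      then show ?thesis using subspace_0[OF subspace_regsub] by simp
    next
      case False
      have "RS \<alpha> \<subseteq> M"
      proof
        fix w assume "w \<in> RS \<alpha>"
        then obtain c where "w = c \<cdot> v" using root_space_line'[OF \<alpha>, of v w] v False by blast
        then show "w \<in> M" using v subspace_scale[OF M(1)] by auto
      qed
      then show ?thesis unfolding regsub_def using v \<alpha> by (intro span_base) auto
    qed
  qed
  then have "M \<inter> h \<union> (\<Union>\<alpha>\<in>R. M \<inter> RS \<alpha>) \<subseteq> regsub {\<alpha> \<in> R. RS \<alpha> \<subseteq> M}" using h_regsub by blast
  then have "span (M \<inter> h \<union> (\<Union>\<alpha>\<in>R. M \<inter> RS \<alpha>)) \<subseteq> regsub {\<alpha> \<in> R. RS \<alpha> \<subseteq> M}"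
    by (rule span_minimal[OF _ subspace_regsub])
  then show "M \<subseteq> regsub {\<alpha> \<in> R. RS \<alpha> \<subseteq> M}" using weight_decomp[OF M(1,2)] by simp
qed

lemma regsub_h_stable:
  assumes "x \<in> h" "v \<in> regsub P" shows "br x v \<in> regsub P"
proof (rule lin_span_subset[OF lin_br subspace_regsub _ assms(2)[unfolded regsub_def]])
  fix w assume "w \<in> h \<union> (\<Union>\<beta>\<in>P. RS \<beta>)"
  then consider "w \<in> h" | \<beta> where "\<beta> \<in> P" "w \<in> RS \<beta>" by blast
  then show "br x w \<in> regsub P"
  proof cases
    case 1
    then show ?thesis using h_abelian[OF assms(1)] subspace_0[OF subspace_regsub] by simp
  next
    case 2
    then have "w \<in> regsub P" unfolding regsub_def by (intro span_base) auto
    then show ?thesis using RS_D[OF 2(2) assms(1)] subspace_scale[OF subspace_regsub] by simp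
  qed
qed

lemma regsub_inter:
  assumes "P \<subseteq> R" "P' \<subseteq> R" shows "regsub P \<inter> regsub P' = regsub (P \<inter> P')"
proof -
  let ?M = "regsub P \<inter> regsub P'"
  have "?M = regsub {\<alpha> \<in> R. RS \<alpha> \<subseteq> ?M}"
    by (rule h_stable_eq_regsub) (use subspace_regsub subspace_inter regsub_h_stable h_regsub in auto)
  also have "{\<alpha> \<in> R. RS \<alpha> \<subseteq> ?M} = P \<inter> P'"
    using RS_regsub_iff assms by auto
  finally show ?thesis .
qed

lemma dim_regsub: assumes "P \<subseteq> R" shows "dim (regsub P) = dim h + card P"
proof -
  have "finite P" using assms finite_roots finite_subset by blast
  then show ?thesis using assms
  proof (induction P rule: finite_induct)
    case empty
    then show ?case by (simp add: regsub_def)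
  next
    case (insert \<alpha> P)
    then have \<alpha>: "\<alpha> \<in> R" "P \<subseteq> R" by auto
    obtain e where e: "e \<in> RS \<alpha>" "e \<noteq> 0" using root_vector[OF \<alpha>(1)] .
    have "e \<notin> regsub P"
    proof
      assume "e \<in> regsub P"
      then have "RS \<alpha> \<subseteq> regsub P"
        using root_space_line'[OF \<alpha>(1) e] subspace_scale[OF subspace_regsub] by (metis subsetI)
      then show False using RS_regsub_iff[OF \<alpha>(2,1)] insert.hyps by simp
    qed
    moreover have "regsub (insert \<alpha> P) = span (insert e (regsub P))"
    proof
      have "RS \<alpha> \<subseteq> span (insert e (regsub P))"
      proof
        fix w assume "w \<in> RS \<alpha>"
        then obtain c where "w = c \<cdot> e" using root_space_line'[OF \<alpha>(1) e] by blast
        then show "w \<in> span (insert e (regsub P))" by (auto intro: span_scale span_base)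
      qed
      moreover have "regsub P \<subseteq> span (insert e (regsub P))"
        by (meson span_superset subset_insertI subset_trans)
      moreover have "h \<union> (\<Union>\<beta>\<in>P. RS \<beta>) \<subseteq> regsub P" unfolding regsub_def by (rule span_superset)
      ultimately show "regsub (insert \<alpha> P) \<subseteq> span (insert e (regsub P))"
        unfolding regsub_def[of "insert \<alpha> P"] by (intro span_minimal) auto
      have "regsub P \<subseteq> regsub (insert \<alpha> P)" unfolding regsub_def by (rule span_mono) auto
      moreover have "e \<in> regsub (insert \<alpha> P)" unfolding regsub_def using e by (intro span_base) auto
      ultimately show "span (insert e (regsub P)) \<subseteq> regsub (insert \<alpha> P)"
        by (intro span_minimal[OF _ subspace_regsub]) auto
    qed
    ultimately show ?case using insert \<alpha>
      by (simp add: dim_insert span_eq_iff[THEN iffD2, OF subspace_regsub])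
  qed
qed

end

section \<open>Root sets of parabolic subalgebras\<close>

locale parabolic_lie = cartan_lie sm Basis br h
  for sm :: "complex \<Rightarrow> 'g::ab_group_add \<Rightarrow> 'g" (infixr \<open>\<cdot>\<close> 75) and Basis :: "'g set"
    and br :: "'g \<Rightarrow> 'g \<Rightarrow> 'g" and h :: "'g set" +
  fixes q :: "'g set"
  assumes q_parabolic: "parabolic sm br q" and h_q: "h \<subseteq> q"
begin

abbreviation Q :: "('g \<Rightarrow> complex) set" where "Q \<equiv> parabolic_set sm br h q"

lemma q_subalgebra: "subalgebra sm br q" using q_parabolic by (simp add: parabolic_def)

lemma Q_roots: "\<alpha> \<in> Q \<Longrightarrow> \<alpha> \<in> R" "\<alpha> \<in> Q \<Longrightarrow> RS \<alpha> \<subseteq> q" "Q \<subseteq> R"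
  by (auto simp: parabolic_set_def)

lemma q_eq_regsub: "q = regsub Q"
  unfolding parabolic_set_def
  by (rule h_stable_eq_regsub[OF subalgebraD(1)[OF q_subalgebra] _ h_q])
    (use subalgebraD(2)[OF q_subalgebra] h_q in auto)

text \<open>With a nonpositive Cartan integer the reflection adds \<alpha> repeatedly. The vector
  realizing this is a nonzero iterate of \<open>br e\<close> inside the subalgebra \<open>q\<close>,
  and it spans its root space. Each side condition of the counting argument reduces to this.\<close>

lemma Q_reflection:
  assumes \<alpha>: "\<alpha> \<in> Q" and \<gamma>: "\<gamma> \<in> Q" and le: "Re (\<gamma> (cor \<alpha>)) \<le> 0"
  shows "rfl \<alpha> \<gamma> \<in> Q"
proof -
  note R = Q_roots(1)[OF \<alpha>] Q_roots(1)[OF \<gamma>]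
  obtain e f where T: "sl2_triple \<alpha> e f (cor \<alpha>)" using root_triple[OF R(1)] .
  obtain v where v: "v \<in> RS \<gamma>" "v \<noteq> 0" using root_vector[OF R(2)] .
  obtain k where k: "\<gamma> (cor \<alpha>) = of_int k" using cartan_integer[OF R] .
  then have m: "\<gamma> (cor \<alpha>) = - of_nat (nat (- k))" using le by simp
  let ?w = "(br e ^^ nat (- k)) v"
  have w: "rfl \<alpha> \<gamma> \<in> R" "?w \<in> RS (rfl \<alpha> \<gamma>)" "?w \<noteq> 0"
    using reflection_string[OF T R(2) m v] reflection_vector[OF T R(2) m v] by auto
  have "e \<in> q" using sl2_tripleD(2)[OF T] Q_roots(2)[OF \<alpha>] by blast
  then have "?w \<in> q"
    using pow_stable[of q "br e"] subalgebraD(2)[OF q_subalgebra] v(1) Q_roots(2)[OF \<gamma>] by blast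
  then have "RS (rfl \<alpha> \<gamma>) \<subseteq> q"
    using root_space_line'[OF w(1,2,3)] subspace_scale[OF subalgebraD(1)[OF q_subalgebra]]
    by (metis subsetI)
  then show ?thesis using w(1) by (simp add: parabolic_set_def)
qed

text \<open>Every vector \<open>n\<close> orthogonal to \<open>q\<close> lies in the Borel subalgebra \<open>B\<close>: otherwise Lie's theorem
  yields such an \<open>n\<close> outside \<open>B\<close> for which \<open>B + \<complex>n\<close> is a subalgebra, and Cartan's criterion shows
  that it is solvable.\<close>
lemma parabolic_perp_subset_borel:
  assumes B: "Defs.borel sm br B" "B \<subseteq> q" and orth: "\<And>y. y \<in> q \<Longrightarrow> kappa x y = 0"
  shows "x \<in> B"
proof (rule ccontr)
  assume xB: "x \<notin> B"
  have Bs: "subalgebra sm br B" "solvable sm br B"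
    and Bmax: "\<And>S. subalgebra sm br S \<Longrightarrow> solvable sm br S \<Longrightarrow> B \<subseteq> S \<Longrightarrow> S = B"
    using B(1) by (auto simp: Defs.borel_def)
  note sB = subalgebraD(1)[OF Bs(1)]
  define N where "N = {x. \<forall>y\<in>q. kappa x y = 0}"
  have N: "subspace N" unfolding N_def by (rule subspace_kappa_perp)
  have BN: "br b n \<in> N" if "b \<in> B" "n \<in> N" for b n
  proof -
    have "kappa (br b n) y = - kappa n (br b y)" for y
      by (simp only: br_swap[of b n] kappa_minus kappa_invariant)
    moreover have "br b y \<in> q" if "y \<in> q" for y
      using subalgebraD(2)[OF q_subalgebra] \<open>b \<in> B\<close> B(2) that by blast
    ultimately show ?thesis using that(2) by (simp add: N_def)
  qed
  let ?V = "span (N \<union> B)"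
  have stV: "br b v \<in> ?V" if b: "b \<in> B" and v: "v \<in> ?V" for b v
  proof (rule lin_span_subset[OF lin_br subspace_span _ v])
    fix w assume "w \<in> N \<union> B"
    then have "br b w \<in> N \<union> B" using BN[OF b] subalgebraD(2)[OF Bs(1) b] by auto
    then show "br b w \<in> ?V" by (rule span_base)
  qed
  have "B \<subseteq> ?V" "x \<in> ?V" using orth by (auto simp: N_def intro: span_base)
  then have "B \<subset> ?V" using xB by blast
  \<comment> \<open>Lie's theorem for \<open>B\<close> on the quotient of N + B by \<open>B\<close>.
    Only the component \<open>n\<close> of \<open>v\<close> in \<open>N\<close> is kept below, since
    it has the orthogonality that the criterion asks for.\<close>
  then obtain v \<mu> where v: "v \<in> ?V" "v \<notin> B" "\<And>b. b \<in> B \<Longrightarrow> br b v - \<mu> b \<cdot> v \<in> B"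
    using lie_theorem[OF Bs sB subalgebraD(2)[OF Bs(1)] subspace_span stV, of thesis] by blast
  obtain n b0 where nb: "n \<in> N" "b0 \<in> B" "v = n + b0"
    using v(1) span_eq_iff[THEN iffD2, OF N] span_eq_iff[THEN iffD2, OF sB] by (auto simp: span_Un)
  have nB: "n \<notin> B" using v(2) nb subspace_add[OF sB] by blast
  let ?B' = "span (insert n B)"
  have bn: "br b n \<in> ?B'" if "b \<in> B" for b
  proof -
    have "br b n = (br b v - \<mu> b \<cdot> v) - br b b0 + \<mu> b \<cdot> b0 + \<mu> b \<cdot> n"
      by (simp add: nb(3) br_add_right scale_right_distrib)
    moreover have "(br b v - \<mu> b \<cdot> v) - br b b0 + \<mu> b \<cdot> b0 \<in> B"
      by (rule subspace_add[OF sB subspace_diff[OF sB v(3)[OF that] subalgebraD(2)[OF Bs(1) that nb(2)]]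
            subspace_scale[OF sB nb(2)]])
    ultimately show ?thesis by (simp only:) (intro span_add span_scale span_base; simp)
  qed
  have nn: "br n b \<in> ?B'" if "b \<in> B" for b
    using span_neg[OF bn[OF that]] br_swap[of n b] by simp
  have B'B': "br u v \<in> ?B'" if u: "u \<in> ?B'" and v: "v \<in> ?B'" for u v
  proof -
    obtain s b where "b \<in> B" "u = b + s \<cdot> n" using in_span_insertE[OF sB u] .
    moreover obtain t c where "c \<in> B" "v = c + t \<cdot> n" using in_span_insertE[OF sB v] .
    ultimately show ?thesis using bn nn subalgebraD(2)[OF Bs(1)]
      by (auto simp: br_add_left br_add_right br_scale_left br_scale_right
          intro!: span_add span_scale intro: span_base)
  qed
  have B': "subalgebra sm br ?B'" using B'B' by (simp add: subalgebra_iff)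
  have nq: "kappa n y = 0" "kappa y n = 0" if "y \<in> B" for y
    using nb(1) that B(2) kappa_sym[of y n] by (auto simp: N_def)
  \<comment> \<open>Expanded in \<open>B\<close> and \<open>n\<close>: terms within \<open>B\<close>
    vanish because \<open>B\<close> is solvable, and invariance reduces the others either to a
    product of \<open>n\<close> with an element of \<open>B\<close>, which is part of
    \<open>q\<close>, or to \<open>br n n\<close>.\<close>
  have "kappa a z = 0" if a: "a \<in> ?B'" and z: "z \<in> drv ?B'" for a z
  proof (rule kappa_span_right[OF _ z])
    fix w assume "w \<in> brs br ?B' ?B'"
    then obtain u v where uv: "u \<in> ?B'" "v \<in> ?B'" "w = br u v" by (auto simp: brs_def)
    obtain s b where b: "b \<in> B" "u = b + s \<cdot> n" using in_span_insertE[OF sB uv(1)] .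
    obtain t c where c: "c \<in> B" "v = c + t \<cdot> n" using in_span_insertE[OF sB uv(2)] .
    obtain r d where d: "d \<in> B" "a = d + r \<cdot> n" using in_span_insertE[OF sB a] .
    have 1: "kappa d (br b c) = 0" by (rule kappa_solvable[OF Bs d(1) br_in_drv[OF b(1) c(1)]])
    have 2: "kappa d (br b n) = 0" if "b \<in> B" for b
      using nq(2)[OF subalgebraD(2)[OF Bs(1) d(1) that]] by (simp add: kappa_invariant[symmetric])
    then have 3: "kappa d (br n c) = 0" using c(1) br_swap[of n c] by (simp add: kappa_minus)
    have 4: "kappa n (br b c) = 0" by (rule nq(1)[OF subalgebraD(2)[OF Bs(1) b(1) c(1)]])
    have 5: "kappa n (br n c) = 0" for c using kappa_invariant[of n n c] by simp
    then have 6: "kappa n (br b n) = 0" using br_swap[of b n] by (simp add: kappa_minus)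
    show "kappa a w = 0" unfolding uv(3) b(2) c(2) d(2)
      using 1 2[OF b(1)] 3 4 5 6 by (simp add: br_add_left br_add_right br_scale_left br_scale_right
          kappa_add_left kappa_add_right kappa_scale_left kappa_scale_right)
  qed
  then have "solvable sm br ?B'" by (rule cartan_criterion[OF B'])
  moreover have "B \<subseteq> ?B'" using span_superset[of "insert n B"] by auto
  ultimately have "?B' = B" using Bmax[OF B'] by blast
  moreover have "n \<in> ?B'" by (rule span_base) simp
  ultimately show False using nB by simp
qed

text \<open>If both were missing, both root spaces would be orthogonal to \<open>q\<close> and hence
  lie in a Borel subalgebra. Then \<open>t = br e f\<close> lies in its derived algebra, so
  \<open>kappa t t = 0\<close>, although it equals twice the nonzero
  \<open>kappa e f\<close>.\<close>

lemma Q_or_neg: assumes \<alpha>: "\<alpha> \<in> R" "\<alpha> \<notin> Q" shows "- \<alpha> \<in> Q"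
proof (rule ccontr)
  assume no: "- \<alpha> \<notin> Q"
  obtain B where B: "Defs.borel sm br B" "B \<subseteq> q" using q_parabolic by (auto simp: parabolic_def)
  have Bs: "subalgebra sm br B" "solvable sm br B" using B(1) by (auto simp: Defs.borel_def)
  have perp: "x \<in> B" if x: "x \<in> RS \<beta>" and \<beta>: "\<beta> \<in> R" "- \<beta> \<notin> Q" for x \<beta>
  proof (rule parabolic_perp_subset_borel[OF B])
    fix y assume "y \<in> q"
    then have "y \<in> span (h \<union> (\<Union>\<gamma>\<in>Q. RS \<gamma>))" using q_eq_regsub by (simp add: regsub_def)
    then show "kappa x y = 0"
    proof (rule kappa_span_right[rotated])
      fix w assume "w \<in> h \<union> (\<Union>\<gamma>\<in>Q. RS \<gamma>)"
      then consider "w \<in> h" | \<gamma> where "\<gamma> \<in> Q" "w \<in> RS \<gamma>" by blast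
      then show "kappa x w = 0"
      proof cases
        case 1
        then show ?thesis using kappa_h_RS[OF 1 x \<beta>(1)] kappa_sym[of x w] by simp
      next
        case 2
        then have "\<gamma> \<noteq> - \<beta>" using \<beta>(2) by auto
        then obtain z where "z \<in> h" "\<gamma> z \<noteq> (- \<beta>) z"
          using root_eqI[OF Q_roots(1)[OF 2(1)] neg_root[OF \<beta>(1)]] by blast
        then show ?thesis using kappa_RS[OF x 2(2), of z] by (auto simp: add_eq_0_iff)
      qed
    qed
  qed
  obtain e f t where T: "sl2_triple \<alpha> e f t" using sl2_triple_exists[OF \<alpha>(1)] .
  note T' = sl2_tripleD[OF T]
  have "- (- \<alpha>) = \<alpha>" by (simp add: fun_eq_iff)
  then have ef: "e \<in> B" "f \<in> B" using perp[OF T'(2) \<alpha>(1) no] perp[OF T'(3) neg_root[OF \<alpha>(1)]] \<alpha>(2) by auto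
  then have "kappa t t = 0"
    using kappa_solvable[OF Bs subalgebraD(2)[OF Bs(1) ef] br_in_drv[OF ef]] T'(4) by simp
  moreover have "kappa t t = 2 * kappa e f" using kappa_bracket_h[OF T'(2,3,6)] T'(4,5) by simp
  ultimately show False using kappa_triple_nonzero[OF T] by simp
qed

end

section \<open>The involution on roots and the CR dimension as a count of roots\<close>

locale cr_lie = parabolic_lie sm Basis br h q
  for sm :: "complex \<Rightarrow> 'g::ab_group_add \<Rightarrow> 'g" (infixr \<open>\<cdot>\<close> 75) and Basis :: "'g set"
    and br :: "'g \<Rightarrow> 'g \<Rightarrow> 'g" and h :: "'g set" and q :: "'g set" +
  fixes \<sigma> :: "'g \<Rightarrow> 'g"
  assumes \<sigma>: "anti_involution sm br \<sigma>" and \<sigma>_h: "\<And>x. x \<in> h \<Longrightarrow> \<sigma> x \<in> h"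
begin

lemma \<sigma>_simps: "\<sigma> (x + y) = \<sigma> x + \<sigma> y" "\<sigma> (c \<cdot> x) = cnj c \<cdot> \<sigma> x" "\<sigma> (\<sigma> x) = x"
    "\<sigma> (br x y) = br (\<sigma> x) (\<sigma> y)"
  using \<sigma> by (auto simp: anti_involution_def)

lemma \<sigma>_0: "\<sigma> 0 = 0" using \<sigma>_simps(2)[of 0 0] by simp

lemma \<sigma>_h_iff: "\<sigma> x \<in> h \<longleftrightarrow> x \<in> h" using \<sigma>_h \<sigma>_simps(3) by metis

text \<open>The involution \<open>root_inv\<close> in closed form, valid on roots by
  \<open>root_inv_eq\<close>. The conjugation appears because \<open>\<sigma>\<close> is
  antilinear.\<close>

definition s :: "('g \<Rightarrow> complex) \<Rightarrow> ('g \<Rightarrow> complex)" where "s \<alpha> = (\<lambda>x. cnj (\<alpha> (\<sigma> x)))"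

lemma s_s [simp]: "s (s \<alpha>) = \<alpha>" by (simp add: s_def \<sigma>_simps)

lemma s_neg: "s (- \<alpha>) = - s \<alpha>" by (simp add: s_def fun_eq_iff)

lemma \<sigma>_RS: "x \<in> RS \<alpha> \<Longrightarrow> \<sigma> x \<in> RS (s \<alpha>)"
proof (rule RS_I)
  fix y assume x: "x \<in> RS \<alpha>" and y: "y \<in> h"
  have "br y (\<sigma> x) = \<sigma> (br (\<sigma> y) x)" by (simp add: \<sigma>_simps)
  also have "\<dots> = s \<alpha> y \<cdot> \<sigma> x" using RS_D[OF x \<sigma>_h[OF y]] by (simp add: \<sigma>_simps s_def)
  finally show "br y (\<sigma> x) = s \<alpha> y \<cdot> \<sigma> x" .
qed

lemma \<sigma>_RS_image: "\<sigma> ` RS \<alpha> = RS (s \<alpha>)"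
proof
  show "\<sigma> ` RS \<alpha> \<subseteq> RS (s \<alpha>)" using \<sigma>_RS by blast
  show "RS (s \<alpha>) \<subseteq> \<sigma> ` RS \<alpha>"
  proof
    fix x assume "x \<in> RS (s \<alpha>)"
    then have "\<sigma> x \<in> RS \<alpha>" using \<sigma>_RS[of x "s \<alpha>"] by simp
    then show "x \<in> \<sigma> ` RS \<alpha>" using \<sigma>_simps(3) by (metis imageI)
  qed
qed

lemma s_root: assumes "\<alpha> \<in> R" shows "s \<alpha> \<in> R"
proof -
  obtain e where e: "e \<in> RS \<alpha>" "e \<noteq> 0" using root_vector[OF assms] .
  obtain y where y: "y \<in> h" "\<alpha> y \<noteq> 0" using roots_nonzero[OF assms] by blast
  have "\<sigma> e \<noteq> 0" using e(2) \<sigma>_simps(3) \<sigma>_0 by metis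
  then show ?thesis using \<sigma>_RS[OF e(1)] y \<sigma>_h[OF y(1)] roots_D[OF assms] \<sigma>_h_iff
    by (intro rootsI[of _ "\<sigma> e" "\<sigma> y"]) (auto simp: s_def \<sigma>_simps)
qed

lemma RS_inj:
  assumes "\<alpha> \<in> R" "\<beta> \<in> R" "RS \<alpha> = RS \<beta>" shows "\<alpha> = \<beta>"
proof (rule root_eqI[OF assms(1,2)])
  fix x assume x: "x \<in> h"
  obtain e where e: "e \<in> RS \<alpha>" "e \<noteq> 0" using root_vector[OF assms(1)] .
  have "\<alpha> x \<cdot> e = \<beta> x \<cdot> e" using RS_D[of e \<alpha> x] RS_D[of e \<beta> x] e x assms(3) by simp
  then show "\<alpha> x = \<beta> x" using e(2) by simp
qed

lemma root_inv_eq: assumes "\<alpha> \<in> R" shows "root_inv sm br h \<sigma> \<alpha> = s \<alpha>"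
  unfolding root_inv_def
  by (rule the_equality) (use s_root[OF assms] \<sigma>_RS_image RS_inj in auto)

text \<open>\<open>\<sigma>\<close> carries an sl2 triple to an sl2 triple. Hence \<open>s\<close>
  preserves Cartan integers and conjugates reflections, the sense in which it is isometric
  here.\<close>

lemma coroot_s: assumes "\<alpha> \<in> R" shows "cor (s \<alpha>) = \<sigma> (cor \<alpha>)"
proof -
  obtain e f where T: "sl2_triple \<alpha> e f (cor \<alpha>)" using root_triple[OF assms] .
  note T' = sl2_tripleD[OF T]
  have "sl2_triple (s \<alpha>) (\<sigma> e) (\<sigma> f) (\<sigma> (cor \<alpha>))"
    unfolding sl2_triple_def
    using s_root[OF assms] \<sigma>_RS[OF T'(2)] \<sigma>_RS[OF T'(3)] T'(4,5)
    by (simp add: s_neg \<sigma>_simps(4)[symmetric]) (simp add: s_def \<sigma>_simps)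
  then show ?thesis by (rule coroot_triple)
qed

lemma s_pairing: "\<alpha> \<in> R \<Longrightarrow> s \<gamma> (cor (s \<alpha>)) = cnj (\<gamma> (cor \<alpha>))"
  by (simp add: coroot_s) (simp add: s_def \<sigma>_simps)

lemma s_reflection: assumes "\<alpha> \<in> R" shows "s (rfl \<alpha> \<gamma>) = rfl (s \<alpha>) (s \<gamma>)"
  unfolding reflection_def s_pairing[OF assms] by (simp add: s_def)

lemma \<sigma>_regsub: "\<sigma> ` regsub P = regsub (s ` P)"
proof -
  have *: "\<sigma> x \<in> regsub (s ` P)" if "x \<in> regsub P" for x P
    using that unfolding regsub_def
  proof (induction rule: span_induct_alt)
    case base
    then show ?case by (simp add: \<sigma>_0 span_zero)
  next
    case (step c x y)
    have "\<sigma> x \<in> span (h \<union> (\<Union>\<beta>\<in>s ` P. RS \<beta>))"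
      by (rule span_base) (use step(1) \<sigma>_h \<sigma>_RS in auto)
    then show ?case using step(2) by (simp add: \<sigma>_simps span_add span_scale)
  qed
  show ?thesis
  proof
    show "\<sigma> ` regsub P \<subseteq> regsub (s ` P)" using * by blast
    show "regsub (s ` P) \<subseteq> \<sigma> ` regsub P"
    proof
      fix x assume "x \<in> regsub (s ` P)"
      then have "\<sigma> x \<in> regsub P" using *[of x "s ` P"] by (simp add: image_image)
      then show "x \<in> \<sigma> ` regsub P" using \<sigma>_simps(3) by (metis imageI)
    qed
  qed
qed

lemma cr_dim_regsub:
  assumes "P \<subseteq> R"
  shows "cr_dim sm \<sigma> (regsub P) = int (dim UNIV) - int (dim h + card (P \<inter> s ` P))"
proof -
  have "s ` P \<subseteq> R" using assms s_root by blast
  then have "regsub P \<inter> \<sigma> ` regsub P = regsub (P \<inter> s ` P)"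
    unfolding \<sigma>_regsub by (rule regsub_inter[OF assms])
  moreover have "P \<inter> s ` P \<subseteq> R" using assms by blast
  ultimately show ?thesis by (simp add: cr_dim_def cdim_eq dim_regsub del: dim_UNIV)
qed

section \<open>Bad roots and the reflection that increases the count\<close>

abbreviation bad :: "('g \<Rightarrow> complex) \<Rightarrow> bool" where
  "bad \<alpha> \<equiv> \<alpha> \<in> Q \<and> - \<alpha> \<notin> Q \<and> s \<alpha> \<notin> Q \<and> s \<alpha> \<noteq> - \<alpha>"

lemma mem_s_image: "x \<in> s ` A \<longleftrightarrow> s x \<in> A"
  by (auto intro: image_eqI[where x = "s x"])

lemma mem_rfl_image: "\<alpha> \<in> R \<Longrightarrow> x \<in> rfl \<alpha> ` A \<longleftrightarrow> rfl \<alpha> x \<in> A"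
  by (auto simp: reflection_involutive intro: image_eqI[where x = "rfl \<alpha> x"])

lemma neg_s_Q: "bad \<alpha> \<Longrightarrow> - s \<alpha> \<in> Q"
  using Q_or_neg[of "s \<alpha>"] s_root Q_roots by blast

lemma uminus_uminus_fun: "- (- \<alpha>) = (\<alpha> :: 'g \<Rightarrow> complex)" by (simp add: fun_eq_iff)

text \<open>For k \<ge> 0 the root \<open>- s \<alpha>\<close> pairs nonpositively with \<alpha>, so
  \<open>Q_reflection\<close> applies. For k = -1 the condition for \<alpha> asks for -(\<alpha> + s
  \<alpha>) in \<open>Q\<close>, and the condition for \<open>- s \<alpha>\<close> asks for \<alpha>
  + s \<alpha>; these are opposite roots, so one of them holds.\<close>

lemma bad_choice:
  assumes bad: "bad \<alpha>"
  obtains \<beta> where "bad \<beta>" "- rfl \<beta> (s \<beta>) \<in> Q"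
proof -
  have \<alpha>: "\<alpha> \<in> R" and s\<alpha>: "s \<alpha> \<in> R" using bad Q_roots s_root by blast+
  note ns = neg_s_Q[OF bad]
  obtain k where k: "s \<alpha> (cor \<alpha>) = of_int k" using cartan_integer[OF \<alpha> s\<alpha>] .
  have k': "\<alpha> (cor (s \<alpha>)) = of_int k" using s_pairing[OF \<alpha>, of "s \<alpha>"] k by simp
  have "k \<ge> -1" by (rule pairing_ge_minus_one[OF \<alpha> s\<alpha> k k']) (use bad in blast)
  show ?thesis
  proof (cases "k \<ge> 0")
    case True
    then have "rfl \<alpha> (- s \<alpha>) \<in> Q" using bad ns k by (intro Q_reflection) auto
    with bad that show ?thesis by (simp add: reflection_uminus)
  next
    case False
    with \<open>k \<ge> -1\<close> have k1: "k = -1" by simp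
    have r1: "rfl \<alpha> (s \<alpha>) = (\<lambda>x. s \<alpha> x + \<alpha> x)" using k k1 by (simp add: reflection_def)
    have r2: "- rfl (- s \<alpha>) (s (- s \<alpha>)) = (\<lambda>x. s \<alpha> x + \<alpha> x)"
      using k' k1 reflection_neg[OF s\<alpha> \<alpha>]
      by (simp add: s_neg reflection_uminus uminus_uminus_fun) (simp add: reflection_def fun_eq_iff)
    have "rfl \<alpha> (s \<alpha>) \<in> R" by (rule reflection_root[OF \<alpha> s\<alpha>])
    then consider "- rfl \<alpha> (s \<alpha>) \<in> Q" | "- rfl (- s \<alpha>) (s (- s \<alpha>)) \<in> Q"
      using Q_or_neg r1 r2 by metis
    then show ?thesis
    proof cases
      case 1
      with bad that show ?thesis by blast
    next
      case 2
      have "bad (- s \<alpha>)" using bad ns by (auto simp: s_neg uminus_uminus_fun)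
      with 2 that show ?thesis by blast
    qed
  qed
qed

lemma bad_reflection_increases:
  assumes bad: "bad \<alpha>" and \<eta>: "- rfl \<alpha> (s \<alpha>) \<in> Q"
  shows "card (Q \<inter> s ` Q) < card (rfl \<alpha> ` Q \<inter> s ` rfl \<alpha> ` Q)"
proof -
  have \<alpha>: "\<alpha> \<in> R" and s\<alpha>: "s \<alpha> \<in> R" using bad Q_roots s_root by blast+
  let ?r = "rfl \<alpha>" and ?k = "\<lambda>b. Re (b (cor \<alpha>))"
  have rR: "b \<in> R \<Longrightarrow> ?r b \<in> R" for b by (rule reflection_root[OF \<alpha>])
  have subs: "s ` Q \<subseteq> R" "s ` ?r ` Q \<subseteq> R" using Q_roots(1) s_root rR by blast+
  have rr: "?r (?r b) = b" for b by (rule reflection_involutive[OF \<alpha>])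
  have kr: "?k (?r b) = - ?k b" for b by (simp add: reflection_pairing[OF \<alpha>])
  have X: "b \<in> Q" if "b \<in> R" "?k b > 0" "?r b \<in> Q" for b
    using Q_reflection[of \<alpha> "?r b"] bad that kr[of b] rr[of b] by simp
  have Y1: "?r b \<in> s ` Q" if b: "b \<in> R" "?k b \<ge> 0" "b \<in> s ` Q" for b
  proof -
    have sb: "s b \<in> Q" "s b \<in> R" using b s_root by (auto simp: mem_s_image)
    have "Re (s b (cor (- s \<alpha>))) \<le> 0"
      using b(2) by (simp add: coroot_neg[OF s\<alpha>] root_minus[OF sb(2) coroot_in_h[OF s\<alpha>]] s_pairing[OF \<alpha>])
    then have "rfl (- s \<alpha>) (s b) \<in> Q" using neg_s_Q[OF bad] sb by (intro Q_reflection) auto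
    then show ?thesis by (simp add: mem_s_image s_reflection[OF \<alpha>] reflection_neg[OF s\<alpha> sb(2)])
  qed
  \<comment> \<open>The same after pulling back by \<open>s\<close> and the reflection: the wall
    becomes that of \<open>- rfl \<alpha> (s \<alpha>)\<close>, which lies in \<open>Q\<close> by
    the extra assumption.\<close>
  have Y2: "?r b \<in> s ` ?r ` Q" if b: "b \<in> R" "?k b \<ge> 0" "b \<in> s ` ?r ` Q" for b
  proof -
    have sb: "?r (s b) \<in> Q" "s b \<in> R" using b s_root by (auto simp: mem_s_image mem_rfl_image[OF \<alpha>])
    let ?d = "?r (s \<alpha>)"
    have d: "?d \<in> R" by (rule rR[OF s\<alpha>])
    have rsb: "?r (s b) \<in> R" by (rule rR[OF sb(2)])
    have "Re (?r (s b) (cor (- ?d))) \<le> 0"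
      using b(2) by (simp add: coroot_neg[OF d] root_minus[OF rsb coroot_in_h[OF d]]
          reflection_conjugate(2)[OF \<alpha> s\<alpha> sb(2)] s_pairing[OF \<alpha>])
    then have "rfl (- ?d) (?r (s b)) \<in> Q" by (rule Q_reflection[OF \<eta> sb(1)])
    also have "rfl (- ?d) (?r (s b)) = ?r (s (?r b))"
      by (simp add: reflection_neg[OF d rsb] reflection_conjugate(1)[OF \<alpha> s\<alpha> sb(2)] s_reflection[OF \<alpha>])
    finally show ?thesis by (simp add: mem_s_image mem_rfl_image[OF \<alpha>])
  qed
  have inj_r: "inj_on ?r A" for A by (rule inj_on_inverseI[of _ ?r]) (rule rr)
  have inj_s: "inj_on s A" for A by (rule inj_on_inverseI[of _ s]) simp
  have "card (Q \<inter> s ` Q) < card (Q \<inter> ?r ` s ` Q)"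
  proof (rule polarization_card(2)[where S = R and k = ?k and d = \<alpha>])
    show "?r \<alpha> \<in> s ` Q"
      using neg_s_Q[OF bad] by (simp add: reflection_self[OF \<alpha>] mem_s_image s_neg)
  qed (use finite_roots Q_roots(3) subs rR rr kr X Y1 bad in \<open>auto simp: reflection_self[OF \<alpha>] mem_s_image\<close>)
  \<comment> \<open>Applying the bijections \<open>?r\<close> and then \<open>s\<close> moves the
    reflection to the inside of the second set, the form that the second comparison starts
    from.\<close>
  also have "Q \<inter> ?r ` s ` Q = ?r ` (?r ` Q \<inter> s ` Q)"
    by (rule set_eqI) (simp only: Int_iff mem_rfl_image[OF \<alpha>] rr)
  also have "card \<dots> = card (?r ` Q \<inter> s ` Q)" by (rule card_image[OF inj_r])
  also have "?r ` Q \<inter> s ` Q = s ` (Q \<inter> s ` ?r ` Q)"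
    by (rule set_eqI) (auto simp only: Int_iff mem_s_image s_s)
  also have "card \<dots> = card (Q \<inter> s ` ?r ` Q)" by (rule card_image[OF inj_s])
  also have "\<dots> \<le> card (Q \<inter> ?r ` s ` ?r ` Q)"
    by (rule polarization_card(1)[where S = R and k = ?k])
      (use finite_roots Q_roots(3) subs rR rr kr X Y2 in auto)
  also have "Q \<inter> ?r ` s ` ?r ` Q = ?r ` (?r ` Q \<inter> s ` ?r ` Q)"
    by (rule set_eqI) (simp only: Int_iff mem_rfl_image[OF \<alpha>] rr)
  also have "card \<dots> = card (?r ` Q \<inter> s ` ?r ` Q)" by (rule card_image[OF inj_r])
  finally show ?thesis .
qed

theorem minimal_type:
  assumes min: "\<forall>w \<in> weyl sm br h. cr_dim sm \<sigma> q \<le> cr_dim sm \<sigma> (q_w sm br h Q w)"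
    and \<alpha>: "\<alpha> \<in> nilpart Q" "root_inv sm br h \<sigma> \<alpha> \<notin> Q"
  shows "root_inv sm br h \<sigma> \<alpha> = - \<alpha>"
proof (rule ccontr)
  assume ne: "root_inv sm br h \<sigma> \<alpha> \<noteq> - \<alpha>"
  have "\<alpha> \<in> R" using \<alpha>(1) Q_roots by (auto simp: nilpart_def)
  then have "bad \<alpha>" using \<alpha> ne by (auto simp: nilpart_def root_inv_eq)
  then obtain \<beta> where \<beta>: "bad \<beta>" "- rfl \<beta> (s \<beta>) \<in> Q" using bad_choice by blast
  have \<beta>R: "\<beta> \<in> R" using \<beta> Q_roots by blast
  have "rfl \<beta> \<circ> id \<in> weyl sm br h" by (rule weyl_step[OF \<beta>R weyl_id])
  then have "cr_dim sm \<sigma> (regsub Q) \<le> cr_dim sm \<sigma> (regsub (rfl \<beta> ` Q))"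
    using min q_eq_regsub by (auto simp: q_w_eq)
  moreover have "rfl \<beta> ` Q \<subseteq> R" using reflection_root[OF \<beta>R] Q_roots(1) by blast
  ultimately have "card (rfl \<beta> ` Q \<inter> s ` rfl \<beta> ` Q) \<le> card (Q \<inter> s ` Q)"
    using Q_roots(3) by (simp add: cr_dim_regsub)
  with bad_reflection_increases[OF \<beta>] show False by simp
qed

end

section \<open>Complexification of the real Cartan subalgebra\<close>

context lie_alg
begin

text \<open>Self-normalization is the delicate part. The points of \<open>span H\<close> fixed by
  \<open>\<sigma>\<close> are exactly those of \<open>H\<close>, and for a normalizing
  \<open>x\<close> both \<open>x + \<sigma> x\<close> and \<i> times \<open>x - \<sigma> x\<close>
  are fixed and bracket \<open>H\<close> into \<open>span H\<close>, hence into \<open>H\<close>; so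
  both lie in \<open>H\<close>, and together they span \<open>x\<close>.\<close>

lemma complexified_cartan:
  assumes \<sigma>: "anti_involution sm br \<sigma>" and H: "real_cartan sm br (real_form \<sigma>) H"
  shows "subalgebra sm br (span H)" "solvable sm br (span H)"
    and "\<And>x y. x \<in> span H \<Longrightarrow> y \<in> span H \<Longrightarrow> \<exists>n. (br x ^^ n) y = 0"
    and "\<And>x. (\<And>y. y \<in> span H \<Longrightarrow> br x y \<in> span H) \<Longrightarrow> x \<in> span H"
    and "\<And>x. x \<in> span H \<Longrightarrow> \<sigma> x \<in> span H"
proof -
  interpret RV: vector_space "\<lambda>r::real. sm (complex_of_real r)"
    by unfold_locales (auto simp: scale_right_distrib scale_left_distrib)
  have \<sigma>_simps: "\<sigma> (x + y) = \<sigma> x + \<sigma> y" "\<sigma> (c \<cdot> x) = cnj c \<cdot> \<sigma> x" "\<sigma> (\<sigma> x) = x"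
      "\<sigma> (br x y) = br (\<sigma> x) (\<sigma> y)" for x y c
    using \<sigma> by (auto simp: anti_involution_def)
  have H\<sigma>: "\<sigma> x = x" if "x \<in> H" for x using that H by (auto simp: real_cartan_def real_form_def)
  have HH: "br x y \<in> H" if "x \<in> H" "y \<in> H" for x y
    using H that by (auto simp: real_cartan_def rsubalgebra_def brs_def)
  have Hsub: "RV.subspace H" using H by (auto simp: real_cartan_def rsubalgebra_def rsubspace_def)
  have Hnorm: "x \<in> H" if "\<sigma> x = x" "\<And>y. y \<in> H \<Longrightarrow> br x y \<in> H" for x
    using H that by (auto simp: real_cartan_def real_form_def brs_def)
  obtain k0 where k0: "lcs sm br H k0 = {0}" using H by (auto simp: real_cartan_def rnilpotent_def)
  \<comment> \<open>The lower central series of \<open>H\<close> uses real spans; its complex spans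
    bound both the iterates of \<open>br x\<close> and the derived series of
    \<open>span H\<close>.\<close>
  define C where "C k = span (lcs sm br H k)" for k
  have C: "br x y \<in> C (Suc k)" if x: "x \<in> span H" and y: "y \<in> C k" for x y k
  proof (rule lin_span_subset[OF lin_br_left _ _ x])
    show "subspace (C (Suc k))" by (simp add: C_def)
    fix a assume a: "a \<in> H"
    show "br a y \<in> C (Suc k)"
    proof (rule lin_span_subset[OF lin_br _ _ y[unfolded C_def]])
      show "subspace (C (Suc k))" by (simp add: C_def)
      fix v assume v: "v \<in> lcs sm br H k"
      have "br a v \<in> lcs sm br H (Suc k)"
        using a v by (auto simp: rspan_def brs_def intro!: RV.span_base)
      then show "br a v \<in> C (Suc k)" unfolding C_def by (rule span_base)
    qed
  qed
  have C0: "C 0 = span H" by (simp add: C_def)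
  have Ck0: "C k0 = {0}" by (simp add: C_def k0)
  have hh: "br x y \<in> span H" if x: "x \<in> span H" and y: "y \<in> span H" for x y
  proof (rule lin_span_subset[OF lin_br_left subspace_span _ x])
    fix a assume a: "a \<in> H"
    show "br a y \<in> span H"
      by (rule lin_span_subset[OF lin_br subspace_span _ y]) (use HH a in \<open>auto intro: span_base\<close>)
  qed
  show sub: "subalgebra sm br (span H)" using hh by (simp add: subalgebra_iff)
  show "\<exists>n. (br x ^^ n) y = 0" if "x \<in> span H" "y \<in> span H" for x y
  proof -
    have "(br x ^^ n) y \<in> C n" for n by (induction n) (use that C C0 in auto)
    from this[of k0] Ck0 show ?thesis by auto
  qed
  have "derived sm br (span H) n \<subseteq> span H \<inter> C n" for n
  proof (induction n)
    case 0
    show ?case by (simp add: C0)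
  next
    case (Suc n)
    have "subspace (span H \<inter> C (Suc n))" by (auto simp: C_def intro: subspace_inter)
    moreover have "brs br (derived sm br (span H) n) (derived sm br (span H) n) \<subseteq> span H \<inter> C (Suc n)"
      using Suc hh C unfolding brs_def by blast
    ultimately show ?case by (simp only: derived.simps cspan_eq span_minimal)
  qed
  from this[of k0] Ck0 derived_0[of "span H" k0] show "solvable sm br (span H)"
    unfolding solvable_def by (intro exI[of _ k0]) (auto simp: span_zero)
  show \<sigma>h: "\<sigma> x \<in> span H" if "x \<in> span H" for x
    using that
  proof (induction rule: span_induct_alt)
    case base
    show ?case using \<sigma>_simps(2)[of 0 0] by (simp add: span_zero)
  next
    case (step c x y)
    then show ?case by (simp add: \<sigma>_simps H\<sigma> span_add span_scale span_base)
  qed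
  have decomp: "\<exists>a\<in>H. \<exists>b\<in>H. x = a + \<i> \<cdot> b" if "x \<in> span H" for x
    using that
  proof (induction rule: span_induct_alt)
    case base
    show ?case using RV.subspace_0[OF Hsub] by (intro bexI[of _ 0]) auto
  next
    case (step c x y)
    then obtain a b where ab: "a \<in> H" "b \<in> H" "y = a + \<i> \<cdot> b" by blast
    have "c \<cdot> x = complex_of_real (Re c) \<cdot> x + \<i> \<cdot> complex_of_real (Im c) \<cdot> x"
      by (simp add: scale_left_distrib[symmetric] complex_eq[symmetric])
    then have "c \<cdot> x + y = (complex_of_real (Re c) \<cdot> x + a) + \<i> \<cdot> (complex_of_real (Im c) \<cdot> x + b)"
      by (simp add: ab(3) scale_right_distrib)
    moreover have "complex_of_real (Re c) \<cdot> x + a \<in> H" "complex_of_real (Im c) \<cdot> x + b \<in> H"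
      using RV.subspace_add[OF Hsub RV.subspace_scale[OF Hsub step(1)]] ab by blast+
    ultimately show ?case by blast
  qed
  have fixed: "x \<in> H" if x: "x \<in> span H" "\<sigma> x = x" for x
  proof -
    obtain a b where ab: "a \<in> H" "b \<in> H" "x = a + \<i> \<cdot> b" using decomp[OF x(1)] by blast
    have "\<sigma> x = a - \<i> \<cdot> b" using ab by (simp add: \<sigma>_simps H\<sigma> scale_minus_left)
    with x(2) ab(3) have "\<i> \<cdot> b + \<i> \<cdot> b = 0" by (simp add: algebra_simps)
    then have "(2 * \<i>) \<cdot> b = 0" by (metis scale_left_distrib mult_2)
    then show ?thesis using ab by simp
  qed
  show "x \<in> span H" if norm: "\<And>y. y \<in> span H \<Longrightarrow> br x y \<in> span H" for x
  proof -
    have part: "z \<in> H" if z: "\<sigma> z = z" "\<And>y. y \<in> H \<Longrightarrow> br z y \<in> span H" for z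
    proof (rule Hnorm[OF z(1)])
      fix y assume y: "y \<in> H"
      show "br z y \<in> H" by (rule fixed[OF z(2)[OF y]]) (simp add: \<sigma>_simps z(1) H\<sigma>[OF y])
    qed
    have xy: "br x y \<in> span H" "br (\<sigma> x) y \<in> span H" if "y \<in> H" for y
    proof -
      show 1: "br x y \<in> span H" using norm that by (simp add: span_base)
      have "br (\<sigma> x) y = \<sigma> (br x y)" using H\<sigma>[OF that] by (simp add: \<sigma>_simps)
      then show "br (\<sigma> x) y \<in> span H" using \<sigma>h[OF 1] by simp
    qed
    have s1: "\<sigma> (x + \<sigma> x) = x + \<sigma> x" by (simp add: \<sigma>_simps add.commute)
    have s2: "\<sigma> (\<i> \<cdot> (x - \<sigma> x)) = \<i> \<cdot> (x - \<sigma> x)"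
    proof -
      have "x - \<sigma> x = x + (-1) \<cdot> \<sigma> x" by (simp add: scale_minus_left)
      then show ?thesis by (simp only: \<sigma>_simps) (simp add: scale_minus_left algebra_simps)
    qed
    have "x + \<sigma> x \<in> H" by (rule part[OF s1]) (use xy in \<open>simp add: br_add_left span_add\<close>)
    moreover have "\<i> \<cdot> (x - \<sigma> x) \<in> H"
      by (rule part[OF s2]) (use xy in \<open>simp add: br_scale_left br_diff span_scale span_diff\<close>)
    \<comment> \<open>The coefficient -\<i>/2 cancels the factor \<i> that made the second part
      fixed by \<open>\<sigma>\<close>, leaving half the sum plus half the difference.\<close>
    ultimately have "(1/2) \<cdot> (x + \<sigma> x) + (- \<i> / 2) \<cdot> \<i> \<cdot> (x - \<sigma> x) \<in> span H"
      by (intro span_add span_scale span_base)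
    moreover have "(1/2) \<cdot> (x + \<sigma> x) + (- \<i> / 2) \<cdot> \<i> \<cdot> (x - \<sigma> x) = (1/2) \<cdot> (x + x)"
      by (simp add: scale_right_distrib scale_right_diff_distrib)
    moreover have "(1/2) \<cdot> (x + x) = x"
      by (simp add: scale_right_distrib scale_left_distrib[symmetric])
    ultimately show ?thesis by simp
  qed
qed

end

theorem theorem5p21:
  fixes sm :: "complex \<Rightarrow> 'g::ab_group_add \<Rightarrow> 'g"
    and br :: "'g \<Rightarrow> 'g \<Rightarrow> 'g"
    and \<sigma> :: "'g \<Rightarrow> 'g"
    and q h\<^sub>\<sigma> :: "'g set"
  assumes "semisimple sm br"
    and "anti_involution sm br \<sigma>"
    and "parabolic sm br q"
    and "real_cartan sm br (real_form \<sigma>) h\<^sub>\<sigma>"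
    and "h\<^sub>\<sigma> \<subseteq> q \<inter> real_form \<sigma>"
    and "\<forall>w \<in> weyl sm br (cspan sm h\<^sub>\<sigma>).
           cr_dim sm \<sigma> q \<le> cr_dim sm \<sigma>
             (q_w sm br (cspan sm h\<^sub>\<sigma>) (parabolic_set sm br (cspan sm h\<^sub>\<sigma>) q) w)"
  shows "\<forall>\<alpha> \<in> nilpart (parabolic_set sm br (cspan sm h\<^sub>\<sigma>) q).
           root_inv sm br (cspan sm h\<^sub>\<sigma>) \<sigma> \<alpha> \<notin> parabolic_set sm br (cspan sm h\<^sub>\<sigma>) q
           \<longrightarrow> root_inv sm br (cspan sm h\<^sub>\<sigma>) \<sigma> \<alpha> = - \<alpha>"
proof -
  have lie: "lie_algebra sm br" and fd: "fin_dim sm" using assms(1) by (auto simp: semisimple_def)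
  interpret vector_space sm using lie by (simp add: lie_algebra_def)
  obtain A where A: "finite A" "span A = UNIV" using fd by (auto simp: fin_dim_def cspan_def)
  \<comment> \<open>The locales fix a finite basis, while \<open>fin_dim\<close> only provides a
    finite spanning set.\<close>
  obtain Basis where Basis: "Basis \<subseteq> A" "independent Basis" "A \<subseteq> span Basis"
    using maximal_independent_subset[of A] by blast
  have "span Basis = UNIV" using A(2) span_minimal[OF Basis(3)] by auto
  then interpret semisimple_lie sm Basis br
    using Basis A(1) lie assms(1) by unfold_locales (auto intro: finite_subset)
  let ?h = "cspan sm h\<^sub>\<sigma>"
  note C = complexified_cartan[OF assms(2,4), folded cspan_eq]
  have "subspace q" using assms(3) by (auto simp: parabolic_def subalgebra_iff)
  then have "?h \<subseteq> q" using assms(5) by (simp add: cspan_eq span_minimal)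
  then interpret cr_lie sm Basis br ?h q \<sigma>
    by unfold_locales (use C assms in blast)+
  show ?thesis using minimal_type[OF assms(6)] by blast
qed

end
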